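(* Every d-minimal expansion $\mathcal F=(F,<,+,\cdot,0,1,\ldots)$ of an ordered field is a definably complete expansion of an ordered field which enjoys the definable choice property, admits a good $(0+)$-pseudo-filter $\mathfrak D$, and has a good extended rank function $\operatorname{eRank}$.
   Context: Let $\mathcal F=(F,<,\ldots)$ be an expansion of a dense linear order without endpoints. "Definable" means definable in $\mathcal F$ with parameters; a definable map is a map between definable sets whose graph is definable. $F$ carries the order topology, $F^n$ the product topology, and subsets of $F^n$ the relative topology. $\mathcal F$ is definably complete if every definable subset of $F$ has both a supremum and an infimum in $F\cup\{\pm\infty\}$. $\mathcal F$ is d-minimal if it is definably complete and every definable subset of $F$ is the union of an open set and finitely many discrete sets, where the number of discrete sets does not depend on the parameters of definition (i.e. for every definable $A\subseteq F^{m+1}$ there is $N\in\mathbb N$ such that for every $x\in F^m$ the fiber $\{y\in F\mid (x,y)\in A\}$ is the union of an open set and at most $N$ discrete sets). Definable choice property: (1) for every coordinate projection $\pi:F^{m+n}\to F^m$ and definable sets $X\subseteq F^m$, $Y\subseteq F^{m+n}$ with $\pi(Y)=X$, there is a definable map $\varphi:X\to Y$ with $\pi(\varphi(x))=x$ for all $x\in X$; (2) for every definable equivalence relation $E$ on a definable set $X$ (i.e. $E\subseteq X\times X$ is definable and is an equivalence relation) there is a definable subset $S\subseteq X$ meeting each equivalence class of $E$ in exactly one point. Good $(0+)$-pseudo-filter: let $\mathfrak D$ be a nonempty family of definable subsets of $(0,\infty)$ whose closure in $F$ contains $0$. For a definable set $D\subseteq(0,\infty)$ with $0$ in its closure and a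 definable map $f:D\to F^n$, the limit set $\operatorname{Lim}(f)$ is the set of $p\in F^n$ such that $f^{-1}(B)\cap I\neq\emptyset$ for every open box $B\subseteq F^n$ containing $p$ and every open interval $I$ containing $0$. $\mathfrak D$ is a good $(0+)$-pseudo-filter if: (a) each $D\in\mathfrak D$ is bounded in $F$ and $\operatorname{cl}_F(D)=D\cup\{0\}$; (b) for each $D\in\mathfrak D$ and definable $D_1,D_2$ with $D=D_1\cup D_2$, either $D_1$ or $D_2$ contains an element of $\mathfrak D$; (c) for $D\in\mathfrak D$ and a definable map $\gamma:D\to F^n$, there is $D'\in\mathfrak D$ with $D'\subseteq D$ such that $\gamma|_{D'}$ is continuous; furthermore, if $\operatorname{Lim}(\gamma)\ne\emptyset$, $D'$ can be taken so that $\operatorname{Lim}(\gamma|_{D'})$ is a singleton. $\mathcal F$ admits a good $(0+)$-pseudo-filter if one exists. Good extended rank function: for each $n\ge 0$, let $\operatorname{Def}(F^n)$ be the set of definable subsets of $F^n$. $\mathcal F$ has a good extended rank function if for each $n$ there is a map $\operatorname{eRank}_n:\operatorname{Def}(F^n)\to\mathcal E_n\cup\{-\infty\}$ such that: (a) $\mathcal E_n$ is a linearly ordered set with a smallest element and $-\infty$ is smaller than any element of $\mathcal E_n$; (b) $\operatorname{eRank}_n(X)=-\infty$ iff $X=\emptyset$; (c) there is no infinite strictly decreasing sequence in $\mathcal E_n$; (d) $\operatorname{eRank}_n(A\cup B)=\max\{\operatorname{eRank}_n(A),\operatorname{eRank}_n(B)\}$; (e) if $X\subseteq Y$ are in $\operatorname{Def}(F^n)$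 and $\operatorname{eRank}_n(X)=\operatorname{eRank}_n(Y)$, there is a definable subset $U$ of $X$ that is open in $Y$ with $\operatorname{eRank}_n(X\setminus U)<\operatorname{eRank}_n(Y)$; (f) a nonempty $X\in\operatorname{Def}(F^n)$ is discrete whenever $\operatorname{eRank}_n(X)$ is the smallest element of $\mathcal E_n$.
   Formalization: In the definition of a good extended rank function, clause (e) is required only for nonempty X; as written it fails for X = Y = ∅, where it would demand −∞ < −∞. *)

theory Defs
  imports "HOL-Analysis.Analysis" "HOL-Library.Extended" "HOL-Library.Lub_Glb"
begin

section \<open>First-order structures and definable sets\<close>

text \<open>
  A one-sorted first-order structure whose universe is the whole type \<^typ>\<open>'a\<close>. The language consists
  of the symbols in \<open>fun_syms\<close> and \<open>rel_syms\<close>; constants are function symbols of arity 0.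
  Interpretations matter only on argument lists of the right length.
\<close>

record ('a, 'f, 'r) fo_structure =
  fun_syms :: "'f set"
  rel_syms :: "'r set"
  fun_arity :: "'f \<Rightarrow> nat"
  rel_arity :: "'r \<Rightarrow> nat"
  fun_interp :: "'f \<Rightarrow> 'a list \<Rightarrow> 'a"
  rel_interp :: "'r \<Rightarrow> 'a list \<Rightarrow> bool"

datatype 'f fo_term = Var nat | Fun 'f "'f fo_term list"

datatype ('f, 'r) fo_formula =
    Equal "'f fo_term" "'f fo_term"
  | Rel 'r "'f fo_term list"
  | Neg "('f, 'r) fo_formula"
  | Conj "('f, 'r) fo_formula" "('f, 'r) fo_formula"
  | Exi nat "('f, 'r) fo_formula"

fun wf_term :: "('a, 'f, 'r) fo_structure \<Rightarrow> 'f fo_term \<Rightarrow> bool" where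
  "wf_term M (Var i) \<longleftrightarrow> True"
| "wf_term M (Fun f ts) \<longleftrightarrow>
     f \<in> fun_syms M \<and> length ts = fun_arity M f \<and> (\<forall>t\<in>set ts. wf_term M t)"

primrec wf_formula :: "('a, 'f, 'r) fo_structure \<Rightarrow> ('f, 'r) fo_formula \<Rightarrow> bool" where
  "wf_formula M (Equal s t) \<longleftrightarrow> wf_term M s \<and> wf_term M t"
| "wf_formula M (Rel r ts) \<longleftrightarrow>
     r \<in> rel_syms M \<and> length ts = rel_arity M r \<and> (\<forall>t\<in>set ts. wf_term M t)"
| "wf_formula M (Neg p) \<longleftrightarrow> wf_formula M p"
| "wf_formula M (Conj p q) \<longleftrightarrow> wf_formula M p \<and> wf_formula M q"
| "wf_formula M (Exi i p) \<longleftrightarrow> wf_formula M p"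

fun term_val :: "('a, 'f, 'r) fo_structure \<Rightarrow> (nat \<Rightarrow> 'a) \<Rightarrow> 'f fo_term \<Rightarrow> 'a" where
  "term_val M s (Var i) = s i"
| "term_val M s (Fun f ts) = fun_interp M f (map (term_val M s) ts)"

primrec satisfies :: "('a, 'f, 'r) fo_structure \<Rightarrow> (nat \<Rightarrow> 'a) \<Rightarrow> ('f, 'r) fo_formula \<Rightarrow> bool" where
  "satisfies M s (Equal t u) \<longleftrightarrow> term_val M s t = term_val M s u"
| "satisfies M s (Rel r ts) \<longleftrightarrow> rel_interp M r (map (term_val M s) ts)"
| "satisfies M s (Neg p) \<longleftrightarrow> \<not> satisfies M s p"
| "satisfies M s (Conj p q) \<longleftrightarrow> satisfies M s p \<and> satisfies M s q"
| "satisfies M s (Exi i p) \<longleftrightarrow> (\<exists>a. satisfies M (s(i := a)) p)"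

text \<open>
  \<open>F\<^sup>n\<close> is the set of extensional functions on \<open>{..<n}\<close>, which is the underlying set of
  the product topology on \<open>n\<close> copies of \<open>F\<close>. Via \<open>pt\<close> and \<open>cat\<close> we identify \<open>F\<close> with \<open>F\<^sup>1\<close> and
  \<open>F\<^sup>m \<times> F\<^sup>n\<close> with \<open>F\<^sup>m\<^sup>+\<^sup>n\<close>.
\<close>

definition Fspace :: "nat \<Rightarrow> (nat \<Rightarrow> 'a) set" where
  "Fspace n = (\<Pi>\<^sub>E i\<in>{..<n}. UNIV)"

definition Ftop :: "nat \<Rightarrow> (nat \<Rightarrow> 'a::linorder_topology) topology" where
  "Ftop n = product_topology (\<lambda>i. euclidean) {..<n}"

definition pt :: "'a \<Rightarrow> nat \<Rightarrow> 'a" where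
  "pt a = (\<lambda>i\<in>{..<1}. a)"

definition cat :: "nat \<Rightarrow> (nat \<Rightarrow> 'a) \<Rightarrow> (nat \<Rightarrow> 'a) \<Rightarrow> nat \<Rightarrow> 'a" where
  "cat m x y = (\<lambda>i. if i < m then x i else y (i - m))"

text \<open>
  Definable with parameters: the variables \<open>0, \<dots>, n - 1\<close> stand for the coordinates, and
  the other free variables of the formula take the values of the parameters, given by \<open>b\<close>.
\<close>

definition definable :: "('a, 'f, 'r) fo_structure \<Rightarrow> nat \<Rightarrow> (nat \<Rightarrow> 'a) set \<Rightarrow> bool" where
  "definable M n X \<longleftrightarrow>
     (\<exists>p b. wf_formula M p \<and>
        X = {x \<in> Fspace n. satisfies M (\<lambda>i. if i < n then x i else b i) p})"

definition definable1 :: "('a, 'f, 'r) fo_structure \<Rightarrow> 'a set \<Rightarrow> bool" where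
  "definable1 M A \<longleftrightarrow> definable M 1 (pt ` A)"

definition definable_map ::
  "('a, 'f, 'r) fo_structure \<Rightarrow> nat \<Rightarrow> nat \<Rightarrow> (nat \<Rightarrow> 'a) set \<Rightarrow> (nat \<Rightarrow> 'a) set
     \<Rightarrow> ((nat \<Rightarrow> 'a) \<Rightarrow> nat \<Rightarrow> 'a) \<Rightarrow> bool" where
  "definable_map M m n X Y f \<longleftrightarrow>
     definable M m X \<and> definable M n Y \<and> f \<in> X \<rightarrow> Y \<and>
     definable M (m + n) ((\<lambda>x. cat m x (f x)) ` X)"

definition definable_map1 ::
  "('a, 'f, 'r) fo_structure \<Rightarrow> nat \<Rightarrow> 'a set \<Rightarrow> ('a \<Rightarrow> nat \<Rightarrow> 'a) \<Rightarrow> bool" where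
  "definable_map1 M n D f \<longleftrightarrow>
     definable1 M D \<and> f \<in> D \<rightarrow> Fspace n \<and>
     definable M (1 + n) ((\<lambda>t. cat 1 (pt t) (f t)) ` D)"

section \<open>Expansions of ordered fields, definable completeness, d-minimality\<close>

definition expands_ordered_field :: "('a::linordered_field, 'f, 'r) fo_structure \<Rightarrow> bool" where
  "expands_ordered_field M \<longleftrightarrow>
     (\<exists>r\<in>rel_syms M. rel_arity M r = 2 \<and> (\<forall>x y. rel_interp M r [x, y] \<longleftrightarrow> x < y)) \<and>
     (\<exists>f\<in>fun_syms M. fun_arity M f = 2 \<and> (\<forall>x y. fun_interp M f [x, y] = x + y)) \<and>
     (\<exists>f\<in>fun_syms M. fun_arity M f = 2 \<and> (\<forall>x y. fun_interp M f [x, y] = x * y)) \<and>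
     (\<exists>f\<in>fun_syms M. fun_arity M f = 0 \<and> fun_interp M f [] = 0) \<and>
     (\<exists>f\<in>fun_syms M. fun_arity M f = 0 \<and> fun_interp M f [] = 1)"

definition definably_complete :: "('a::linorder, 'f, 'r) fo_structure \<Rightarrow> bool" where
  "definably_complete M \<longleftrightarrow>
     (\<forall>A. definable1 M A \<longrightarrow>
        (\<exists>s :: 'a extended. isLub UNIV (Fin ` A) s) \<and>
        (\<exists>s :: 'a extended. isGlb UNIV (Fin ` A) s))"

definition d_minimal :: "('a::linorder_topology, 'f, 'r) fo_structure \<Rightarrow> bool" where
  "d_minimal M \<longleftrightarrow>
     definably_complete M \<and>
     (\<forall>m A. definable M (m + 1) A \<longrightarrow>
        (\<exists>N. \<forall>x\<in>Fspace m. \<exists>U \<D>.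
           open U \<and> finite \<D> \<and> card \<D> \<le> N \<and> (\<forall>S\<in>\<D>. discrete S) \<and>
           {y. cat m x (pt y) \<in> A} = U \<union> \<Union>\<D>))"

section \<open>Definable choice\<close>

text \<open>
  A coordinate projection \<open>F\<^sup>m\<^sup>+\<^sup>n \<rightarrow> F\<^sup>m\<close> selects \<open>m\<close> distinct coordinates, given by an
  injection \<open>\<sigma>\<close>; it need not select the first \<open>m\<close> ones.
\<close>

definition coord_proj :: "nat \<Rightarrow> (nat \<Rightarrow> nat) \<Rightarrow> (nat \<Rightarrow> 'a) \<Rightarrow> nat \<Rightarrow> 'a" where
  "coord_proj m \<sigma> x = (\<lambda>i\<in>{..<m}. x (\<sigma> i))"

definition definable_choice :: "('a, 'f, 'r) fo_structure \<Rightarrow> bool" where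
  "definable_choice M \<longleftrightarrow>
     (\<forall>m n \<sigma> X Y.
        \<sigma> \<in> {..<m} \<rightarrow> {..<m + n} \<and> inj_on \<sigma> {..<m} \<and>
        definable M m X \<and> definable M (m + n) Y \<and> coord_proj m \<sigma> ` Y = X \<longrightarrow>
        (\<exists>\<phi>. definable_map M m (m + n) X Y \<phi> \<and> (\<forall>x\<in>X. coord_proj m \<sigma> (\<phi> x) = x))) \<and>
     (\<forall>n X E.
        definable M n X \<and> equiv X E \<and> definable M (n + n) ((\<lambda>(x, y). cat n x y) ` E) \<longrightarrow>
        (\<exists>S. definable M n S \<and> S \<subseteq> X \<and> (\<forall>C\<in>X // E. \<exists>!s. s \<in> S \<inter> C)))"

section \<open>Good \<open>(0+)\<close>-pseudo-filters\<close>

definition open_interval :: "'a::linorder set \<Rightarrow> bool" where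
  "open_interval I \<longleftrightarrow> (\<exists>a b. I = {x. a < Fin x \<and> Fin x < b})"

definition open_box :: "nat \<Rightarrow> (nat \<Rightarrow> 'a::linorder) set \<Rightarrow> bool" where
  "open_box n B \<longleftrightarrow> (\<exists>J. (\<forall>i<n. open_interval (J i)) \<and> B = (\<Pi>\<^sub>E i\<in>{..<n}. J i))"

text \<open>\<open>Lim_set n D f\<close> is the limit set of \<open>f\<close> restricted to \<open>D\<close>, as a map into \<open>F\<^sup>n\<close>.\<close>

definition Lim_set ::
  "nat \<Rightarrow> 'a::{zero, linorder} set \<Rightarrow> ('a \<Rightarrow> nat \<Rightarrow> 'a) \<Rightarrow> (nat \<Rightarrow> 'a) set" where
  "Lim_set n D f =
     {p \<in> Fspace n. \<forall>B I. open_box n B \<and> p \<in> B \<and> open_interval I \<and> 0 \<in> I \<longrightarrow>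
                     (f -` B \<inter> D) \<inter> I \<noteq> {}}"

definition good_pseudo_filter ::
  "('a::{zero, linorder_topology}, 'f, 'r) fo_structure \<Rightarrow> 'a set set \<Rightarrow> bool" where
  "good_pseudo_filter M \<DD> \<longleftrightarrow>
     \<DD> \<noteq> {} \<and>
     (\<forall>D\<in>\<DD>. definable1 M D \<and> D \<subseteq> {0<..} \<and> 0 \<in> closure D) \<and>
     (\<forall>D\<in>\<DD>. bdd_below D \<and> bdd_above D \<and> closure D = D \<union> {0}) \<and>
     (\<forall>D\<in>\<DD>. \<forall>D1 D2. definable1 M D1 \<and> definable1 M D2 \<and> D = D1 \<union> D2 \<longrightarrow>
        (\<exists>D'\<in>\<DD>. D' \<subseteq> D1) \<or> (\<exists>D'\<in>\<DD>. D' \<subseteq> D2)) \<and>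
     (\<forall>D\<in>\<DD>. \<forall>n \<gamma>. definable_map1 M n D \<gamma> \<longrightarrow>
        (\<exists>D'\<in>\<DD>. D' \<subseteq> D \<and>
           continuous_map (subtopology euclidean D') (Ftop n) \<gamma> \<and>
           (Lim_set n D \<gamma> \<noteq> {} \<longrightarrow> is_singleton (Lim_set n D' \<gamma>))))"

definition admits_good_pseudo_filter ::
  "('a::{zero, linorder_topology}, 'f, 'r) fo_structure \<Rightarrow> bool" where
  "admits_good_pseudo_filter M \<longleftrightarrow> (\<exists>\<DD>. good_pseudo_filter M \<DD>)"

section \<open>Good extended rank functions\<close>

text \<open>
  \<open>E\<close> with the reflexive linear order \<open>le\<close> is the linearly ordered set of ranks; \<^term>\<open>None\<close>
  plays the role of \<open>-\<infinity>\<close>.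
\<close>

fun rank_le :: "'e rel \<Rightarrow> 'e option \<Rightarrow> 'e option \<Rightarrow> bool" where
  "rank_le le None v \<longleftrightarrow> True"
| "rank_le le (Some a) None \<longleftrightarrow> False"
| "rank_le le (Some a) (Some b) \<longleftrightarrow> (a, b) \<in> le"

definition rank_less :: "'e rel \<Rightarrow> 'e option \<Rightarrow> 'e option \<Rightarrow> bool" where
  "rank_less le u v \<longleftrightarrow> rank_le le u v \<and> u \<noteq> v"

definition rank_max :: "'e rel \<Rightarrow> 'e option \<Rightarrow> 'e option \<Rightarrow> 'e option" where
  "rank_max le u v = (if rank_le le u v then v else u)"

text \<open>
  In the last clause but one \<open>X\<close> is taken nonempty: no value lies below the rank \<open>-\<infinity>\<close> of the
  empty set, so the clause could not hold for \<open>X = Y = \<emptyset>\<close>.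
\<close>

definition good_extended_rank ::
  "('a::linorder_topology, 'f, 'r) fo_structure \<Rightarrow> nat \<Rightarrow> 'e set \<Rightarrow> 'e rel
     \<Rightarrow> ((nat \<Rightarrow> 'a) set \<Rightarrow> 'e option) \<Rightarrow> bool" where
  "good_extended_rank M n E le eRank \<longleftrightarrow>
     eRank \<in> {X. definable M n X} \<rightarrow> insert None (Some ` E) \<and>
     linear_order_on E le \<and> (\<exists>e\<in>E. \<forall>e'\<in>E. (e, e') \<in> le) \<and>
     (\<forall>X. definable M n X \<longrightarrow> (eRank X = None \<longleftrightarrow> X = {})) \<and>
     \<not> (\<exists>s :: nat \<Rightarrow> 'e. \<forall>i. s i \<in> E \<and> (s (Suc i), s i) \<in> le \<and> s (Suc i) \<noteq> s i) \<and>
     (\<forall>A B. definable M n A \<and> definable M n B \<longrightarrow>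
        eRank (A \<union> B) = rank_max le (eRank A) (eRank B)) \<and>
     (\<forall>X Y. definable M n X \<and> definable M n Y \<and> X \<noteq> {} \<and> X \<subseteq> Y \<and> eRank X = eRank Y \<longrightarrow>
        (\<exists>U. definable M n U \<and> U \<subseteq> X \<and> openin (subtopology (Ftop n) Y) U \<and>
             rank_less le (eRank (X - U)) (eRank Y))) \<and>
     (\<forall>X e. definable M n X \<and> X \<noteq> {} \<and>
        eRank X = Some e \<and> (\<forall>e'\<in>E. (e, e') \<in> le) \<longrightarrow>
        subtopology (Ftop n) X = discrete_topology X)"

text \<open>
  The set of ranks is sought inside the type of subsets of \<open>nat \<Rightarrow> 'a\<close>. This loses no
  generality: given a good rank function with values in any linearly ordered set, discard all
  ranks that are neither attained nor smallest, represent an attained rank by a nonempty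
  definable set having it, and represent the smallest one, if it is not attained, by the empty set.
\<close>

definition has_good_extended_rank :: "('a::linorder_topology, 'f, 'r) fo_structure \<Rightarrow> bool" where
  "has_good_extended_rank M \<longleftrightarrow>
     (\<forall>n. \<exists>(E :: (nat \<Rightarrow> 'a) set set) le eRank. good_extended_rank M n E le eRank)"

end

theory Submission
  imports Defs
begin

text \<open>Every definable subset of \<open>F\<close> without interior is nowhere dense, being a finite union of
  discrete sets, and its iterated derived sets vanish after uniformly many steps. This gives a Baire
  property: an increasing definable family of nowhere dense sets cannot exhaust an interval,
  because the family of the last nonvanishing derived sets would order an interval like a
  sequence, and such an order defines a dense and codense set. From the Baire property, induction on
  the number of coordinates shows that finite unions of definable sets without interior have no
  interior, and that definable functions have arbitrarily small oscillation on some ball.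

  Choice: a definable subset of \<open>F\<close> contains canonical nonempty closed bounded definable sets,
  and these have least elements. Pseudo-filter: either there is a definable sequence-like set
  decreasing to \<open>0\<close>, and one takes all such sets, or all definable sets are constant germs at
  \<open>0+\<close>, and one takes the intervals \<open>(0, e]\<close>. Rank: to a definable set one assigns the pair of its
  dimension and the largest number of fibrewise derived sets (with respect to a coordinate
  projection) that survives over an open set of the base, ordered lexicographically.\<close>

section \<open>Closure properties of definable predicates\<close>

text \<open>The field may be non-archimedean and of any cofinality, so in general neither sequences
  nor countable unions help; the only finite quantity at hand is the uniform number of discrete
  pieces, which bounds the number of derived sets over a whole family. Both the Baire argument and
  the rank count derivations instead of points. Predicates live on environments
  \<open>nat => 'a\<close>, not on \<open>Fspace n\<close>: any finite set of coordinates can move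
  while all the others act as parameters, so inductions over coordinates and projections onto
  arbitrary coordinate sets need no reindexing. The chosen point of a set depends on that set alone.
  This is why one choice lemma yields both sections of projections and representatives of
  equivalence classes. The rank is built so that a nonempty subset containing no relatively open
  piece of the larger set has strictly smaller rank. Removing from \<open>X\<close> its interior
  relative to \<open>Y\<close> leaves such a subset of \<open>Y\<close>, and a point that is not
  isolated in \<open>X\<close> is such a subset of \<open>X\<close>; hence clauses (e) and (f) have
  the same source.\<close>

definition mix :: "(nat \<Rightarrow> 'a) \<Rightarrow> (nat \<Rightarrow> 'a) \<Rightarrow> nat \<Rightarrow> 'a" where
  "mix s b = (\<lambda>i. if even i then s (i div 2) else b (i div 2))"

lemma mix_even [simp]: "mix s b (2 * i) = s i"
  and mix_odd [simp]: "mix s b (Suc (2 * i)) = b i"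
  by (auto simp: mix_def)

lemma mix_upd_even: "mix (s(i := a)) b = (mix s b)(2 * i := a)"
  by (auto simp: mix_def fun_eq_iff)

text \<open>Predicates on environments, with the even variables for the arguments and the odd ones for
  the parameters, so that both supplies of variables are infinite.\<close>

definition dfn :: "('a, 'f, 'r) fo_structure \<Rightarrow> ((nat \<Rightarrow> 'a) \<Rightarrow> bool) \<Rightarrow> bool" where
  "dfn M P \<longleftrightarrow> (\<exists>p b. wf_formula M p \<and> (\<forall>s. P s \<longleftrightarrow> satisfies M (mix s b) p))"

text \<open>The value is variable 0 and the arguments are shifted up by one. \<open>dfam\<close>
  uses the same convention for a point of a set and its parameters, and \<open>dfn_ex\<close> and
  \<open>dfn_all\<close> strip variable 0 again, so definitions nest without naming
  variables.\<close>

definition dterm :: "('a, 'f, 'r) fo_structure \<Rightarrow> ((nat \<Rightarrow> 'a) \<Rightarrow> 'a) \<Rightarrow> bool" where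
  "dterm M t \<longleftrightarrow> dfn M (\<lambda>s. s 0 = t (\<lambda>i. s (Suc i)))"

abbreviation dset :: "('a, 'f, 'r) fo_structure \<Rightarrow> (nat \<Rightarrow> 'a) set \<Rightarrow> bool" where
  "dset M A \<equiv> dfn M (\<lambda>s. s \<in> A)"

definition dfam :: "('a, 'f, 'r) fo_structure \<Rightarrow> ((nat \<Rightarrow> 'a) \<Rightarrow> 'a set) \<Rightarrow> bool" where
  "dfam M S \<longleftrightarrow> dfn M (\<lambda>s. s 0 \<in> S (\<lambda>i. s (Suc i)))"

section \<open>Finite support and renaming of variables\<close>

lemma uniform_bound_list:
  fixes B :: "'b \<Rightarrow> nat \<Rightarrow> bool"
  assumes "\<And>t. t \<in> set ts \<Longrightarrow> \<exists>k. B t k" "\<And>t k k'. B t k \<Longrightarrow> k \<le> k' \<Longrightarrow> B t k'"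
  shows "\<exists>k. \<forall>t\<in>set ts. B t k"
  using assms(1)
proof (induction ts)
  case (Cons t ts)
  obtain k where k: "B t k" using Cons.prems[of t] by auto
  obtain k' where k': "\<forall>t\<in>set ts. B t k'" using Cons.IH Cons.prems by (meson list.set_intros(2))
  have "B t (max k k')" using assms(2)[OF k] by simp
  moreover have "B u (max k k')" if "u \<in> set ts" for u
    using assms(2)[of u k'] k' that by simp
  ultimately show ?case by (intro exI[of _ "max k k'"]) simp
qed simp

text \<open>A term mentions finitely many variables. Stated semantically, this replaces a syntactic
  notion of free variable; it supplies fresh variables for renaming and ends substitution after
  finitely many steps.\<close>

lemma term_val_finite_support:
  "\<exists>k. \<forall>s s'. (\<forall>i<k. s i = s' i) \<longrightarrow> term_val M s t = term_val M s' t"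
proof (induction t)
  case (Var x)
  show ?case by (rule exI[of _ "Suc x"]) auto
next
  case (Fun f ts)
  have "\<exists>k. \<forall>t\<in>set ts. \<forall>s s'. (\<forall>i<k. s i = s' i) \<longrightarrow> term_val M s t = term_val M s' t"
    by (rule uniform_bound_list) (use Fun in blast, meson order_less_le_trans)
  then obtain k where
    k: "\<forall>t\<in>set ts. \<forall>s s'. (\<forall>i<k. s i = s' i) \<longrightarrow> term_val M s t = term_val M s' t" by blast
  show ?case
  proof (intro exI allI impI)
    fix s s' :: "nat \<Rightarrow> 'a" assume "\<forall>i<k. s i = s' i"
    then have "map (term_val M s) ts = map (term_val M s') ts" using k by auto
    then show "term_val M s (Fun f ts) = term_val M s' (Fun f ts)" by (simp only: term_val.simps)
  qed
qed

lemma satisfies_finite_support: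
  "\<exists>k. \<forall>s s'. (\<forall>i<k. s i = s' i) \<longrightarrow> satisfies M s p = satisfies M s' p"
proof (induction p)
  case (Neg p)
  then show ?case by simp
next
  case (Equal t u)
  obtain k where k: "\<forall>s s'. (\<forall>i<k. s i = s' i) \<longrightarrow> term_val M s t = term_val M s' t"
    using term_val_finite_support by blast
  obtain k' where k': "\<forall>s s'. (\<forall>i<k'. s i = s' i) \<longrightarrow> term_val M s u = term_val M s' u"
    using term_val_finite_support by blast
  have "satisfies M s (Equal t u) = satisfies M s' (Equal t u)"
    if "\<forall>i<max k k'. s i = s' i" for s s'
    using k[rule_format, of s s'] k'[rule_format, of s s'] that by simp
  then show ?case by blast
next
  case (Rel r ts)
  have "\<exists>k. \<forall>t\<in>set ts. \<forall>s s'. (\<forall>i<k. s i = s' i) \<longrightarrow> term_val M s t = term_val M s' t"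
    by (rule uniform_bound_list) (rule term_val_finite_support, meson order_less_le_trans)
  then obtain k where
    k: "\<forall>t\<in>set ts. \<forall>s s'. (\<forall>i<k. s i = s' i) \<longrightarrow> term_val M s t = term_val M s' t" by blast
  show ?case
  proof (intro exI allI impI)
    fix s s' :: "nat \<Rightarrow> 'a" assume "\<forall>i<k. s i = s' i"
    then have "map (term_val M s) ts = map (term_val M s') ts" using k by auto
    then show "satisfies M s (Rel r ts) = satisfies M s' (Rel r ts)" by (simp only: satisfies.simps)
  qed
next
  case (Conj p q)
  obtain k where k: "\<forall>s s'. (\<forall>i<k. s i = s' i) \<longrightarrow> satisfies M s p = satisfies M s' p"
    using Conj.IH(1) by blast
  obtain k' where k': "\<forall>s s'. (\<forall>i<k'. s i = s' i) \<longrightarrow> satisfies M s q = satisfies M s' q"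
    using Conj.IH(2) by blast
  have "satisfies M s (Conj p q) = satisfies M s' (Conj p q)"
    if "\<forall>i<max k k'. s i = s' i" for s s'
    using k[rule_format, of s s'] k'[rule_format, of s s'] that by simp
  then show ?case by blast
next
  case (Exi i p)
  then obtain k where
    k: "\<forall>s s'. (\<forall>i<k. s i = s' i) \<longrightarrow> satisfies M s p = satisfies M s' p" by blast
  show ?case
  proof (intro exI allI impI)
    fix s s' :: "nat \<Rightarrow> 'a" assume *: "\<forall>i<k. s i = s' i"
    have "satisfies M (s(i := a)) p = satisfies M (s'(i := a)) p" for a
      by (intro k[rule_format]) (use * in auto)
    then show "satisfies M s (Exi i p) = satisfies M s' (Exi i p)" by simp
  qed
qed

fun rename_term :: "(nat \<Rightarrow> nat) \<Rightarrow> 'f fo_term \<Rightarrow> 'f fo_term" where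
  "rename_term f (Var i) = Var (f i)"
| "rename_term f (Fun g ts) = Fun g (map (rename_term f) ts)"

lemma wf_rename_term: "wf_term M t \<Longrightarrow> wf_term M (rename_term f t)"
  by (induction t) auto

lemma term_val_rename_term: "term_val M s (rename_term f t) = term_val M (\<lambda>i. s (f i)) t"
proof (induction t)
  case (Fun g ts)
  then have "map (\<lambda>t. term_val M s (rename_term f t)) ts = map (term_val M (\<lambda>i. s (f i))) ts" by auto
  then show ?case by (simp add: o_def cong: map_cong del: map_eq_conv)
qed auto

text \<open>Only the existence of \<open>p'\<close> is claimed, because a bound variable has to be
  changed when \<open>f\<close> would capture it. The map \<open>f\<close> is arbitrary, so
  variables may also be identified.\<close>

lemma satisfies_rename:
  assumes "wf_formula M p"
  shows "\<exists>p'. wf_formula M p' \<and> (\<forall>s. satisfies M s p' = satisfies M (\<lambda>i. s (f i)) p)"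
  using assms
proof (induction p arbitrary: f)
  case (Equal t u)
  show ?case
    by (rule exI[of _ "Equal (rename_term f t) (rename_term f u)"])
      (use Equal in \<open>simp add: wf_rename_term term_val_rename_term del: comp_apply\<close>)
next
  case (Rel r ts)
  have eq: "map (\<lambda>t. term_val M s (rename_term f t)) ts = map (term_val M (\<lambda>i. s (f i))) ts" for s
    by (auto simp: term_val_rename_term)
  show ?case
    by (rule exI[of _ "Rel r (map (rename_term f) ts)"])
      (use Rel eq in \<open>auto simp: wf_rename_term o_def simp del: map_eq_conv\<close>)
next
  case (Neg p)
  then obtain p' where "wf_formula M p'" "\<forall>s. satisfies M s p' = satisfies M (\<lambda>i. s (f i)) p"
    by (metis wf_formula.simps(3))
  then show ?case by (intro exI[of _ "Neg p'"]) auto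
next
  case (Conj p q)
  then obtain p' q' where "wf_formula M p'" "\<forall>s. satisfies M s p' = satisfies M (\<lambda>i. s (f i)) p"
    "wf_formula M q'" "\<forall>s. satisfies M s q' = satisfies M (\<lambda>i. s (f i)) q"
    by (metis wf_formula.simps(4))
  then show ?case by (intro exI[of _ "Conj p' q'"]) auto
next
  case (Exi i p)
  obtain k where
    k: "\<forall>s s'. (\<forall>i<k. s i = s' i) \<longrightarrow> satisfies M s p = satisfies M s' p"
    using satisfies_finite_support by blast
  \<comment> \<open>The new bound variable \<open>z\<close> exceeds the image of every variable on
    which \<open>p\<close> can depend, so no other variable is captured.\<close>
  obtain z where z: "\<forall>j<k. f j < z"
    using finite_nat_set_iff_bounded[of "f ` {..<k}"] by auto
  obtain p' where p': "wf_formula M p'"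
    "\<forall>s. satisfies M s p' = satisfies M (\<lambda>j. s ((f(i := z)) j)) p"
    using Exi by (metis wf_formula.simps(5))
  have "satisfies M (s(z := a)) p' = satisfies M ((\<lambda>j. s (f j))(i := a)) p" for s a
  proof -
    have "(s(z := a)) ((f(i := z)) j) = ((\<lambda>j. s (f j))(i := a)) j" if "j < k" for j
      using z that by (metis fun_upd_apply order_less_irrefl)
    then have "satisfies M (\<lambda>j. (s(z := a)) ((f(i := z)) j)) p =
        satisfies M ((\<lambda>j. s (f j))(i := a)) p"
      by (intro k[rule_format]) auto
    then show ?thesis using p'(2) by simp
  qed
  then show ?case using p' by (intro exI[of _ "Exi z p'"]) auto
qed

lemma dfn_rename:
  assumes "dfn M P" shows "dfn M (\<lambda>s. P (\<lambda>i. s (f i)))"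
proof -
  obtain p b where p: "wf_formula M p" "\<And>s. P s \<longleftrightarrow> satisfies M (mix s b) p"
    using assms unfolding dfn_def by blast
  define g where "g = (\<lambda>i::nat. if even i then 2 * f (i div 2) else i)"
  obtain p' where p': "wf_formula M p'" "\<And>s. satisfies M s p' = satisfies M (\<lambda>i. s (g i)) p"
    using satisfies_rename[OF p(1)] by metis
  have "(\<lambda>i. mix s b (g i)) = mix (\<lambda>i. s (f i)) b" for s
    by (auto simp: mix_def g_def fun_eq_iff)
  then show ?thesis unfolding dfn_def using p p' by metis
qed

lemma dfn_finite_support:
  assumes "dfn M P" shows "\<exists>k. \<forall>s s'. (\<forall>i<k. s i = s' i) \<longrightarrow> P s = P s'"
proof -
  obtain p b where p: "wf_formula M p" "\<And>s. P s \<longleftrightarrow> satisfies M (mix s b) p"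
    using assms unfolding dfn_def by blast
  obtain k where
    k: "\<forall>s s'. (\<forall>i<k. s i = s' i) \<longrightarrow> satisfies M s p = satisfies M s' p"
    using satisfies_finite_support by blast
  show ?thesis
  proof (intro exI allI impI)
    fix s s' :: "nat \<Rightarrow> 'a" assume "\<forall>i<k. s i = s' i"
    then have "\<forall>i<k. mix s b i = mix s' b i" by (auto simp: mix_def)
    then show "P s = P s'" using k p(2) by metis
  qed
qed

section \<open>A calculus of definable predicates and terms\<close>

named_theorems dfn_intro

lemma dfn_not [dfn_intro]: "dfn M P \<Longrightarrow> dfn M (\<lambda>s. \<not> P s)"
  unfolding dfn_def by (metis satisfies.simps(3) wf_formula.simps(3))

lemma dfn_conj [dfn_intro]:
  assumes "dfn M P" "dfn M Q" shows "dfn M (\<lambda>s. P s \<and> Q s)"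
proof -
  obtain p b where p: "wf_formula M p" "\<And>s. P s \<longleftrightarrow> satisfies M (mix s b) p"
    using assms unfolding dfn_def by blast
  obtain q c where q: "wf_formula M q" "\<And>s. Q s \<longleftrightarrow> satisfies M (mix s c) q"
    using assms unfolding dfn_def by blast
  \<comment> \<open>The parameters \<open>b\<close> and \<open>c\<close> are interleaved into
    \<open>mix b c\<close>; \<open>g\<close> and \<open>h\<close> send the parameters of
    \<open>p\<close> and of \<open>q\<close> to its even and its odd places.\<close>
  define g where "g = (\<lambda>i::nat. if even i then i else Suc (2 * (2 * (i div 2))))"
  define h where "h = (\<lambda>i::nat. if even i then i else Suc (2 * (Suc (2 * (i div 2)))))"
  obtain p' where p': "wf_formula M p'" "\<And>s. satisfies M s p' = satisfies M (\<lambda>i. s (g i)) p"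
    using satisfies_rename[OF p(1)] by metis
  obtain q' where q': "wf_formula M q'" "\<And>s. satisfies M s q' = satisfies M (\<lambda>i. s (h i)) q"
    using satisfies_rename[OF q(1)] by metis
  have "(\<lambda>i. mix s (mix b c) (g i)) = mix s b" for s
    unfolding mix_def g_def fun_eq_iff by (auto elim!: oddE)
  moreover have "(\<lambda>i. mix s (mix b c) (h i)) = mix s c" for s
    unfolding mix_def h_def fun_eq_iff by (auto elim!: oddE)
  ultimately show ?thesis unfolding dfn_def using p p' q q'
    by (intro exI[of _ "Conj p' q'"] exI[of _ "mix b c"]) auto
qed

lemma dfn_disj [dfn_intro]:
  assumes "dfn M P" "dfn M Q" shows "dfn M (\<lambda>s. P s \<or> Q s)"
proof -
  have "dfn M (\<lambda>s. \<not> (\<not> P s \<and> \<not> Q s))" by (intro dfn_intro assms)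
  then show ?thesis by simp
qed

lemma dfn_imp [dfn_intro]:
  assumes "dfn M P" "dfn M Q" shows "dfn M (\<lambda>s. P s \<longrightarrow> Q s)"
  unfolding imp_conv_disj by (intro dfn_intro assms)

lemma dfn_iff [dfn_intro]:
  assumes "dfn M P" "dfn M Q" shows "dfn M (\<lambda>s. P s \<longleftrightarrow> Q s)"
  unfolding iff_conv_conj_imp by (intro dfn_intro assms)

lemma dfn_ex_upd:
  assumes "dfn M P" shows "dfn M (\<lambda>s. \<exists>a. P (s(i := a)))"
proof -
  obtain p b where p: "wf_formula M p" "\<And>s. P s \<longleftrightarrow> satisfies M (mix s b) p"
    using assms unfolding dfn_def by blast
  then show ?thesis unfolding dfn_def
    by (intro exI[of _ "Exi (2 * i) p"] exI[of _ b]) (auto simp: mix_upd_even)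
qed

text \<open>The quantified value occupies variable 0 after the shift; renaming by the predecessor
  then gives the outer variables their own names back.\<close>

lemma dfn_ex [dfn_intro]:
  assumes "dfn M (\<lambda>s. Q (\<lambda>i. s (Suc i)) (s 0))" shows "dfn M (\<lambda>s. \<exists>a. Q s a)"
  using dfn_rename[OF dfn_ex_upd[OF assms, of 0], of "\<lambda>i. i - 1"] by simp

lemma dfn_all [dfn_intro]:
  assumes "dfn M (\<lambda>s. Q (\<lambda>i. s (Suc i)) (s 0))" shows "dfn M (\<lambda>s. \<forall>a. Q s a)"
  using dfn_not[OF dfn_ex[OF dfn_not[OF assms]]] by simp

lemma dfn_eq_const: "dfn M (\<lambda>s. s i = c)"
  unfolding dfn_def
  by (intro exI[of _ "Equal (Var (2 * i)) (Var (Suc (2 * 0)))"] exI[of _ "\<lambda>_. c"])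
    (simp del: mult_0_right mult_zero_right)

lemma dfn_eq_var: "dfn M (\<lambda>s. s i = s j)"
  unfolding dfn_def
  by (intro exI[of _ "Equal (Var (2 * i)) (Var (2 * j))"] exI) simp

lemma dfn_const [dfn_intro]: "dfn M (\<lambda>s. c)"
proof (cases c)
  case True
  then show ?thesis using dfn_eq_var[of M 0 0] by simp
next
  case False
  then show ?thesis using dfn_not[OF dfn_eq_var[of M 0 0]] by simp
qed

lemma dfn_ball_finite:
  assumes "finite I" "\<And>i. i \<in> I \<Longrightarrow> dfn M (\<lambda>s. P i s)"
  shows "dfn M (\<lambda>s. \<forall>i\<in>I. P i s)"
  using assms by (induction I rule: finite_induct) (auto intro!: dfn_intro)

lemma dfn_bex_finite:
  assumes "finite I" "\<And>i. i \<in> I \<Longrightarrow> dfn M (\<lambda>s. P i s)"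
  shows "dfn M (\<lambda>s. \<exists>i\<in>I. P i s)"
  using assms by (induction I rule: finite_induct) (auto intro!: dfn_intro)

lemma dterm_rename: "dterm M t \<Longrightarrow> dterm M (\<lambda>s. t (\<lambda>i. s (f i)))"
  unfolding dterm_def
  by (drule dfn_rename[where f = "\<lambda>i. case i of 0 \<Rightarrow> 0 | Suc j \<Rightarrow> Suc (f j)"]) simp

lemma dterm_var [dfn_intro]: "dterm M (\<lambda>s. s i)"
  unfolding dterm_def by (rule dfn_eq_var)

lemma dterm_const [dfn_intro]: "dterm M (\<lambda>s. c)"
  unfolding dterm_def by (rule dfn_eq_const)

text \<open>Substitution replaces the finitely many relevant variables one at a time; the original
  arguments are kept out of the way by a shift by \<open>k\<close>.\<close>

lemma dfn_subst:
  assumes P: "dfn M P" and g: "\<And>i. dterm M (\<lambda>s. g s i)"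
  shows "dfn M (\<lambda>s. P (g s))"
proof -
  obtain k where k: "\<And>s s'. (\<forall>i<k. s i = s' i) \<Longrightarrow> P s = P s'"
    using dfn_finite_support[OF P] by blast
  have "dfn M (\<lambda>s. P (\<lambda>i. if i < m then g (\<lambda>j. s (j + k)) i else s i))" if "m \<le> k" for m
    using that
  proof (induction m)
    case 0
    then show ?case using P by simp
  next
    case (Suc m)
    have "dfn M (\<lambda>s. s m = g (\<lambda>j. s (j + k)) m)"
      using dfn_rename[OF g[of m, unfolded dterm_def],
          where f = "\<lambda>i. case i of 0 \<Rightarrow> m | Suc j \<Rightarrow> j + k"] by simp
    with Suc have "dfn M (\<lambda>s. s m = g (\<lambda>j. s (j + k)) m \<and>
        P (\<lambda>i. if i < m then g (\<lambda>j. s (j + k)) i else s i))"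
      by (auto intro!: dfn_intro)
    from dfn_ex_upd[OF this, of m] show ?case
    proof (rule back_subst[of "dfn M"], intro ext)
      fix s :: "nat \<Rightarrow> 'a"
      have shift: "(\<lambda>j. (s(m := a)) (j + k)) = (\<lambda>j. s (j + k))" for a
        using Suc.prems by auto
      have slot: "(\<lambda>i. if i < m then g (\<lambda>j. s (j + k)) i
            else (s(m := g (\<lambda>j. s (j + k)) m)) i)
          = (\<lambda>i. if i < Suc m then g (\<lambda>j. s (j + k)) i else s i)"
        by (auto simp: less_Suc_eq fun_eq_iff)
      show "(\<exists>a. (s(m := a)) m = g (\<lambda>j. (s(m := a)) (j + k)) m \<and>
          P (\<lambda>i. if i < m then g (\<lambda>j. (s(m := a)) (j + k)) i else (s(m := a)) i)) =
        P (\<lambda>i. if i < Suc m then g (\<lambda>j. s (j + k)) i else s i)"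
        unfolding shift fun_upd_same by (simp add: slot del: fun_upd_apply)
    qed
  qed
  from this[of k] have "dfn M (\<lambda>s. P (g (\<lambda>j. s (j + k))))"
    by (rule back_subst[of "dfn M"]) (auto intro!: ext k)
  from dfn_rename[OF this, of "\<lambda>i. i - k"] show ?thesis by simp
qed

lemma dterm_subst:
  assumes "dterm M t" "\<And>i. dterm M (\<lambda>s. g s i)" shows "dterm M (\<lambda>s. t (g s))"
proof -
  have "dterm M (\<lambda>s. case i of 0 \<Rightarrow> s 0 | Suc j \<Rightarrow> g (\<lambda>i. s (Suc i)) j)" for i
    by (cases i) (auto intro: dfn_intro dterm_rename[OF assms(2)])
  from dfn_subst[where g = "\<lambda>s i. case i of 0 \<Rightarrow> s 0 | Suc j \<Rightarrow> g (\<lambda>i. s (Suc i)) j",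
      OF assms(1)[unfolded dterm_def] this]
  show ?thesis unfolding dterm_def by simp
qed

lemma dfn_binary:
  assumes "dfn M (\<lambda>s. R (s 0) (s 1))" "dterm M t" "dterm M u" shows "dfn M (\<lambda>s. R (t s) (u s))"
proof -
  have "dterm M (\<lambda>s. case i of 0 \<Rightarrow> t s | Suc _ \<Rightarrow> u s)" for i :: nat
    using assms by (cases i) auto
  from dfn_subst[where g = "\<lambda>s i. case i of 0 \<Rightarrow> t s | Suc _ \<Rightarrow> u s", OF assms(1) this] show ?thesis by simp
qed

lemma dterm_binary:
  assumes "dfn M (\<lambda>s. s 0 = f (s 1) (s 2))" "dterm M t" "dterm M u"
  shows "dterm M (\<lambda>s. f (t s) (u s))"
proof -
  have *: "dterm M (\<lambda>s. f (s 0) (s 1))"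
    unfolding dterm_def using assms(1) by (simp add: numeral_2_eq_2)
  have "dterm M (\<lambda>s. case i of 0 \<Rightarrow> t s | Suc _ \<Rightarrow> u s)" for i :: nat
    using assms by (cases i) auto
  from dterm_subst[where g = "\<lambda>s i. case i of 0 \<Rightarrow> t s | Suc _ \<Rightarrow> u s", OF * this] show ?thesis by simp
qed

lemma dfn_eq [dfn_intro]: "dterm M t \<Longrightarrow> dterm M u \<Longrightarrow> dfn M (\<lambda>s. t s = u s)"
  by (rule dfn_binary[where R = "(=)"]) (rule dfn_eq_var)

lemma dterm_If [dfn_intro]:
  assumes "dfn M P" "dterm M t" "dterm M u" shows "dterm M (\<lambda>s. if P s then t s else u s)"
proof -
  have "dfn M (\<lambda>s. P (\<lambda>i. s (Suc i)) \<and> s 0 = t (\<lambda>i. s (Suc i)) \<or>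
      \<not> P (\<lambda>i. s (Suc i)) \<and> s 0 = u (\<lambda>i. s (Suc i)))"
    using assms by (intro dfn_intro dfn_rename[OF assms(1)] dterm_rename[OF assms(2)]
        dterm_rename[OF assms(3)])
  then show ?thesis unfolding dterm_def by (rule back_subst[of "dfn M"]) auto
qed

lemma dterm_upd [dfn_intro]:
  "dterm M u \<Longrightarrow> dterm M (\<lambda>s. g s i) \<Longrightarrow> dterm M (\<lambda>s. ((g s)(j := u s)) i)"
  by (cases "i = j") auto

text \<open>Definite descriptions are definable terms. This is how the function given by
  \<open>THE\<close> in the choice lemma enters the calculus.\<close>

lemma dterm_unique:
  assumes "dfn M (\<lambda>s. Q (\<lambda>i. s (Suc i)) (s 0))" "\<And>s. Q s (t s)" "\<And>s a. Q s a \<Longrightarrow> a = t s"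
  shows "dterm M t"
proof -
  have "Q (\<lambda>i. s (Suc i)) (s 0) \<longleftrightarrow> s 0 = t (\<lambda>i. s (Suc i))" for s
    using assms(2,3) by metis
  then show ?thesis using assms(1) unfolding dterm_def by simp
qed

lemma dfamD:
  assumes "dfam M S" "dterm M u" "\<And>i. dterm M (\<lambda>s. g s i)" shows "dfn M (\<lambda>s. u s \<in> S (g s))"
proof -
  have "dterm M (\<lambda>s. case i of 0 \<Rightarrow> u s | Suc j \<Rightarrow> g s j)" for i
    using assms by (cases i) auto
  from dfn_subst[where g = "\<lambda>s i. case i of 0 \<Rightarrow> u s | Suc j \<Rightarrow> g s j",
      OF assms(1)[unfolded dfam_def] this]
  show ?thesis by simp
qed

lemma dfn_pred:
  assumes "dfn M (\<lambda>s. P (s 0))" "dterm M t" shows "dfn M (\<lambda>s. P (t s))"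
  by (rule dfn_subst[where g = "\<lambda>s _. t s", OF assms(1)]) (rule assms(2))

text \<open>Bridge to the official notion: there the coordinates come before the parameters, split
  at \<open>n\<close>, whereas here they alternate. Restricting \<open>s\<close> makes the
  coordinates from \<open>n\<close> on invisible.\<close>

lemma definable_iff_dfn:
  "definable M n X \<longleftrightarrow> X \<subseteq> Fspace n \<and> dfn M (\<lambda>s. restrict s {..<n} \<in> X)"
proof
  assume "definable M n X"
  then obtain p b where p: "wf_formula M p"
    and X: "X = {x \<in> Fspace n. satisfies M (\<lambda>i. if i < n then x i else b i) p}"
    unfolding definable_def by blast
  define f where "f = (\<lambda>i. if i < n then 2 * i else Suc (2 * i))"
  obtain p' where p': "wf_formula M p'" "\<And>s. satisfies M s p' = satisfies M (\<lambda>i. s (f i)) p"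
    using satisfies_rename[OF p(1)] by metis
  have "(\<lambda>i. mix s b (f i)) = (\<lambda>i. if i < n then restrict s {..<n} i else b i)" for s
    by (auto simp: f_def fun_eq_iff)
  then have "restrict s {..<n} \<in> X \<longleftrightarrow> satisfies M (mix s b) p'" for s
    using X p'(2) by (simp add: Fspace_def)
  then show "X \<subseteq> Fspace n \<and> dfn M (\<lambda>s. restrict s {..<n} \<in> X)"
    using X p' unfolding dfn_def by auto
next
  assume *: "X \<subseteq> Fspace n \<and> dfn M (\<lambda>s. restrict s {..<n} \<in> X)"
  then obtain p b where p: "wf_formula M p"
      "\<And>s. restrict s {..<n} \<in> X \<longleftrightarrow> satisfies M (mix s b) p"
    unfolding dfn_def by blast
  \<comment> \<open>Coordinates from \<open>n\<close> on all go to the single variable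
    \<open>n\<close>, whose value may be anything because the predicate sees \<open>s\<close> only
    through its restriction; the parameters follow from \<open>n + 1\<close> on.\<close>
  define f where
    "f = (\<lambda>i::nat. if even i then (if i div 2 < n then i div 2 else n) else n + 1 + i div 2)"
  define c where "c = (\<lambda>i. b (i - (n + 1)))"
  obtain p' where p': "wf_formula M p'" "\<And>s. satisfies M s p' = satisfies M (\<lambda>i. s (f i)) p"
    using satisfies_rename[OF p(1)] by metis
  have "x \<in> X \<longleftrightarrow> satisfies M (\<lambda>i. if i < n then x i else c i) p'" if "x \<in> Fspace n" for x
  proof -
    define s where "s = (\<lambda>i. if i < n then x i else c n)"
    have "(\<lambda>i. if f i < n then x (f i) else c (f i)) = mix s b"
      by (auto simp: f_def s_def c_def mix_def fun_eq_iff)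
    moreover have "restrict s {..<n} = x"
      using that by (auto simp: s_def Fspace_def fun_eq_iff PiE_def extensional_def)
    ultimately show ?thesis using p(2)[of s] p'(2)[of "\<lambda>i. if i < n then x i else c i"] by simp
  qed
  then have "X = {x \<in> Fspace n. satisfies M (\<lambda>i. if i < n then x i else c i) p'}"
    using * by blast
  then show "definable M n X" unfolding definable_def using p'(1) by blast
qed

section \<open>Topology of an ordered field\<close>

lemma finite_positive_lower_bound:
  fixes f :: "'b \<Rightarrow> 'a::linordered_field"
  assumes "finite I" "\<And>i. i \<in> I \<Longrightarrow> 0 < f i" shows "\<exists>e>0. \<forall>i\<in>I. e \<le> f i"
  using assms
proof (induction I rule: finite_induct)
  case empty
  show ?case by (intro exI[of _ 1]) simp
next
  case (insert i I)
  then obtain e where e: "0 < e" "\<forall>i\<in>I. e \<le> f i" by auto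
  then show ?case using insert.prems[of i]
    by (intro exI[of _ "min e (f i)"]) (auto simp: min_le_iff_disj)
qed

text \<open>The sort gives an order topology but no metric. In this form openness, and with it
  closure, interior and limit points, becomes a first-order condition that the introduction rules
  for definability can handle.\<close>

lemma open_iff_abs:
  fixes S :: "'a::{linordered_field, linorder_topology} set"
  shows "open S \<longleftrightarrow> (\<forall>x\<in>S. \<exists>e>0. \<forall>y. \<bar>y - x\<bar> < e \<longrightarrow> y \<in> S)"
proof
  assume "open S"
  show "\<forall>x\<in>S. \<exists>e>0. \<forall>y. \<bar>y - x\<bar> < e \<longrightarrow> y \<in> S"
  proof
    fix x assume "x \<in> S"
    obtain b where b: "x < b" "{x..<b} \<subseteq> S"
      using open_right[OF \<open>open S\<close> \<open>x \<in> S\<close>, of "x + 1"] by auto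
    obtain a where a: "a < x" "{a<..x} \<subseteq> S"
      using open_left[OF \<open>open S\<close> \<open>x \<in> S\<close>, of "x - 1"] by auto
    have "y \<in> S" if "\<bar>y - x\<bar> < min (b - x) (x - a)" for y
    proof (cases "x \<le> y")
      case True
      then have "y \<in> {x..<b}" using that by (auto simp: abs_if split: if_splits)
      then show ?thesis using b by blast
    next
      case False
      then have "y \<in> {a<..x}" using that by (auto simp: abs_if split: if_splits)
      then show ?thesis using a by blast
    qed
    then show "\<exists>e>0. \<forall>y. \<bar>y - x\<bar> < e \<longrightarrow> y \<in> S"
      using a b by (intro exI[of _ "min (b - x) (x - a)"]) auto
  qed
next
  assume *: "\<forall>x\<in>S. \<exists>e>0. \<forall>y. \<bar>y - x\<bar> < e \<longrightarrow> y \<in> S"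
  show "open S"
  proof (subst open_subopen, intro ballI)
    fix x assume "x \<in> S"
    then obtain e where e: "e > 0" "\<forall>y. \<bar>y - x\<bar> < e \<longrightarrow> y \<in> S" using * by blast
    then have "{x - e<..<x + e} \<subseteq> S" by (auto simp: abs_less_iff)
    then show "\<exists>T. open T \<and> x \<in> T \<and> T \<subseteq> S" using e
      by (intro exI[of _ "{x - e<..<x + e}"]) auto
  qed
qed

lemma open_abs_ball: "open {y. \<bar>y - x\<bar> < (e::'a::{linordered_field, linorder_topology})}"
proof -
  have "{y. \<bar>y - x\<bar> < e} = {x - e<..<x + e}" by (auto simp: abs_less_iff)
  then show ?thesis by simp
qed

lemma islimpt_iff_abs:
  fixes x :: "'a::{linordered_field, linorder_topology}"
  shows "x islimpt S \<longleftrightarrow> (\<forall>e>0. \<exists>y\<in>S. y \<noteq> x \<and> \<bar>y - x\<bar> < e)"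
proof
  assume lim: "x islimpt S"
  show "\<forall>e>0. \<exists>y\<in>S. y \<noteq> x \<and> \<bar>y - x\<bar> < e"
  proof (intro allI impI)
    fix e :: 'a assume "e > 0"
    then have "x \<in> {y. \<bar>y - x\<bar> < e}" by simp
    from islimptE[OF lim this open_abs_ball] show "\<exists>y\<in>S. y \<noteq> x \<and> \<bar>y - x\<bar> < e" by blast
  qed
next
  assume *: "\<forall>e>0. \<exists>y\<in>S. y \<noteq> x \<and> \<bar>y - x\<bar> < e"
  show "x islimpt S"
  proof (rule islimptI)
    fix T assume "x \<in> T" "open T"
    then obtain e where e: "e > 0" "\<forall>y. \<bar>y - x\<bar> < e \<longrightarrow> y \<in> T" using open_iff_abs[of T] by blast
    then show "\<exists>y\<in>S. y \<in> T \<and> y \<noteq> x" using * by blast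
  qed
qed

lemma closure_iff_abs:
  fixes x :: "'a::{linordered_field, linorder_topology}"
  shows "x \<in> closure S \<longleftrightarrow> (\<forall>e>0. \<exists>y\<in>S. \<bar>y - x\<bar> < e)"
proof (cases "x \<in> S")
  case True
  then show ?thesis using closure_subset[of S] by force
next
  case False
  then have "x \<in> closure S \<longleftrightarrow> x islimpt S" by (simp add: closure_def)
  then show ?thesis using False islimpt_iff_abs[of x S] by metis
qed

lemma interior_iff_abs:
  fixes x :: "'a::{linordered_field, linorder_topology}"
  shows "x \<in> interior S \<longleftrightarrow> (\<exists>e>0. \<forall>y. \<bar>y - x\<bar> < e \<longrightarrow> y \<in> S)"
proof
  assume "x \<in> interior S"
  then obtain T where "open T" "x \<in> T" "T \<subseteq> S" unfolding interior_def by blast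
  then show "\<exists>e>0. \<forall>y. \<bar>y - x\<bar> < e \<longrightarrow> y \<in> S" using open_iff_abs[of T] by blast
next
  assume "\<exists>e>0. \<forall>y. \<bar>y - x\<bar> < e \<longrightarrow> y \<in> S"
  then obtain e where e: "e > 0" "\<forall>y. \<bar>y - x\<bar> < e \<longrightarrow> y \<in> S" by blast
  show "x \<in> interior S"
    by (rule interiorI[OF open_abs_ball[of x e]]) (use e in auto)
qed

section \<open>Iterated derived sets\<close>

definition der :: "'a::topological_space set \<Rightarrow> 'a set" where
  "der S = {x. x islimpt S}"

lemma mem_der: "x \<in> der S \<longleftrightarrow> x islimpt S"
  by (simp add: der_def)

lemma der_mono: "S \<subseteq> T \<Longrightarrow> der S \<subseteq> der T"
  unfolding der_def using islimpt_subset by auto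

lemma der_funpow_mono: "S \<subseteq> T \<Longrightarrow> (der ^^ k) S \<subseteq> (der ^^ k) T"
  by (induction k) (auto dest: der_mono)

lemma closed_der: "closed (der (S :: 'a::t1_space set))"
  unfolding closed_limpt
proof (intro allI impI)
  fix x assume x: "x islimpt der S"
  show "x \<in> der S" unfolding mem_der
  proof (rule islimptI)
    fix T assume T: "x \<in> T" "open T"
    obtain y where y: "y islimpt S" "y \<in> T" "y \<noteq> x"
      using islimptE[OF x T] unfolding mem_der by blast
    then show "\<exists>z\<in>S. z \<in> T \<and> z \<noteq> x"
      using islimptE[OF y(1), of "T - {x}"] T by (metis Diff_iff insertI1 open_delete singletonD)
  qed
qed

lemma closed_der_subset: "closed S \<Longrightarrow> der S \<subseteq> S"
  unfolding der_def by (auto simp: closed_limpt)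

lemma closed_der_funpow: "closed (S :: 'a::t1_space set) \<Longrightarrow> closed ((der ^^ k) S)"
  by (induction k) (auto simp: closed_der)

lemma der_funpow_decreasing:
  "closed (S :: 'a::t1_space set) \<Longrightarrow> j \<le> k \<Longrightarrow> (der ^^ k) S \<subseteq> (der ^^ j) S"
proof (induction k)
  case (Suc k)
  then show ?case
    using closed_der_subset[OF closed_der_funpow[of S k]] by (auto simp: le_Suc_eq)
qed auto

lemma discrete_iff: "discrete S \<longleftrightarrow> (\<forall>x\<in>S. \<not> x islimpt S)"
  unfolding discrete_def isolated_in_islimpt_iff by blast

text \<open>Passing to a derived set uses up one of the discrete pieces in a small neighbourhood.\<close>

lemma der_funpow_meets_many:
  fixes T :: "'a::t1_space set"
  assumes "closed T" "T = \<Union>\<D>" "finite \<D>" "\<forall>D\<in>\<D>. discrete D"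
    and "x \<in> (der ^^ k) T" "open U" "x \<in> U"
  shows "k < card {D\<in>\<D>. D \<inter> U \<noteq> {}}"
  using assms(5-7)
proof (induction k arbitrary: x U)
  case 0
  then have "{D\<in>\<D>. D \<inter> U \<noteq> {}} \<noteq> {}" using assms(2) by auto
  then show ?case using assms(3) by (simp add: card_gt_0_iff)
next
  case (Suc k)
  have "x \<in> T" using Suc.prems(1) der_funpow_decreasing[OF assms(1), of 0 "Suc k"] by auto
  then obtain D0 where D0: "D0 \<in> \<D>" "x \<in> D0" using assms(2) by blast
  obtain V where V: "open V" "x \<in> V" "\<And>y. y \<in> D0 \<Longrightarrow> y \<in> V \<Longrightarrow> y = x"
    using assms(4) D0 unfolding discrete_iff islimpt_def by metis
  have lim: "x islimpt (der ^^ k) T" using Suc.prems(1) by (simp add: mem_der)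
  obtain y where y: "y \<in> (der ^^ k) T" "y \<in> U \<inter> V" "y \<noteq> x"
    using islimptE[OF lim, of "U \<inter> V"] Suc.prems V by auto
  have op: "open (U \<inter> V - {x})" using Suc.prems V by (intro open_Diff) auto
  \<comment> \<open>Inside \<open>V\<close> the piece \<open>D0\<close> consists of \<open>x\<close>
    alone, so it meets \<open>U\<close> but not the punctured neighbourhood of
    \<open>x\<close>.\<close>
  let ?A = "{D\<in>\<D>. D \<inter> (U \<inter> V - {x}) \<noteq> {}}" and ?B = "{D\<in>\<D>. D \<inter> U \<noteq> {}}"
  have "?A \<subset> ?B"
  proof
    show "?A \<subseteq> ?B" by blast
    have "D0 \<in> ?B - ?A" using D0 V(3) Suc.prems(3) by blast
    then show "?A \<noteq> ?B" by blast
  qed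
  then have "card ?A < card ?B" using assms(3) by (intro psubset_card_mono) auto
  moreover have "k < card ?A" using Suc.IH[OF y(1) op] y by blast
  ultimately show ?case by linarith
qed

lemma der_funpow_card_empty:
  fixes T :: "'a::t1_space set"
  assumes "closed T" "T = \<Union>\<D>" "finite \<D>" "\<forall>D\<in>\<D>. discrete D" "card \<D> \<le> N"
  shows "(der ^^ N) T = {}"
proof -
  have "card {D\<in>\<D>. D \<inter> UNIV \<noteq> {}} \<le> card \<D>" using assms(3) by (intro card_mono) auto
  then show ?thesis using der_funpow_meets_many[OF assms(1-4), of _ N UNIV] assms(5) by force
qed

lemma interior_closure_Un:
  assumes "interior (closure S) = {}" "interior (closure T) = {}"
  shows "interior (closure (S \<union> T)) = {}"
proof -
  have "interior (closure S \<union> closure T) = interior (closure S)"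
    by (rule interior_closed_Un_empty_interior) (use assms in auto)
  then show ?thesis using assms by (simp add: closure_Un)
qed

lemma discrete_interior_closure:
  fixes S :: "'a::{linordered_field, linorder_topology} set"
  assumes "discrete S" shows "interior (closure S) = {}"
proof (rule ccontr)
  assume "interior (closure S) \<noteq> {}"
  then obtain x where "x \<in> interior (closure S)" by blast
  then obtain y where y: "y \<in> S" "y \<in> interior (closure S)"
    using closure_iff_nhds_not_empty[of x S] interior_subset[of "closure S"] open_interior
    by (metis disjoint_iff in_mono order_refl)
  obtain V where V: "open V" "y \<in> V" "\<And>z. z \<in> S \<Longrightarrow> z \<in> V \<Longrightarrow> z = y"
    using assms y unfolding discrete_iff islimpt_def by metis
  obtain e where e: "e > 0" "\<forall>z. \<bar>z - y\<bar> < e \<longrightarrow> z \<in> V \<inter> interior (closure S)"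
    using y V open_iff_abs[of "V \<inter> interior (closure S)"] by blast
  \<comment> \<open>A point of \<open>S\<close> within \<open>e/4\<close> of \<open>y + e/2\<close>
    stays in the ball around \<open>y\<close> but cannot be \<open>y\<close>, against the isolation
    of \<open>y\<close>.\<close>
  have "y + e/2 \<in> V \<inter> interior (closure S)" using e by auto
  then have "y + e/2 \<in> closure S" using interior_subset by blast
  then obtain z where z: "z \<in> S" "\<bar>z - (y + e/2)\<bar> < e/4"
    using closure_iff_abs e(1) by (metis divide_pos_pos zero_less_numeral)
  then have "\<bar>z - y\<bar> < e" "z \<noteq> y" using e(1) by (auto simp: abs_if field_simps split: if_splits)
  then show False using V(3)[OF z(1)] e(2) by blast
qed

lemma interior_closure_Union:
  assumes "finite \<D>" "\<forall>D\<in>\<D>. interior (closure D) = {}"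
  shows "interior (closure (\<Union>\<D>)) = {}"
  using assms by (induction \<D> rule: finite_induct) (simp_all add: interior_closure_Un del: closure_Un)

section \<open>Definable sets in d-minimal expansions of ordered fields\<close>

locale d_minimal_field =
  fixes M :: "('a::{linordered_field, linorder_topology}, 'f, 'r) fo_structure"
  assumes field: "expands_ordered_field M" and dmin: "d_minimal M"
begin

abbreviation "df \<equiv> dfn M"
abbreviation "dt \<equiv> dterm M"

section \<open>First-order arithmetic in the structure\<close>

lemma rel_atom:
  assumes "r \<in> rel_syms M" "rel_arity M r = 2" "\<And>x y. rel_interp M r [x, y] \<longleftrightarrow> R x y"
  shows "df (\<lambda>s. R (s 0) (s 1))"
  unfolding dfn_def
  by (intro exI[of _ "Rel r [Var (2 * 0), Var (2 * 1)]"] exI conjI allI)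
    (use assms in \<open>simp_all add: mix_def\<close>)

lemma fun_atom:
  assumes "g \<in> fun_syms M" "fun_arity M g = 2" "\<And>x y. fun_interp M g [x, y] = f x y"
  shows "df (\<lambda>s. s 0 = f (s 1) (s 2))"
  unfolding dfn_def
  by (intro exI[of _ "Equal (Var (2 * 0)) (Fun g [Var (2 * 1), Var (2 * 2)])"] exI conjI allI)
    (use assms in \<open>simp_all add: mix_def\<close>)

lemma dfn_less [dfn_intro]:
  assumes "dt t" "dt u" shows "df (\<lambda>s. t s < u s)"
proof -
  obtain r where r: "r \<in> rel_syms M" "rel_arity M r = 2" "\<forall>x y. rel_interp M r [x, y] \<longleftrightarrow> x < y"
    using field unfolding expands_ordered_field_def by blast
  from dfn_binary[where R = "(<)", OF rel_atom[OF r(1,2) r(3)[rule_format]] assms] show ?thesis .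
qed

lemma dterm_plus [dfn_intro]:
  assumes "dt t" "dt u" shows "dt (\<lambda>s. t s + u s)"
proof -
  obtain g where g: "g \<in> fun_syms M" "fun_arity M g = 2" "\<forall>x y. fun_interp M g [x, y] = x + y"
    using field unfolding expands_ordered_field_def by blast
  from dterm_binary[where f = "(+)", OF fun_atom[OF g(1,2) g(3)[rule_format]] assms] show ?thesis .
qed

lemma dterm_times [dfn_intro]:
  assumes "dt t" "dt u" shows "dt (\<lambda>s. t s * u s)"
proof -
  obtain g where g: "g \<in> fun_syms M" "fun_arity M g = 2" "\<forall>x y. fun_interp M g [x, y] = x * y"
    using field unfolding expands_ordered_field_def by blast
  from dterm_binary[where f = "(*)", OF fun_atom[OF g(1,2) g(3)[rule_format]] assms] show ?thesis .
qed

lemma dfn_le [dfn_intro]: "dt t \<Longrightarrow> dt u \<Longrightarrow> df (\<lambda>s. t s \<le> u s)"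
  unfolding le_less by (intro dfn_intro)

lemma dterm_minus [dfn_intro]:
  assumes "dt t" "dt u" shows "dt (\<lambda>s. t s - u s)"
proof -
  have "df (\<lambda>s. s 0 + s 2 = s 1)" by (intro dfn_intro)
  then have "df (\<lambda>s. s 0 = s 1 - s 2)" by (simp add: eq_diff_eq)
  from dterm_binary[where f = "(-)", OF this assms] show ?thesis .
qed

lemma dterm_uminus [dfn_intro]: "dt t \<Longrightarrow> dt (\<lambda>s. - t s)"
  using dterm_minus[OF dterm_const[of M 0], of t] by simp

lemma dterm_divide [dfn_intro]:
  assumes "dt t" "dt u" shows "dt (\<lambda>s. t s / u s)"
proof -
  \<comment> \<open>The first disjunct reflects the convention that division by zero gives
    zero.\<close>
  have "df (\<lambda>s. (s 2 = 0 \<and> s 0 = 0) \<or> (s 2 \<noteq> 0 \<and> s 0 * s 2 = s 1))" by (intro dfn_intro)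
  moreover have "((s 2 = 0 \<and> s 0 = 0) \<or> (s 2 \<noteq> 0 \<and> s 0 * s 2 = s 1)) = (s 0 = s 1 / s 2)"
    for s :: "nat \<Rightarrow> 'a" by (cases "s 2 = 0") (auto simp: eq_divide_eq)
  ultimately have "df (\<lambda>s. s 0 = s 1 / s 2)" by simp
  from dterm_binary[where f = "(/)", OF this assms] show ?thesis .
qed

lemma dterm_abs [dfn_intro]: "dt t \<Longrightarrow> dt (\<lambda>s. \<bar>t s\<bar>)"
  unfolding abs_if by (intro dfn_intro)

lemma dfn_Bex [dfn_intro]:
  fixes A :: "(nat \<Rightarrow> 'a) \<Rightarrow> 'a set"
  assumes "df (\<lambda>s. \<exists>y. y \<in> A s \<and> Q s y)" shows "df (\<lambda>s. \<exists>y\<in>A s. Q s y)"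
  using assms by (simp only: Bex_def)

lemma dfn_Ball [dfn_intro]:
  fixes A :: "(nat \<Rightarrow> 'a) \<Rightarrow> 'a set"
  assumes "df (\<lambda>s. \<forall>y. y \<in> A s \<longrightarrow> Q s y)" shows "df (\<lambda>s. \<forall>y\<in>A s. Q s y)"
  using assms by (simp only: Ball_def)

lemma dfn_mem_Collect [dfn_intro]: "df (\<lambda>s. Q s (t s)) \<Longrightarrow> df (\<lambda>s. t s \<in> {x. Q s x})"
  by simp

lemma dfn_mem_Un [dfn_intro]:
  fixes A B :: "(nat \<Rightarrow> 'a) \<Rightarrow> 'a set"
  shows "df (\<lambda>s. t s \<in> A s) \<Longrightarrow> df (\<lambda>s. t s \<in> B s) \<Longrightarrow> df (\<lambda>s. t s \<in> A s \<union> B s)"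
  unfolding Un_iff by (rule dfn_disj)

lemma dfn_mem_Int [dfn_intro]:
  fixes A B :: "(nat \<Rightarrow> 'a) \<Rightarrow> 'a set"
  shows "df (\<lambda>s. t s \<in> A s) \<Longrightarrow> df (\<lambda>s. t s \<in> B s) \<Longrightarrow> df (\<lambda>s. t s \<in> A s \<inter> B s)"
  unfolding Int_iff by (rule dfn_conj)

lemma dfn_mem_Diff [dfn_intro]:
  fixes A B :: "(nat \<Rightarrow> 'a) \<Rightarrow> 'a set"
  shows "df (\<lambda>s. t s \<in> A s) \<Longrightarrow> df (\<lambda>s. t s \<in> B s) \<Longrightarrow> df (\<lambda>s. t s \<in> A s - B s)"
  unfolding Diff_iff by (intro dfn_intro)

lemma dfn_mem_interval [dfn_intro]:
  assumes "dt t" "dt u" "dt v"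
  shows "df (\<lambda>s. t s \<in> {u s..v s})" "df (\<lambda>s. t s \<in> {u s<..<v s})"
    "df (\<lambda>s. t s \<in> {u s<..v s})" "df (\<lambda>s. t s \<in> {u s..<v s})"
  unfolding atLeastAtMost_iff greaterThanLessThan_iff greaterThanAtMost_iff atLeastLessThan_iff
  by (intro dfn_intro assms)+

abbreviation ds :: "'a set \<Rightarrow> bool" where "ds A \<equiv> df (\<lambda>s. s 0 \<in> A)"

lemma dfam_const: "ds A \<Longrightarrow> dfam M (\<lambda>_. A)"
  unfolding dfam_def .

lemma dsD: "ds A \<Longrightarrow> dt t \<Longrightarrow> df (\<lambda>s. t s \<in> A)"
  by (rule dfn_pred)

lemma dfam_ds:
  assumes "dfam M S" shows "ds (S s)"
  by (rule dfamD[OF assms]) (rule dfn_intro)+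

lemma definable1_iff: "definable1 M A \<longleftrightarrow> ds A"
proof -
  have "restrict s {..<1} \<in> pt ` A \<longleftrightarrow> s 0 \<in> A" for s
    by (force simp: pt_def restrict_def fun_eq_iff image_iff split: if_splits)
  moreover have "pt ` A \<subseteq> Fspace 1"
    unfolding pt_def Fspace_def by (intro image_subsetI) (simp only: restrict_PiE_iff, simp)
  ultimately show ?thesis unfolding definable1_def definable_iff_dfn by simp
qed

section \<open>Suprema and extrema of definable sets\<close>

lemma sup_exists:
  assumes "ds A" "A \<noteq> {}" "\<And>a. a \<in> A \<Longrightarrow> a \<le> b"
  obtains c where "\<And>a. a \<in> A \<Longrightarrow> a \<le> c" "\<And>d. (\<And>a. a \<in> A \<Longrightarrow> a \<le> d) \<Longrightarrow> c \<le> d"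
proof -
  obtain s :: "'a extended" where s: "isLub UNIV (Fin ` A) s"
    using dmin assms(1) unfolding d_minimal_def definably_complete_def definable1_iff by blast
  have ub: "\<And>a. a \<in> A \<Longrightarrow> Fin a \<le> s"
    and least: "\<And>d. (\<And>a. a \<in> A \<Longrightarrow> a \<le> d) \<Longrightarrow> s \<le> Fin d"
    using s unfolding isLub_def leastP_def isUb_def setle_def setge_def by auto
  obtain c where "s = Fin c" using ub least[of b] assms by (cases s) auto
  then show thesis using that ub least by auto
qed

lemma inf_exists:
  assumes "ds A" "A \<noteq> {}" "\<And>a. a \<in> A \<Longrightarrow> b \<le> a"
  obtains c where "\<And>a. a \<in> A \<Longrightarrow> c \<le> a" "\<And>d. (\<And>a. a \<in> A \<Longrightarrow> d \<le> a) \<Longrightarrow> d \<le> c"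
proof -
  obtain s :: "'a extended" where s: "isGlb UNIV (Fin ` A) s"
    using dmin assms(1) unfolding d_minimal_def definably_complete_def definable1_iff by blast
  have lb: "\<And>a. a \<in> A \<Longrightarrow> s \<le> Fin a"
    and greatest: "\<And>d. (\<And>a. a \<in> A \<Longrightarrow> d \<le> a) \<Longrightarrow> Fin d \<le> s"
    using s unfolding isGlb_def greatestP_def isLb_def setle_def setge_def by auto
  obtain c where "s = Fin c" using lb greatest[of b] assms by (cases s) auto
  then show thesis using that lb greatest by auto
qed

lemma max_exists:
  assumes "ds A" "closed A" "A \<noteq> {}" "\<And>a. a \<in> A \<Longrightarrow> a \<le> b"
  obtains m where "m \<in> A" "\<And>a. a \<in> A \<Longrightarrow> a \<le> m"
proof -
  obtain c where c: "\<And>a. a \<in> A \<Longrightarrow> a \<le> c" "\<And>d. (\<And>a. a \<in> A \<Longrightarrow> a \<le> d) \<Longrightarrow> c \<le> d"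
    using sup_exists[OF assms(1,3,4)] by blast
  have "c \<in> closure A" unfolding closure_iff_abs
  proof (intro allI impI)
    fix e :: 'a assume "e > 0"
    then obtain a where "a \<in> A" "c - e < a" using c(2)[of "c - e"] by force
    then show "\<exists>y\<in>A. \<bar>y - c\<bar> < e" using c(1)[of a] by (intro bexI[of _ a]) auto
  qed
  then show thesis using that c assms(2) by (simp add: closure_closed)
qed

lemma min_exists:
  assumes "ds A" "closed A" "A \<noteq> {}" "\<And>a. a \<in> A \<Longrightarrow> b \<le> a"
  obtains m where "m \<in> A" "\<And>a. a \<in> A \<Longrightarrow> m \<le> a"
proof -
  obtain c where c: "\<And>a. a \<in> A \<Longrightarrow> c \<le> a" "\<And>d. (\<And>a. a \<in> A \<Longrightarrow> d \<le> a) \<Longrightarrow> d \<le> c"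
    using inf_exists[OF assms(1,3,4)] by blast
  have "c \<in> closure A" unfolding closure_iff_abs
  proof (intro allI impI)
    fix e :: 'a assume "e > 0"
    then obtain a where "a \<in> A" "a < c + e" using c(2)[of "c + e"] by force
    then show "\<exists>y\<in>A. \<bar>y - c\<bar> < e" using c(1)[of a] by (intro bexI[of _ a]) auto
  qed
  then show thesis using that c assms(2) by (simp add: closure_closed)
qed

section \<open>Uniform consequences of d-minimality\<close>

lemma dfam_closure: "dfam M S \<Longrightarrow> dfam M (\<lambda>s. closure (S s))"
  unfolding dfam_def closure_iff_abs by (intro dfn_intro dfamD[of M S]) (simp add: dfam_def)

lemma dfam_der: "dfam M S \<Longrightarrow> dfam M (\<lambda>s. der (S s))"
  unfolding dfam_def mem_der islimpt_iff_abs by (intro dfn_intro dfamD[of M S]) (simp add: dfam_def)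

lemma dfam_der_funpow: "dfam M S \<Longrightarrow> dfam M (\<lambda>s. (der ^^ k) (S s))"
  by (induction k) (auto simp: dfam_der)

text \<open>Finite support turns a family over infinite environments into one over \<open>k\<close>
  parameters, to which d-minimality applies.\<close>

lemma dfam_decomposition:
  assumes "dfam M S"
  shows "\<exists>N. \<forall>s. \<exists>U \<D>. open U \<and> finite \<D> \<and> card \<D> \<le> N \<and> (\<forall>D\<in>\<D>. discrete D) \<and> S s = U \<union> \<Union>\<D>"
proof -
  obtain k where k: "\<And>s s'. (\<And>i. i < k \<Longrightarrow> s i = s' i) \<Longrightarrow>
      s 0 \<in> S (\<lambda>i. s (Suc i)) \<longleftrightarrow> s' 0 \<in> S (\<lambda>i. s' (Suc i))"
    using dfn_finite_support[OF assms[unfolded dfam_def]] by metis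
  \<comment> \<open>The parameters become the first \<open>k\<close> coordinates and the point of
    the fibre becomes the last one; parameters beyond the support are set to 0.\<close>
  define A where "A = {z \<in> Fspace (k + 1). z k \<in> S (\<lambda>i. if i < k then z i else 0)}"
  have "restrict s {..<k + 1} \<in> A \<longleftrightarrow> s k \<in> S (\<lambda>i. if i < k then s i else 0)" for s
  proof -
    have "(\<lambda>i. if i < k then restrict s {..<Suc k} i else 0) = (\<lambda>i. if i < k then s i else 0)"
      by (auto simp: fun_eq_iff)
    then show ?thesis by (simp add: A_def Fspace_def)
  qed
  moreover have "df (\<lambda>s. s k \<in> S (\<lambda>i. if i < k then s i else 0))"
    by (intro dfn_intro dfamD[OF assms])
  ultimately have "definable M (k + 1) A" unfolding definable_iff_dfn by (auto simp: A_def)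
  with dmin have "\<exists>N. \<forall>x\<in>Fspace k. \<exists>U \<D>. open U \<and> finite \<D> \<and> card \<D> \<le> N \<and>
      (\<forall>D\<in>\<D>. discrete D) \<and> {y. cat k x (pt y) \<in> A} = U \<union> \<Union>\<D>"
    unfolding d_minimal_def by (elim conjE allE impE)
  then obtain N where N: "\<forall>x\<in>Fspace k. \<exists>U \<D>. open U \<and> finite \<D> \<and> card \<D> \<le> N \<and>
      (\<forall>D\<in>\<D>. discrete D) \<and> {y. cat k x (pt y) \<in> A} = U \<union> \<Union>\<D>" ..
  have eq: "{y. cat k (restrict s {..<k}) (pt y) \<in> A} = S s" for s
  proof -
    have "cat k (restrict s {..<k}) (pt y) \<in> A \<longleftrightarrow> y \<in> S s" for y
    proof -
      have "(\<lambda>i. if i < k then cat k (restrict s {..<k}) (pt y) i else 0) = (\<lambda>i. if i < k then s i else 0)"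
        by (auto simp: cat_def)
      moreover have "cat k (restrict s {..<k}) (pt y) \<in> Fspace (k + 1)"
        by (auto simp: Fspace_def cat_def pt_def PiE_def extensional_def)
      moreover have "cat k (restrict s {..<k}) (pt y) k = y" by (simp add: cat_def pt_def)
      moreover have "y \<in> S (\<lambda>i. if i < k then s i else 0) \<longleftrightarrow> y \<in> S s"
        using k[of "\<lambda>i. case i of 0 \<Rightarrow> y | Suc i \<Rightarrow> if i < k then s i else 0"
            "\<lambda>i. case i of 0 \<Rightarrow> y | Suc i \<Rightarrow> s i"] by (auto split: nat.splits)
      ultimately show ?thesis by (simp add: A_def)
    qed
    then show ?thesis by blast
  qed
  have mem: "restrict s {..<k} \<in> Fspace k" for s :: "nat \<Rightarrow> 'a" by (simp add: Fspace_def)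
  show ?thesis
    by (intro exI[of _ N] allI) (rule N[rule_format, OF mem, unfolded eq])
qed

text \<open>The open part of the decomposition is empty, and discrete sets are nowhere dense because
  the order is dense. Consequently no definable set is both dense and codense in an interval, which
  is the source of the contradictions in the Baire argument.\<close>

lemma nowhere_dense:
  assumes "ds A" "interior A = {}" shows "interior (closure A) = {}"
proof -
  obtain U \<D> where "open U" "finite \<D>" "\<forall>D\<in>\<D>. discrete D" "A = U \<union> \<Union>\<D>"
    using dfam_decomposition[OF dfam_const[OF assms(1)]] by blast
  moreover have "U = {}" using calculation assms(2) interior_maximal[of U A] by blast
  ultimately show ?thesis using interior_closure_Union[of \<D>] discrete_interior_closure by auto
qed

text \<open>If both interiors were empty, \<open>closure A\<close> would have empty interior by the
  previous lemma, and enlarging a closed set by a set without interior creates no interior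
  points.\<close>

lemma interior_Un_nonempty:
  assumes "ds A" "interior (A \<union> B) \<noteq> {}" shows "interior A \<noteq> {} \<or> interior B \<noteq> {}"
proof (rule ccontr)
  assume *: "\<not> ?thesis"
  then have "interior (closure A) = {}" using nowhere_dense assms(1) by blast
  moreover have "interior (closure A \<union> B) = interior (closure A)"
    using * by (intro interior_closed_Un_empty_interior) auto
  moreover have "interior (A \<union> B) \<subseteq> interior (closure A \<union> B)"
    using closure_subset by (intro interior_mono) auto
  ultimately show False using assms(2) by blast
qed

text \<open>The decomposition is taken for the family of closures: derived sets of closed sets
  decrease, and each derivation consumes one of the at most \<open>N\<close> discrete
  pieces.\<close>

lemma der_funpow_uniform:
  assumes "dfam M S"
  shows "\<exists>N. \<forall>s. interior (S s) = {} \<longrightarrow> (der ^^ N) (closure (S s)) = {}"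
proof -
  from dfam_decomposition[OF dfam_closure[OF assms]]
  obtain N where N: "\<forall>s. \<exists>U \<D>. open U \<and> finite \<D> \<and> card \<D> \<le> N \<and> (\<forall>D\<in>\<D>. discrete D)
      \<and> closure (S s) = U \<union> \<Union>\<D>" ..
  have "(der ^^ N) (closure (S s)) = {}" if "interior (S s) = {}" for s
  proof -
    from N[rule_format, of s] obtain U \<D> where *: "open U" "finite \<D>" "card \<D> \<le> N"
      "\<forall>D\<in>\<D>. discrete D" "closure (S s) = U \<union> \<Union>\<D>" by (elim exE conjE)
    then have "U = {}"
      using nowhere_dense[OF dfam_ds[OF assms] that] interior_maximal[of U "closure (S s)"] by blast
    with * show ?thesis by (intro der_funpow_card_empty[of _ \<D>] closed_closure) auto
  qed
  then show ?thesis by blast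
qed

section \<open>A definable Baire property on the line\<close>

lemma closed_if_der_empty: "der S = {} \<Longrightarrow> closed (S :: 'a set)"
  unfolding closed_limpt der_def by blast

lemma der_empty_subset: "der T = {} \<Longrightarrow> S \<subseteq> T \<Longrightarrow> der S = {}"
  using der_mono[of S T] by blast

text \<open>Induction along a bounded set without limit points.\<close>

lemma least_in_discrete:
  assumes R: "df (\<lambda>s. R (s 0) (s 1))" and S: "ds S" "der S = {}" "S \<noteq> {}" "S \<subseteq> {a..b}"
    and trans: "\<And>x y z. R x y \<Longrightarrow> R y z \<Longrightarrow> R x z"
    and total: "\<And>x y. x \<in> S \<Longrightarrow> y \<in> S \<Longrightarrow> x \<noteq> y \<Longrightarrow> R x y \<or> R y x"
  shows "\<exists>m\<in>S. \<forall>x\<in>S. x \<noteq> m \<longrightarrow> R m x"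
proof -
  define good where "good d \<longleftrightarrow> (\<exists>m\<in>S. m \<le> d \<and> (\<forall>x\<in>S. x \<le> d \<longrightarrow> x \<noteq> m \<longrightarrow> R m x))" for d
  define P where "P = {d\<in>S. good d}"
  note [dfn_intro] = dsD[OF S(1)] dfn_binary[where R = R, OF R]
  have dP: "ds P" unfolding P_def good_def
    by (intro dfn_intro)
  have "P \<subseteq> S" by (auto simp: P_def)
  have clP: "closed P" by (rule closed_if_der_empty[OF der_empty_subset[OF S(2) \<open>P \<subseteq> S\<close>]])
  obtain m0 where m0: "m0 \<in> S" "\<And>x. x \<in> S \<Longrightarrow> m0 \<le> x"
    using min_exists[OF S(1) closed_if_der_empty[OF S(2)] S(3), of a] S(4) atLeastAtMost_iff by blast
  have "good m0" unfolding good_def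
    by (intro bexI[of _ m0]) (use m0 in \<open>auto dest: order_antisym\<close>)
  then have "P \<noteq> {}" using m0 by (auto simp: P_def)
  \<comment> \<open>If a point of \<open>S\<close> lay beyond this last good point, the next one
    after \<open>q\<close> would be good as well: it only has to be compared with the least element
    found so far.\<close>
  then obtain q where q: "q \<in> P" "\<And>x. x \<in> P \<Longrightarrow> x \<le> q"
    using max_exists[OF dP clP, of b] \<open>P \<subseteq> S\<close> S(4) atLeastAtMost_iff by blast
  have "q \<in> S" "good q" using q(1) by (auto simp: P_def)
  have "x \<le> q" if "x \<in> S" for x
  proof (rule ccontr)
    assume "\<not> x \<le> q"
    let ?T = "{x\<in>S. q < x}"
    have dT: "ds ?T" by (intro dfn_intro)
    have clT: "closed ?T" by (rule closed_if_der_empty[OF der_empty_subset[OF S(2)]]) auto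
    have neT: "?T \<noteq> {}" using that \<open>\<not> x \<le> q\<close> not_le by blast
    have lbT: "y \<in> ?T \<Longrightarrow> q \<le> y" for y by simp
    obtain r where "r \<in> ?T" "\<And>x. x \<in> ?T \<Longrightarrow> r \<le> x"
      using min_exists[OF dT clT neT lbT] by blast
    then have r: "r \<in> S" "q < r" "\<And>x. x \<in> S \<Longrightarrow> q < x \<Longrightarrow> r \<le> x" by auto
    obtain m where m: "m \<in> S" "m \<le> q" "\<And>x. x \<in> S \<Longrightarrow> x \<le> q \<Longrightarrow> x \<noteq> m \<Longrightarrow> R m x"
      using \<open>good q\<close> unfolding good_def by auto
    have below: "x = r \<or> x \<le> q" if "x \<in> S" "x \<le> r" for x using r(3)[OF that(1)] that by force
    have "good r"
    proof (cases "R m r")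
      case True
      then show ?thesis unfolding good_def using m r below by (intro bexI[of _ m]) auto
    next
      case False
      then have "R r m" using total[OF r(1) m(1)] m(2) r(2) by auto
      then have "R r x" if "x \<in> S" "x \<le> q" for x using m(3)[OF that] trans by (cases "x = m") auto
      then show ?thesis unfolding good_def using r below by (intro bexI[of _ r]) auto
    qed
    then have "r \<in> P" using r by (simp add: P_def)
    then show False using q(2) r(2) by force
  qed
  then show ?thesis using \<open>good q\<close> unfolding good_def by blast
qed

text \<open>An interval has no definable linear order whose proper initial segments are without limit
  points. For such an order every point has nearest earlier points on both sides, and the points
  whose left one comes before the right one form a dense and codense set.\<close>

lemma no_locally_finite_order:
  assumes R: "df (\<lambda>s. R (s 0) (s 1))" and ab: "a < b"
    and trans: "\<And>x y z. R x y \<Longrightarrow> R y z \<Longrightarrow> R x z"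
    and irrefl: "\<And>x. \<not> R x x"
    and total: "\<And>x y. x \<in> {a..b} \<Longrightarrow> y \<in> {a..b} \<Longrightarrow> x \<noteq> y \<Longrightarrow> R x y \<or> R y x"
    and seg: "\<And>y. y \<in> {a..b} \<Longrightarrow> der {x\<in>{a..b}. R x y} = {}"
  shows False
proof -
  note [dfn_intro] = dfn_binary[where R = R, OF R]
  \<comment> \<open>The predecessors of an arbitrary point \<open>s\<close> of the interval have no
    limit points, so the preceding lemma gives them a least element; if there are none,
    \<open>s\<close> itself is least.\<close>
  have least: "\<exists>m\<in>{u<..<v}. \<forall>x\<in>{u<..<v}. x \<noteq> m \<longrightarrow> R m x" if uv: "u < v" "{u<..<v} \<subseteq> {a..b}" for u v
  proof -
    obtain s where s: "s \<in> {u<..<v}" using dense[OF uv(1)] by auto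
    let ?T = "{x\<in>{u<..<v}. R x s}"
    show ?thesis
    proof (cases "?T = {}")
      case True
      then have "\<forall>x\<in>{u<..<v}. x \<noteq> s \<longrightarrow> R s x" using total s uv(2) by blast
      then show ?thesis using s by blast
    next
      case False
      have dT: "ds ?T" by (intro dfn_intro)
      have derT: "der ?T = {}"
        by (rule der_empty_subset[OF seg[of s]]) (use s uv(2) in auto)
      have sub: "?T \<subseteq> {a..b}" using uv(2) by auto
      have "\<exists>m\<in>?T. \<forall>x\<in>?T. x \<noteq> m \<longrightarrow> R m x"
      proof (rule least_in_discrete[OF R dT derT False sub])
        show "R x z" if "R x y" "R y z" for x y z using trans that .
        show "R x y \<or> R y x" if "x \<in> ?T" "y \<in> ?T" "x \<noteq> y" for x y
          using total[OF _ _ that(3)] sub that(1,2) by blast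
      qed
      then obtain m where m: "m \<in> ?T" "\<And>x. x \<in> ?T \<Longrightarrow> x \<noteq> m \<Longrightarrow> R m x" by blast
      have "R m x" if x: "x \<in> {u<..<v}" "x \<noteq> m" for x
      proof (cases "R x s")
        case True
        then show ?thesis using m(2)[of x] x by blast
      next
        case False
        then have "x = s \<or> R s x" using total[of x s] x s \<open>{u<..<v} \<subseteq> {a..b}\<close> by blast
        then show ?thesis using m(1) trans by blast
      qed
      then show ?thesis using m(1) by blast
    qed
  qed
  define nb where "nb l x r \<longleftrightarrow> l < x \<and> x < r \<and> R l x \<and> R r x \<and> (\<forall>y\<in>{l<..<r}. \<not> R y x)" for l x r
  define Z where "Z = {x. \<exists>l r. nb l x r \<and> R l r}"
  define Z' where "Z' = {x. \<exists>l r. nb l x r \<and> R r l}"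
  have "ds Z" unfolding Z_def nb_def by (intro dfn_intro)
  have nb_unique: "l = l' \<and> r = r'" if "nb l x r" "nb l' x r'" for l l' x r r'
  proof -
    have "l' \<notin> {l<..<r}" "l \<notin> {l'<..<r'}" "r' \<notin> {l<..<r}" "r \<notin> {l'<..<r'}" and
      "l < x" "x < r" "l' < x" "x < r'"
      using that unfolding nb_def by blast+
    then show ?thesis by auto
  qed
  have disj: "Z \<inter> Z' = {}"
    unfolding Z_def Z'_def using nb_unique trans irrefl by blast
  have hit: "(\<exists>x\<in>Z. x \<in> {u<..<v}) \<and> (\<exists>x\<in>Z'. x \<in> {u<..<v})"
    if uv: "u < v" "{u<..<v} \<subseteq> {a..b}" for u v
  proof -
    \<comment> \<open>Minima of four nested intervals: \<open>x2\<close> has neighbours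
      \<open>x1\<close> and \<open>x0\<close>, of which the right one comes earlier, while
      \<open>x3\<close> has neighbours \<open>x1\<close> and \<open>x2\<close>, of which the left
      one comes earlier.\<close>
    obtain x0 where x0: "u < x0" "x0 < v" "\<And>x. x \<in> {u<..<v} \<Longrightarrow> x \<noteq> x0 \<Longrightarrow> R x0 x"
      using least[OF uv] by auto
    have "{u<..<x0} \<subseteq> {a..b}" using uv(2) x0 by auto
    then obtain x1 where x1: "u < x1" "x1 < x0" "\<And>x. x \<in> {u<..<x0} \<Longrightarrow> x \<noteq> x1 \<Longrightarrow> R x1 x"
      using least[of u x0] x0 by auto
    have "{x1<..<x0} \<subseteq> {a..b}" using uv(2) x0 x1 by auto
    then obtain x2 where x2: "x1 < x2" "x2 < x0" "\<And>x. x \<in> {x1<..<x0} \<Longrightarrow> x \<noteq> x2 \<Longrightarrow> R x2 x"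
      using least[of x1 x0] x1 by auto
    have "{x1<..<x2} \<subseteq> {a..b}" using uv(2) x0 x1 x2 by auto
    then obtain x3 where x3: "x1 < x3" "x3 < x2" "\<And>x. x \<in> {x1<..<x2} \<Longrightarrow> x \<noteq> x3 \<Longrightarrow> R x3 x"
      using least[of x1 x2] x2 by auto
    have r01: "R x0 x1" and r02: "R x0 x2" and r12: "R x1 x2" and r13: "R x1 x3" and r23: "R x2 x3"
      using x0 x1 x2 x3 by auto
    have "nb x1 x2 x0" unfolding nb_def using x2 r12 r02 irrefl trans by blast
    then have "x2 \<in> Z'" unfolding Z'_def using r01 by blast
    moreover have "nb x1 x3 x2" unfolding nb_def using x3 r13 r23 irrefl trans by blast
    then have "x3 \<in> Z" unfolding Z_def using r12 by blast
    moreover have "x2 \<in> {u<..<v}" "x3 \<in> {u<..<v}" using x0 x1 x2 x3 by auto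
    ultimately show ?thesis by blast
  qed
  obtain c where c: "a < c" "c < b" using dense[OF ab] by blast
  have "interior (Z \<inter> {a<..<b}) \<noteq> {}"
  proof
    assume "interior (Z \<inter> {a<..<b}) = {}"
    moreover have "ds (Z \<inter> {a<..<b})" by (intro dfn_intro \<open>ds Z\<close>)
    ultimately have "interior (closure (Z \<inter> {a<..<b})) = {}" using nowhere_dense by blast
    moreover have "{a<..<b} \<subseteq> closure (Z \<inter> {a<..<b})"
    proof
      fix x assume x: "x \<in> {a<..<b}"
      show "x \<in> closure (Z \<inter> {a<..<b})" unfolding closure_iff_abs
      proof (intro allI impI)
        fix e :: 'a assume "e > 0"
        have "{max a (x - e)<..<min b (x + e)} \<subseteq> {a..b}" by auto
        then have "\<exists>y\<in>Z. y \<in> {max a (x - e)<..<min b (x + e)}"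
          using hit[of "max a (x - e)" "min b (x + e)"] \<open>e > 0\<close> x by auto
        then obtain y where y: "y \<in> Z" "y \<in> {max a (x - e)<..<min b (x + e)}" by blast
        then have "\<bar>y - x\<bar> < e" "y \<in> {a<..<b}" by (auto simp: abs_less_iff)
        then show "\<exists>y\<in>Z \<inter> {a<..<b}. \<bar>y - x\<bar> < e" using y(1) by blast
      qed
    qed
    then have "{a<..<b} \<subseteq> interior (closure (Z \<inter> {a<..<b}))" by (intro interior_maximal) auto
    ultimately show False using c by auto
  qed
  then obtain y where y: "y \<in> interior (Z \<inter> {a<..<b})" by blast
  then obtain e where e: "e > 0" "\<And>z. \<bar>z - y\<bar> < e \<Longrightarrow> z \<in> Z \<inter> {a<..<b}"
    unfolding interior_iff_abs by blast
  have sub: "{y - e<..<y + e} \<subseteq> Z \<inter> {a<..<b}" using e(2) by (auto simp: abs_less_iff)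
  then have "{y - e<..<y + e} \<subseteq> {a..b}" by auto
  then obtain z where "z \<in> Z'" "z \<in> {y - e<..<y + e}" using hit[of "y - e" "y + e"] e(1) by auto
  then show False using sub disj by blast
qed

text \<open>Were all sublevel sets \<open>W t\<close> without interior, they would be nowhere dense
  with uniformly bounded derivation length. The order fed to the previous lemma compares points by
  the values of \<open>t\<close> at which they enter the derived set of \<open>closure (W t)\<close>
  of a well-chosen depth.\<close>

lemma baire_line:
  assumes h: "dt (\<lambda>s. h (s 0))" and uv: "u < v"
  shows "\<exists>c. interior {x\<in>{u<..<v}. h x \<le> c} \<noteq> {}"
proof (rule ccontr)
  assume no: "\<not> ?thesis"
  define W where "W t = {x\<in>{u<..<v}. h x \<le> t}" for t
  have W_empty: "interior (W t) = {}" for t using no by (auto simp: W_def)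
  define Y where "Y k t = (der ^^ k) (closure (W t))" for k t
  have h': "dt t \<Longrightarrow> dt (\<lambda>s. h (t s))" for t
    using dterm_subst[where g = "\<lambda>s _. t s", OF h] by simp
  have dW: "dfam M (\<lambda>s. W (s 0))" unfolding dfam_def W_def by (intro dfn_intro h')
  then have dY: "dfam M (\<lambda>s. Y k (s 0))" for k
    unfolding Y_def by (intro dfam_der_funpow dfam_closure)
  have dY': "df (\<lambda>s. t s \<in> Y k (w s))" if "dt t" "dt w" for t w k
    using dfamD[OF dY that(1), of "\<lambda>s _. w s"] that(2) by simp
  note [dfn_intro] = dY'
  obtain N where "\<forall>s::nat \<Rightarrow> 'a. interior (W (s 0)) = {} \<longrightarrow> (der ^^ N) (closure (W (s 0))) = {}"
    using der_funpow_uniform[OF dW] ..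
  from spec[OF this, of "\<lambda>_. t" for t] have N: "Y N t = {}" for t
    using W_empty by (simp add: Y_def)
  have Y_mono: "Y k t \<subseteq> Y k t'" if "t \<le> t'" for k t t'
    unfolding Y_def using that by (intro der_funpow_mono closure_mono) (auto simp: W_def)
  \<comment> \<open>\<open>K\<close> is the least depth at which the derived sets for all
    \<open>t\<close> together miss some interval. One derivation earlier, at depth \<open>k\<close>,
    they still meet every subinterval of \<open>{u<..<v}\<close>, so their union \<open>E\<close> is
    dense in the interval found.\<close>
  define good where "good k \<longleftrightarrow> (\<exists>p q. p < q \<and> {p<..<q} \<subseteq> {u<..<v} \<and> (\<forall>t. Y k t \<inter> {p<..<q} = {}))" for k
  have "good N" unfolding good_def using N uv by auto
  define K where "K = (LEAST k. good k)"
  have "good K" unfolding K_def using \<open>good N\<close> by (rule LeastI)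
  have "\<not> good 0"
  proof
    assume "good 0"
    then obtain p q where pq: "p < q" "{p<..<q} \<subseteq> {u<..<v}" "\<And>t. Y 0 t \<inter> {p<..<q} = {}"
      unfolding good_def by blast
    obtain x where x: "p < x" "x < q" using dense[OF pq(1)] by blast
    then have "x \<in> W (h x)" using pq(2) by (auto simp: W_def)
    then have "x \<in> Y 0 (h x)" unfolding Y_def using closure_subset by auto
    then show False using pq(3)[of "h x"] x by auto
  qed
  then obtain k where k: "K = Suc k" using \<open>good K\<close> by (cases K) auto
  then have "\<not> good k" unfolding K_def using not_less_Least[of k good] by simp
  obtain p q where pq: "p < q" "{p<..<q} \<subseteq> {u<..<v}" "\<And>t. Y (Suc k) t \<inter> {p<..<q} = {}"
    using \<open>good K\<close> unfolding good_def k by blast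
  define E where "E = {x\<in>{p<..<q}. \<exists>t. x \<in> Y k t}"
  have dE: "ds E" unfolding E_def by (intro dfn_intro)
  have "interior E \<noteq> {}"
  proof
    assume "interior E = {}"
    then have "interior (closure E) = {}" using nowhere_dense dE by blast
    moreover have "{p<..<q} \<subseteq> closure E"
    proof
      fix x assume x: "x \<in> {p<..<q}"
      show "x \<in> closure E" unfolding closure_iff_abs
      proof (intro allI impI)
        fix e :: 'a assume "e > 0"
        let ?p = "max p (x - e)" and ?q = "min q (x + e)"
        have "?p < ?q" "{?p<..<?q} \<subseteq> {u<..<v}" using pq(2) x \<open>e > 0\<close> by auto
        then obtain t where "Y k t \<inter> {?p<..<?q} \<noteq> {}" using \<open>\<not> good k\<close> unfolding good_def by blast
        then obtain y where "y \<in> Y k t" "y \<in> {?p<..<?q}" by blast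
        then show "\<exists>y\<in>E. \<bar>y - x\<bar> < e" unfolding E_def
          by (intro bexI[of _ y]) (auto simp: abs_less_iff)
      qed
    qed
    then have "{p<..<q} \<subseteq> interior (closure E)" by (intro interior_maximal) auto
    ultimately show False using dense[OF pq(1)] by auto
  qed
  then obtain y e where e: "e > 0" "\<And>z. \<bar>z - y\<bar> < e \<Longrightarrow> z \<in> E"
    using interior_iff_abs by blast
  define a b where "a = y - e/2" and "b = y + e/2"
  have "a < b" using e(1) by (simp add: a_def b_def)
  have abE: "{a..b} \<subseteq> E"
  proof
    fix x assume "x \<in> {a..b}"
    then have "\<bar>x - y\<bar> < e" using e(1) unfolding a_def b_def by (auto simp: abs_le_iff abs_less_iff)
    then show "x \<in> E" by (rule e(2))
  qed
  \<comment> \<open>In the increasing family \<open>Y k t\<close> the point \<open>x\<close> appears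
    no later than \<open>z\<close>. Points that appear simultaneously are ordered by size in
    \<open>R\<close>.\<close>
  define lesseq where "lesseq x z \<longleftrightarrow> (\<forall>t. z \<in> Y k t \<longrightarrow> x \<in> Y k t)" for x z
  define R where "R x z \<longleftrightarrow> lesseq x z \<and> (\<not> lesseq z x \<or> x < z)" for x z
  have lin: "lesseq x z \<or> lesseq z x" for x z
    unfolding lesseq_def using Y_mono by (metis linear subsetD)
  have tr: "lesseq x w" if "lesseq x z" "lesseq z w" for x z w
    using that unfolding lesseq_def by blast
  show False
  proof (rule no_locally_finite_order[of R, OF _ \<open>a < b\<close>])
    show "df (\<lambda>s. R (s 0) (s 1))" unfolding R_def lesseq_def by (intro dfn_intro)
    show "R x w" if "R x z" "R z w" for x z w
      using that tr unfolding R_def by (meson order_less_trans)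
    show "\<not> R x x" for x unfolding R_def by auto
    show "R x z \<or> R z x" if "x \<noteq> z" for x z
      using that lin[of x z] unfolding R_def by auto
    show "der {x \<in> {a..b}. R x z} = {}" if z: "z \<in> {a..b}" for z
    proof -
      obtain t where t: "z \<in> Y k t" using z abE unfolding E_def by blast
      \<comment> \<open>The predecessors of \<open>z\<close> all lie in one \<open>Y k t\<close>,
        whose limit points form \<open>Y (Suc k) t\<close> and hence avoid
        \<open>{p<..<q}\<close>.\<close>
      have sub: "{x \<in> {a..b}. R x z} \<subseteq> Y k t \<inter> {a..b}"
        using t unfolding R_def lesseq_def by blast
      have "der (Y k t \<inter> {a..b}) \<subseteq> der (Y k t) \<inter> der {a..b}"
        by (intro Int_greatest der_mono) auto
      moreover have "der (Y k t) = Y (Suc k) t" by (simp add: Y_def)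
      moreover have "der {a..b} \<subseteq> {a..b}" by (rule closed_der_subset) auto
      moreover have "{a..b} \<subseteq> {p<..<q}" using abE unfolding E_def by blast
      ultimately have "der (Y k t \<inter> {a..b}) = {}" using pq(3)[of t] by blast
      then show ?thesis using sub der_empty_subset by blast
    qed
  qed
qed

section \<open>Definable choice on environments\<close>

text \<open>Bounding both the size of a point and the scale on which \<open>S\<close> is open or a singleton around
  it produces closed bounded subsets of \<open>S\<close>, which have least elements.\<close>

definition core :: "'a set \<Rightarrow> 'a \<Rightarrow> 'a set" where
  "core S R = {x. x \<in> S \<and> \<bar>x\<bar> \<le> R \<and>
     ((\<forall>y. \<bar>y - x\<bar> * R < 1 \<longrightarrow> y \<in> S) \<or> (\<forall>y. y \<noteq> x \<longrightarrow> \<bar>y - x\<bar> * R < 1 \<longrightarrow> y \<notin> S))}"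

lemma core_mono:
  assumes "R \<le> R'" shows "core S R \<subseteq> core S R'"
proof -
  have "\<bar>y - x\<bar> * R < 1" if "\<bar>y - x\<bar> * R' < 1" for x y
    using that mult_left_mono[OF assms abs_ge_zero[of "y - x"]] by linarith
  then show ?thesis unfolding core_def using assms by auto
qed

text \<open>The two kinds of points are closed separately. Limits of points with a full ball of
  radius \<open>1 / R\<close> in \<open>S\<close> again have one, and two distinct points isolated
  in \<open>S\<close> at that scale are at least \<open>1 / R\<close> apart, so the second kind has
  no limit points.\<close>

lemma closed_core:
  assumes "0 < R" shows "closed (core S R)"
proof -
  define P where "P = {x. \<bar>x\<bar> \<le> R \<and> (\<forall>y. \<bar>y - x\<bar> * R < 1 \<longrightarrow> y \<in> S)}"
  define Q where "Q = {x. x \<in> S \<and> \<bar>x\<bar> \<le> R \<and> (\<forall>y. y \<noteq> x \<longrightarrow> \<bar>y - x\<bar> * R < 1 \<longrightarrow> y \<notin> S)}"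
  have less_iff: "\<bar>y - x\<bar> * R < 1 \<longleftrightarrow> \<bar>y - x\<bar> < 1 / R" for x y
    using assms by (simp add: pos_less_divide_eq)
  have small: "\<bar>x\<bar> \<le> R" if "x \<in> closure T" "\<And>y. y \<in> T \<Longrightarrow> \<bar>y\<bar> \<le> R" for x T
  proof -
    have "y \<in> {-R..R}" if "y \<in> T" for y
      using \<open>\<And>y. y \<in> T \<Longrightarrow> \<bar>y\<bar> \<le> R\<close>[OF that] by (simp add: abs_le_iff minus_le_iff)
    then have "T \<subseteq> {-R..R}" by blast
    then have "closure T \<subseteq> {-R..R}" by (intro closure_minimal) auto
    then have "x \<in> {-R..R}" using that(1) by blast
    then show ?thesis by (simp add: abs_le_iff minus_le_iff)
  qed
  have "closure P \<subseteq> P"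
  proof
    fix x assume x: "x \<in> closure P"
    have "\<bar>x\<bar> \<le> R" by (rule small[OF x]) (simp add: P_def)
    moreover have "y \<in> S" if "\<bar>y - x\<bar> * R < 1" for y
    proof -
      have "0 < 1 / R - \<bar>y - x\<bar>" using that less_iff by simp
      then obtain z where z: "z \<in> P" "\<bar>z - x\<bar> < 1 / R - \<bar>y - x\<bar>" using x closure_iff_abs by blast
      then have "\<bar>y - z\<bar> < 1 / R" by linarith
      then show ?thesis using z(1) less_iff unfolding P_def by blast
    qed
    ultimately show "x \<in> P" by (simp add: P_def)
  qed
  moreover have "closure Q \<subseteq> Q"
  proof
    fix x assume x: "x \<in> closure Q"
    have "0 < 1 / (2 * R)" using assms by simp
    then obtain y where y: "y \<in> Q" "\<bar>y - x\<bar> < 1 / (2 * R)" using x closure_iff_abs by blast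
    show "x \<in> Q"
    proof (cases "y = x")
      case False
      then have "0 < \<bar>y - x\<bar>" by simp
      then obtain z where z: "z \<in> Q" "\<bar>z - x\<bar> < \<bar>y - x\<bar>" using x closure_iff_abs by blast
      have "1 / (2 * R) + 1 / (2 * R) = 1 / R" using assms by (simp add: field_simps)
      then have "\<bar>z - y\<bar> < 1 / R" using y(2) z(2) by linarith
      moreover have "z \<noteq> y" using z(2) by auto
      ultimately show ?thesis using y(1) z(1) less_iff unfolding Q_def by blast
    qed (use y in simp)
  qed
  ultimately have "closed (P \<union> Q)" by (intro closed_Un) (metis closure_subset_eq)+
  moreover have "core S R = P \<union> Q" unfolding core_def P_def Q_def by auto
  ultimately show ?thesis by simp
qed

text \<open>Either \<open>S\<close> has an interior point or it has an isolated one: otherwise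
  \<open>S\<close> would lie in its own derived set and survive every derivation, while its closure
  vanishes after finitely many.\<close>

lemma core_nonempty:
  assumes "ds S" "S \<noteq> {}" shows "\<exists>R>0. core S R \<noteq> {}"
proof -
  have ball: "\<bar>y - x\<bar> < e" if "\<bar>y - x\<bar> * max \<bar>x\<bar> (1 / e) < 1" "e > 0" for x y e :: 'a
  proof -
    have "\<bar>y - x\<bar> * (1 / e) \<le> \<bar>y - x\<bar> * max \<bar>x\<bar> (1 / e)" by (intro mult_left_mono) auto
    then have "\<bar>y - x\<bar> * (1 / e) < 1" using that(1) by linarith
    then show ?thesis using that(2) by (simp add: field_simps)
  qed
  have *: "\<exists>x e. e > 0 \<and> x \<in> S \<and>
      ((\<forall>y. \<bar>y - x\<bar> < e \<longrightarrow> y \<in> S) \<or> (\<forall>y. y \<noteq> x \<longrightarrow> \<bar>y - x\<bar> < e \<longrightarrow> y \<notin> S))"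
  proof (cases "interior S = {}")
    case True
    obtain N where "\<forall>s::nat \<Rightarrow> 'a. interior S = {} \<longrightarrow> (der ^^ N) (closure S) = {}"
      using der_funpow_uniform[OF dfam_const[OF assms(1)]] ..
    then have N: "(der ^^ N) (closure S) = {}" using True by blast
    have "\<not> S \<subseteq> der S"
    proof
      assume "S \<subseteq> der S"
      then have "S \<subseteq> (der ^^ k) S" for k
        by (induction k) (auto dest: der_mono)
      then have "S \<subseteq> (der ^^ N) (closure S)" using der_funpow_mono[OF closure_subset[of S]] by blast
      then show False using N assms(2) by blast
    qed
    then obtain x where "x \<in> S" "\<not> x islimpt S" unfolding der_def by blast
    then obtain e where "e > 0" "\<forall>y\<in>S. y \<noteq> x \<longrightarrow> \<not> \<bar>y - x\<bar> < e" unfolding islimpt_iff_abs by blast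
    then show ?thesis using \<open>x \<in> S\<close> by blast
  next
    case False
    then obtain x where x: "x \<in> interior S" by blast
    then obtain e where "e > 0" "\<forall>y. \<bar>y - x\<bar> < e \<longrightarrow> y \<in> S" unfolding interior_iff_abs by blast
    then show ?thesis using x interior_subset by blast
  qed
  then obtain x e where "e > 0" and x: "x \<in> S" and
    alt: "(\<forall>y. \<bar>y - x\<bar> < e \<longrightarrow> y \<in> S) \<or> (\<forall>y. y \<noteq> x \<longrightarrow> \<bar>y - x\<bar> < e \<longrightarrow> y \<notin> S)" by blast
  have "x \<in> core S (max \<bar>x\<bar> (1 / e))"
    unfolding core_def using x alt ball[OF _ \<open>e > 0\<close>] by auto
  moreover have "max \<bar>x\<bar> (1 / e) > 0" using \<open>e > 0\<close> by (simp add: less_max_iff_disj)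
  ultimately show ?thesis by blast
qed

text \<open>The least element of \<open>core S (r + 1)\<close>, where \<open>r\<close> is the
  infimum of the bounds with nonempty core. The infimum may fail to be attained, hence the
  \<open>+ 1\<close>. Infimum and emptiness are spelled out with quantifiers to stay first-order,
  and 0 is the default for the empty set.\<close>

definition chosen :: "'a set \<Rightarrow> 'a \<Rightarrow> bool" where
  "chosen S c \<longleftrightarrow> (\<forall>x. x \<notin> S) \<and> c = 0 \<or>
     (\<exists>x. x \<in> S) \<and> (\<exists>r. (\<forall>R. 0 < R \<and> (\<exists>x. x \<in> core S R) \<longrightarrow> r \<le> R) \<and>
        (\<forall>d. (\<forall>R. 0 < R \<and> (\<exists>x. x \<in> core S R) \<longrightarrow> d \<le> R) \<longrightarrow> d \<le> r) \<and>
        c \<in> core S (r + 1) \<and> (\<forall>x. x \<in> core S (r + 1) \<longrightarrow> c \<le> x))"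

lemma chosen_mem: "chosen S c \<Longrightarrow> S \<noteq> {} \<Longrightarrow> c \<in> S"
  unfolding chosen_def core_def by auto

lemma chosen_unique:
  assumes "chosen S c" "chosen S c'" shows "c = c'"
proof (cases "S = {}")
  case True
  then show ?thesis using assms unfolding chosen_def by auto
next
  case False
  define P where "P r \<longleftrightarrow> (\<forall>R. 0 < R \<and> (\<exists>x. x \<in> core S R) \<longrightarrow> r \<le> R)" for r
  obtain r where r: "P r" "\<And>d. P d \<Longrightarrow> d \<le> r" "c \<in> core S (r + 1)" "\<And>x. x \<in> core S (r + 1) \<Longrightarrow> c \<le> x"
    using assms(1) False unfolding chosen_def P_def by auto
  obtain r' where r': "P r'" "\<And>d. P d \<Longrightarrow> d \<le> r'" "c' \<in> core S (r' + 1)"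
      "\<And>x. x \<in> core S (r' + 1) \<Longrightarrow> c' \<le> x"
    using assms(2) False unfolding chosen_def P_def by auto
  have "r = r'" using r(1,2) r'(1,2) by (simp add: order_antisym)
  then show ?thesis using r(3,4) r'(3,4) by (simp add: order_antisym)
qed

lemma dfn_chosen:
  assumes "dfam M S" "dt t" "\<And>i. dt (\<lambda>s. g s i)" shows "df (\<lambda>s. chosen (S (g s)) (t s))"
proof -
  have g': "dt (\<lambda>s. g (\<lambda>i. s (f i)) j)" for f j
    using dterm_rename[OF assms(3)] .
  note [dfn_intro] = dfamD[OF assms(1)] g' assms(3) dterm_rename[OF assms(2)] assms(2)
  have [dfn_intro]: "df (\<lambda>s. u s \<in> core (S (g (\<lambda>i. s (f i)))) (v s))" if "dt u" "dt v" for u v f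
  proof -
    note [dfn_intro] = dterm_rename[OF that(1)] dterm_rename[OF that(2)] that
    show ?thesis unfolding core_def mem_Collect_eq by (intro dfn_intro)
  qed
  show ?thesis unfolding chosen_def by (intro dfn_intro)
qed

lemma chosen_exists:
  assumes "ds S" shows "\<exists>c. chosen S c"
proof (cases "S = {}")
  case True
  then show ?thesis unfolding chosen_def by auto
next
  case False
  note [dfn_intro] = dsD[OF assms]
  have dcore: "df (\<lambda>s. u s \<in> core S (v s))" if "dt u" "dt v" for u v
  proof -
    note [dfn_intro] = dterm_rename[OF that(1)] dterm_rename[OF that(2)] that
    show ?thesis unfolding core_def mem_Collect_eq by (intro dfn_intro)
  qed
  define G where "G = {R. 0 < R \<and> (\<exists>x. x \<in> core S R)}"
  have "ds G" unfolding G_def by (intro dfn_intro dcore)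
  moreover have "G \<noteq> {}" using core_nonempty[OF assms False] unfolding G_def by blast
  moreover have "0 \<le> R" if "R \<in> G" for R using that unfolding G_def by simp
  ultimately obtain r where r: "\<And>R. R \<in> G \<Longrightarrow> r \<le> R" "\<And>d. (\<And>R. R \<in> G \<Longrightarrow> d \<le> R) \<Longrightarrow> d \<le> r"
    using inf_exists[of G 0] by blast
  have "r \<ge> 0" by (rule r(2)) (simp add: G_def)
  obtain R where R: "R \<in> G" "R < r + 1" using r(2)[of "r + 1"] by force
  have "ds (core S (r + 1))" by (intro dfn_intro dcore)
  moreover have "closed (core S (r + 1))" using \<open>r \<ge> 0\<close> by (intro closed_core) simp
  moreover have "core S (r + 1) \<noteq> {}"
    using R core_mono[of R "r + 1" S] unfolding G_def by auto
  moreover have "- (r + 1) \<le> x" if "x \<in> core S (r + 1)" for x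
    using that unfolding core_def by (auto simp: abs_le_iff)
  ultimately obtain c where c: "c \<in> core S (r + 1)" "\<And>x. x \<in> core S (r + 1) \<Longrightarrow> c \<le> x"
    using min_exists[of "core S (r + 1)" "- (r + 1)"] by blast
  have r': "(\<forall>R. 0 < R \<and> (\<exists>x. x \<in> core S R) \<longrightarrow> d \<le> R) \<longleftrightarrow> (\<forall>R\<in>G. d \<le> R)" for d
    unfolding G_def by blast
  have "\<exists>x. x \<in> S" using False by blast
  then have "chosen S c" unfolding chosen_def r'
    by (rule disjI2[OF conjI], intro exI[of _ r]) (use r c in auto)
  then show ?thesis by blast
qed

text \<open>The selection reads only the set \<open>S s\<close> and not the parameter
  \<open>s\<close>; the last clause records this and later makes representatives of equivalence
  classes unique.\<close>

lemma choice_line: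
  assumes "dfam M S"
  shows "\<exists>t. dt t \<and> (\<forall>s. S s \<noteq> {} \<longrightarrow> t s \<in> S s) \<and> (\<forall>s s'. S s = S s' \<longrightarrow> t s = t s')"
proof -
  define t where "t s = (THE c. chosen (S s) c)" for s
  have t: "chosen (S s) (t s)" for s
    unfolding t_def by (rule theI') (use chosen_exists[OF dfam_ds[OF assms]] chosen_unique in blast)
  have "dt t"
    by (rule dterm_unique[where Q = "\<lambda>s c. chosen (S s) c"])
      (use t chosen_unique in \<open>auto intro!: dfn_chosen[OF assms] dfn_intro\<close>)
  moreover have "t s = t s'" if "S s = S s'" for s s' using that by (simp add: t_def)
  ultimately show ?thesis using t chosen_mem by blast
qed

text \<open>Two such environments lie in the same fibre of the projection that forgets the
  coordinates in \<open>I\<close>; thus fibres are handled without tuples.\<close>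

definition eqoff :: "nat set \<Rightarrow> (nat \<Rightarrow> 'a) \<Rightarrow> (nat \<Rightarrow> 'a) \<Rightarrow> bool" where
  "eqoff I x y \<longleftrightarrow> (\<forall>i. i \<notin> I \<longrightarrow> x i = y i)"

lemma eqoff_refl [simp]: "eqoff I x x"
  and eqoff_sym: "eqoff I x y \<Longrightarrow> eqoff I y x"
  and eqoff_trans: "eqoff I x y \<Longrightarrow> eqoff I y z \<Longrightarrow> eqoff I x z"
  by (auto simp: eqoff_def)

lemma eqoff_insert: "eqoff (insert j I) x y \<longleftrightarrow> (\<exists>a. eqoff I (x(j := a)) y)"
proof
  assume "eqoff (insert j I) x y"
  then show "\<exists>a. eqoff I (x(j := a)) y" by (intro exI[of _ "y j"]) (auto simp: eqoff_def)
qed (auto simp: eqoff_def)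

text \<open>A block of quantifiers over the coordinates in \<open>I\<close>, bound one at a time.
  \<open>Q\<close> relates two environments; its premise interleaves them, the outer one on the even
  and the bound one on the odd variables.\<close>

lemma dfn_ex_eqoff:
  assumes "finite I" "\<And>i. dt (\<lambda>s. g s i)" "df (\<lambda>s. Q (\<lambda>i. s (2 * i)) (\<lambda>i. s (Suc (2 * i))))"
  shows "df (\<lambda>s. \<exists>y. eqoff I (g s) y \<and> Q s y)"
  using assms
proof (induction I arbitrary: g Q rule: finite_induct)
  case empty
  have eq: "eqoff {} x y \<longleftrightarrow> y = x" for x y by (auto simp: eqoff_def fun_eq_iff)
  define h where "h s i = (if even i then s (i div 2) else g s (i div 2))" for s i
  have "dt (\<lambda>s. h s i)" for i unfolding h_def
    by (intro dfn_intro empty)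
  from dfn_subst[where g = h, OF empty(2) this] have "df (\<lambda>s. Q s (g s))" by (simp add: h_def)
  then show ?case by (simp add: eq)
next
  case (insert j I)
  \<comment> \<open>Only the outer environment gains a variable, so only the even positions
    move.\<close>
  define f where "f i = (if even i then i + 2 else i)" for i :: nat
  have "df (\<lambda>s. \<exists>y. eqoff I ((g (\<lambda>i. s (Suc i)))(j := s 0)) y \<and> Q (\<lambda>i. s (Suc i)) y)"
  proof (rule insert.IH)
    show "dt (\<lambda>s. ((g (\<lambda>i. s (Suc i)))(j := s 0)) i)" for i
      by (intro dfn_intro dterm_rename[OF insert.prems(1)])
    have "(\<lambda>i. s (f (2 * i))) = (\<lambda>i. s (2 * Suc i))" "(\<lambda>i. s (f (Suc (2 * i)))) = (\<lambda>i. s (Suc (2 * i)))"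
      for s :: "nat \<Rightarrow> 'a" by (auto simp: f_def)
    with dfn_rename[OF insert.prems(2), of f]
    show "df (\<lambda>s. Q (\<lambda>i. s (2 * Suc i)) (\<lambda>i. s (Suc (2 * i))))" by simp
  qed
  then have "df (\<lambda>s. \<exists>a. \<exists>y. eqoff I ((g s)(j := a)) y \<and> Q s y)" by (rule dfn_ex)
  moreover have "(\<exists>a. \<exists>y. eqoff I ((g s)(j := a)) y \<and> Q s y) = (\<exists>y. eqoff (insert j I) (g s) y \<and> Q s y)"
    for s unfolding eqoff_insert by blast
  ultimately show ?case by simp
qed

lemma dfn_all_eqoff:
  assumes "finite I" "\<And>i. dt (\<lambda>s. g s i)" "df (\<lambda>s. Q (\<lambda>i. s (2 * i)) (\<lambda>i. s (Suc (2 * i))))"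
  shows "df (\<lambda>s. \<forall>y. eqoff I (g s) y \<longrightarrow> Q s y)"
proof -
  have "df (\<lambda>s. \<not> (\<exists>y. eqoff I (g s) y \<and> \<not> Q s y))"
    by (intro dfn_not dfn_ex_eqoff assms)
  then show ?thesis by simp
qed

lemma dset_mem: "dset M A \<Longrightarrow> (\<And>i. dt (\<lambda>s. g s i)) \<Longrightarrow> df (\<lambda>s. g s \<in> A)"
  by (rule dfn_subst)

lemma dset_ex_eqoff:
  assumes "finite I" "dset M A" shows "dset M {x. \<exists>y. eqoff I x y \<and> y \<in> A}"
  unfolding mem_Collect_eq by (intro dfn_ex_eqoff assms dset_mem[OF assms(2)] dfn_intro)

text \<open>Coordinates are chosen one after the other, each from the projection of what remains. In
  the last clause \<open>override_on\<close> compares the fibres over \<open>x\<close> and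
  \<open>x'\<close>, which may differ outside \<open>I\<close>; equal fibres receive equal
  choices.\<close>

lemma env_choice:
  assumes "finite I" "dset M A"
  shows "\<exists>g. (\<forall>i. dt (\<lambda>x. g x i)) \<and>
    (\<forall>x. (\<exists>y. eqoff I x y \<and> y \<in> A) \<longrightarrow> g x \<in> A \<and> eqoff I x (g x)) \<and>
    (\<forall>x x'. (\<forall>z. override_on x z I \<in> A \<longleftrightarrow> override_on x' z I \<in> A) \<longrightarrow> (\<forall>i\<in>I. g x i = g x' i))"
  using assms(1)
proof (induction I rule: finite_induct)
  case empty
  have "eqoff {} x y \<longleftrightarrow> y = x" for x y by (auto simp: eqoff_def fun_eq_iff)
  then show ?case by (intro exI[of _ "\<lambda>x. x"]) (auto intro: dfn_intro)
next
  case (insert j I)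
  from insert.IH obtain g where g: "\<forall>i. dt (\<lambda>x. g x i)"
    "\<forall>x. (\<exists>y. eqoff I x y \<and> y \<in> A) \<longrightarrow> g x \<in> A \<and> eqoff I x (g x)"
    "\<forall>x x'. (\<forall>z. override_on x z I \<in> A \<longleftrightarrow> override_on x' z I \<in> A) \<longrightarrow> (\<forall>i\<in>I. g x i = g x' i)"
    by (elim exE conjE)
  define S where "S x = {a. \<exists>y. eqoff I (x(j := a)) y \<and> y \<in> A}" for x
  have "dfam M S" unfolding dfam_def S_def mem_Collect_eq
    by (intro dfn_ex_eqoff insert.hyps dset_mem[OF assms(2)] dfn_intro)
  from choice_line[OF this] obtain t where t: "dt t" "\<forall>s. S s \<noteq> {} \<longrightarrow> t s \<in> S s"
      "\<forall>s s'. S s = S s' \<longrightarrow> t s = t s'" by (elim exE conjE)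
  \<comment> \<open>If the fibre is nonempty, \<open>g\<close> keeps coordinate \<open>j\<close> and
    the outer update changes nothing; over empty fibres the update secures the last clause at
    \<open>j\<close>.\<close>
  define h where "h x = (g (x(j := t x)))(j := t x)" for x
  have "dt (\<lambda>x. h x i)" for i
    unfolding h_def by (intro dfn_intro dterm_subst[OF g(1)[rule_format]] t(1))
  moreover have "h x \<in> A \<and> eqoff (insert j I) x (h x)" if ex: "\<exists>y. eqoff (insert j I) x y \<and> y \<in> A" for x
  proof -
    have "S x \<noteq> {}" using ex unfolding S_def eqoff_insert by blast
    then have "t x \<in> S x" using t(2) by blast
    then have *: "g (x(j := t x)) \<in> A \<and> eqoff I (x(j := t x)) (g (x(j := t x)))"
      unfolding S_def using g(2) by blast
    then have "g (x(j := t x)) j = t x" using insert.hyps(2) unfolding eqoff_def by (metis fun_upd_same)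
    then have "h x = g (x(j := t x))" unfolding h_def by auto
    then show ?thesis using * unfolding eqoff_insert by metis
  qed
  moreover have "h x i = h x' i"
    if same: "\<forall>z. override_on x z (insert j I) \<in> A \<longleftrightarrow> override_on x' z (insert j I) \<in> A"
      and i: "i \<in> insert j I" for x x' i
  proof -
    have S_iff: "a \<in> S w \<longleftrightarrow> (\<exists>z. z j = a \<and> override_on w z (insert j I) \<in> A)" for a w
    proof
      assume "a \<in> S w"
      then obtain y where y: "eqoff I (w(j := a)) y" "y \<in> A" unfolding S_def by blast
      then have "override_on w y (insert j I) = y" "y j = a" using insert.hyps(2)
        by (auto simp: override_on_def eqoff_def fun_eq_iff)
      then show "\<exists>z. z j = a \<and> override_on w z (insert j I) \<in> A" using y by auto
    next
      assume "\<exists>z. z j = a \<and> override_on w z (insert j I) \<in> A"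
      then obtain z where z: "z j = a" "override_on w z (insert j I) \<in> A" by blast
      then have "eqoff I (w(j := a)) (override_on w z (insert j I))"
        by (auto simp: override_on_def eqoff_def)
      then show "a \<in> S w" using z unfolding S_def by blast
    qed
    have "S x = S x'" using S_iff same by blast
    then have tt: "t x = t x'" using t(3) by blast
    have ov: "override_on (w(j := a)) z I = override_on w (z(j := a)) (insert j I)" for w z :: "nat \<Rightarrow> 'a" and a
      using insert.hyps(2) by (auto simp: override_on_def fun_eq_iff)
    have *: "\<forall>z. override_on (x(j := t x)) z I \<in> A \<longleftrightarrow> override_on (x'(j := t x')) z I \<in> A"
      unfolding ov tt using same by blast
    show ?thesis
      using g(3)[rule_format, OF *[rule_format]] tt i unfolding h_def by (cases "i = j") auto
  qed
  ultimately show ?case by (intro exI[of _ h]) blast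
qed

section \<open>Sets with interior and generic oscillation\<close>

text \<open>Only the coordinates in \<open>I\<close> are allowed to move; the others are parameters.\<close>

definition nb :: "nat set \<Rightarrow> (nat \<Rightarrow> 'a) \<Rightarrow> 'a \<Rightarrow> (nat \<Rightarrow> 'a) set" where
  "nb I x e = {y. eqoff I x y \<and> (\<forall>i\<in>I. \<bar>y i - x i\<bar> < e)}"

text \<open>Interior points of the slice of \<open>A\<close> through \<open>x\<close> in the
  directions \<open>I\<close>. The quantifiers have the shape required by the rules for
  \<open>eqoff\<close>; \<open>has_interior_nb\<close> is the readable form.\<close>

definition has_interior :: "nat set \<Rightarrow> (nat \<Rightarrow> 'a) set \<Rightarrow> (nat \<Rightarrow> 'a) \<Rightarrow> bool" where
  "has_interior I A x \<longleftrightarrow> (\<exists>y. eqoff I x y \<and> (\<exists>e>0. \<forall>z. eqoff I y z \<longrightarrow> (\<forall>i\<in>I. \<bar>z i - y i\<bar> < e) \<longrightarrow> z \<in> A))"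

lemma has_interior_nb: "has_interior I A x \<longleftrightarrow> (\<exists>y. eqoff I x y \<and> (\<exists>e>0. nb I y e \<subseteq> A))"
  unfolding has_interior_def nb_def by (simp add: subset_iff imp_conjL)

lemma has_interior_mono: "has_interior I A x \<Longrightarrow> (\<And>z. eqoff I x z \<Longrightarrow> z \<in> A \<Longrightarrow> z \<in> B) \<Longrightarrow> has_interior I B x"
  unfolding has_interior_def by (metis eqoff_trans)

lemma nb_center: "0 < e \<Longrightarrow> x \<in> nb I x e"
  by (simp add: nb_def)

lemma nb_mono: "e \<le> e' \<Longrightarrow> nb I x e \<subseteq> nb I x e'"
  unfolding nb_def by fastforce

lemma nb_eqoff: "y \<in> nb I x e \<Longrightarrow> eqoff I x y"
  by (simp add: nb_def)

lemma has_interior_nonempty: "has_interior I A x \<Longrightarrow> \<exists>y. eqoff I x y \<and> y \<in> A"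
  unfolding has_interior_nb using nb_center by blast

lemma nb_inner:
  assumes "finite I" "y \<in> nb I x e" shows "\<exists>e'>0. nb I y e' \<subseteq> nb I x e"
proof -
  have "\<And>i. i \<in> I \<Longrightarrow> 0 < e - \<bar>y i - x i\<bar>" using assms(2) by (simp add: nb_def)
  then obtain e' where e': "0 < e'" "\<forall>i\<in>I. e' \<le> e - \<bar>y i - x i\<bar>"
    using finite_positive_lower_bound[OF assms(1), of "\<lambda>i. e - \<bar>y i - x i\<bar>"] by blast
  have "nb I y e' \<subseteq> nb I x e"
  proof
    fix z assume z: "z \<in> nb I y e'"
    have "\<bar>z i - x i\<bar> < e" if "i \<in> I" for i
    proof -
      have "\<bar>z i - y i\<bar> < e'" using z that by (simp add: nb_def)
      moreover have "e' \<le> e - \<bar>y i - x i\<bar>" using e'(2) that by blast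
      ultimately show ?thesis by linarith
    qed
    then show "z \<in> nb I x e" using z assms(2) eqoff_trans by (auto simp: nb_def)
  qed
  then show ?thesis using e'(1) by blast
qed

lemma has_interior_nb_center: "0 < e \<Longrightarrow> has_interior I (nb I x e) x"
  unfolding has_interior_nb by (intro exI[of _ x]) auto

lemma dfn_has_interior:
  assumes "finite I" "dset M A" "\<And>i. dt (\<lambda>s. g s i)"
  shows "df (\<lambda>s. has_interior I A (g s))"
  unfolding has_interior_def
  by (rule dfn_intro dfn_ex_eqoff dfn_all_eqoff assms(1) dset_mem[OF assms(2)] dterm_rename[OF assms(3)]
      assms(3) dfn_ball_finite)+

lemma dset_has_interior:
  assumes "finite I" "dset M A" shows "dset M {x. has_interior I A x}"
  unfolding mem_Collect_eq by (intro dfn_has_interior assms dfn_intro)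

text \<open>For finite \<open>I\<close> the ball \<open>nb I x e\<close> fixes infinitely many
  coordinates and so is not a definable set of environments. The box leaves the coordinates outside
  \<open>I\<close> free and cuts out the same ball in the fibre of \<open>x\<close>.\<close>

definition box :: "nat set \<Rightarrow> (nat \<Rightarrow> 'a) \<Rightarrow> 'a \<Rightarrow> (nat \<Rightarrow> 'a) set" where
  "box I x e = {y. \<forall>i\<in>I. \<bar>y i - x i\<bar> < e}"

lemma nb_subset_box: "nb I x e \<subseteq> box I x e"
  by (auto simp: nb_def box_def)

lemma nb_subset_if_box: "eqoff I x y \<Longrightarrow> nb I y e' \<subseteq> box I x e \<Longrightarrow> nb I y e' \<subseteq> nb I x e"
  using eqoff_trans by (fastforce simp: nb_def box_def)

lemma dset_box:
  assumes "finite I" shows "dset M (box I x e)"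
  unfolding box_def mem_Collect_eq by (intro dfn_ball_finite assms dfn_intro)

lemma dset_Int: "dset M A \<Longrightarrow> dset M B \<Longrightarrow> dset M (A \<inter> B)"
  unfolding Int_iff by (rule dfn_conj)

lemma dset_Diff: "dset M A \<Longrightarrow> dset M B \<Longrightarrow> dset M (A - B)"
  unfolding Diff_iff by (intro dfn_intro)

lemma nb_line: "nb {j} x e = {x(j := a) |a. \<bar>a - x j\<bar> < e}"
proof (intro subset_antisym subsetI)
  fix y assume y: "y \<in> nb {j} x e"
  then have "y = x(j := y j)" unfolding nb_def eqoff_def by (intro ext) simp
  moreover have "\<bar>y j - x j\<bar> < e" using y by (simp add: nb_def)
  ultimately show "y \<in> {x(j := a) |a. \<bar>a - x j\<bar> < e}" by blast
next
  fix y assume "y \<in> {x(j := a) |a. \<bar>a - x j\<bar> < e}"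
  then show "y \<in> nb {j} x e" by (auto simp: nb_def eqoff_def)
qed

lemma has_interior_line: "has_interior {j} A x \<longleftrightarrow> interior {a. x(j := a) \<in> A} \<noteq> {}"
proof -
  have "has_interior {j} A x \<longleftrightarrow> (\<exists>b. \<exists>e>0. nb {j} (x(j := b)) e \<subseteq> A)"
  proof
    assume "has_interior {j} A x"
    then obtain y e where "eqoff {j} x y" "e > 0" "nb {j} y e \<subseteq> A" unfolding has_interior_nb by blast
    moreover from this have "y = x(j := y j)" unfolding eqoff_def by (auto simp: fun_eq_iff)
    ultimately show "\<exists>b. \<exists>e>0. nb {j} (x(j := b)) e \<subseteq> A" by metis
  next
    assume "\<exists>b. \<exists>e>0. nb {j} (x(j := b)) e \<subseteq> A"
    moreover have "eqoff {j} x (x(j := b))" for b by (simp add: eqoff_def)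
    ultimately show "has_interior {j} A x" unfolding has_interior_nb by blast
  qed
  also have "\<dots> \<longleftrightarrow> (\<exists>b. \<exists>e>0. \<forall>a. \<bar>a - b\<bar> < e \<longrightarrow> x(j := a) \<in> A)"
    unfolding nb_line by (auto simp: subset_iff)
  also have "\<dots> \<longleftrightarrow> interior {a. x(j := a) \<in> A} \<noteq> {}"
    unfolding ex_in_conv[symmetric] interior_iff_abs by simp
  finally show ?thesis .
qed

lemma has_interior_insert_imp:
  assumes "j \<notin> I" "has_interior (insert j I) A x" shows "has_interior I {y. has_interior {j} A y} x"
proof -
  obtain y e where ye: "eqoff (insert j I) x y" "e > 0" "nb (insert j I) y e \<subseteq> A"
    using assms(2) unfolding has_interior_nb by blast
  \<comment> \<open>The base point must agree with \<open>x\<close> at \<open>j\<close>, since only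
    coordinates in \<open>I\<close> may move; the line over it passes through the value
    \<open>y j\<close>.\<close>
  define w where "w = y(j := x j)"
  have "eqoff I x w" using ye(1) assms(1) by (auto simp: w_def eqoff_def)
  moreover have "nb I w e \<subseteq> {y. has_interior {j} A y}"
  proof
    fix z assume z: "z \<in> nb I w e"
    have "nb {j} (z(j := y j)) e \<subseteq> nb (insert j I) y e"
    proof
      fix v assume v: "v \<in> nb {j} (z(j := y j)) e"
      then have vz: "v i = z i" if "i \<noteq> j" for i using that by (simp add: nb_def eqoff_def)
      have "y i = v i" if "i \<notin> insert j I" for i
      proof -
        have "w i = z i" using z that by (simp add: nb_def eqoff_def)
        then show ?thesis using vz[of i] that by (simp add: w_def)
      qed
      moreover have "\<bar>v i - y i\<bar> < e" if "i \<in> insert j I" for i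
        using z v vz[of i] that assms(1) by (cases "i = j") (auto simp: nb_def w_def)
      ultimately show "v \<in> nb (insert j I) y e" by (simp add: nb_def eqoff_def)
    qed
    moreover have "eqoff {j} z (z(j := y j))" by (simp add: eqoff_def)
    ultimately show "z \<in> {y. has_interior {j} A y}" using ye(2,3) unfolding has_interior_nb by blast
  qed
  ultimately show ?thesis using ye(2) unfolding has_interior_nb[of I] by blast
qed

section \<open>Generic regularity by induction on the number of coordinates\<close>

definition small_union :: "nat set \<Rightarrow> bool" where
  "small_union I \<longleftrightarrow> (\<forall>A B x. dset M A \<longrightarrow> dset M B \<longrightarrow> has_interior I (A \<union> B) x \<longrightarrow>
     has_interior I A x \<or> has_interior I B x)"

definition locally_bounded :: "nat set \<Rightarrow> bool" where
  "locally_bounded I \<longleftrightarrow> (\<forall>f x e. dt f \<longrightarrow> 0 < e \<longrightarrow>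
     (\<exists>y e' c. 0 < e' \<and> nb I y e' \<subseteq> nb I x e \<and> (\<forall>z\<in>nb I y e'. f z \<le> c)))"

definition small_oscillation :: "nat set \<Rightarrow> bool" where
  "small_oscillation I \<longleftrightarrow> (\<forall>f x e d. dt f \<longrightarrow> 0 < e \<longrightarrow> 0 < d \<longrightarrow>
     (\<exists>y e'. 0 < e' \<and> nb I y e' \<subseteq> nb I x e \<and> (\<forall>z\<in>nb I y e'. \<forall>w\<in>nb I y e'. \<bar>f z - f w\<bar> < d)))"

lemma locally_boundedD:
  assumes "locally_bounded I" "dt f" "0 < e"
  obtains y e' c where "0 < e'" "nb I y e' \<subseteq> nb I x e" "\<And>z. z \<in> nb I y e' \<Longrightarrow> f z \<le> c"
proof -
  from assms(1)[unfolded locally_bounded_def, rule_format, OF assms(2,3), of x] show thesis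
    using that by blast
qed

lemma small_oscillationD:
  assumes "small_oscillation I" "dt f" "0 < e" "0 < d"
  obtains y e' where "0 < e'" "nb I y e' \<subseteq> nb I x e"
    "\<And>z w. z \<in> nb I y e' \<Longrightarrow> w \<in> nb I y e' \<Longrightarrow> \<bar>f z - f w\<bar> < d"
proof -
  from assms(1)[unfolded small_oscillation_def, rule_format, OF assms(2-4), of x] show thesis
    using that by blast
qed

lemma small_union_line: "small_union {j}"
  unfolding small_union_def
proof (intro allI impI)
  fix A B x assume *: "dset M A" "dset M B" "has_interior {j} (A \<union> B) x"
  have "ds {a. x(j := a) \<in> A}"
    unfolding mem_Collect_eq by (intro dset_mem[OF *(1)] dfn_intro)
  moreover have "{a. x(j := a) \<in> A \<union> B} = {a. x(j := a) \<in> A} \<union> {a. x(j := a) \<in> B}" by auto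
  ultimately show "has_interior {j} A x \<or> has_interior {j} B x"
    using *(3) interior_Un_nonempty[of "{a. x(j := a) \<in> A}" "{a. x(j := a) \<in> B}"]
    unfolding has_interior_line by simp
qed

lemma locally_bounded_line: "locally_bounded {j}"
  unfolding locally_bounded_def
proof (intro allI impI)
  fix f x and e :: 'a assume f: "dt f" and "0 < e"
  have "dt (\<lambda>s. f (x(j := s 0)))" by (rule dterm_subst[OF f]) (rule dfn_intro)+
  from this have "\<exists>c. interior {a \<in> {x j - e<..<x j + e}. f (x(j := a)) \<le> c} \<noteq> {}"
    by (rule baire_line) (use \<open>0 < e\<close> in simp)
  then obtain c where c: "interior {a \<in> {x j - e<..<x j + e}. f (x(j := a)) \<le> c} \<noteq> {}" ..
  then obtain b where "b \<in> interior {a \<in> {x j - e<..<x j + e}. f (x(j := a)) \<le> c}" by blast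
  then obtain e' where e': "e' > 0"
      "\<And>a. \<bar>a - b\<bar> < e' \<Longrightarrow> a \<in> {x j - e<..<x j + e} \<and> f (x(j := a)) \<le> c"
    unfolding interior_iff_abs by blast
  have "\<bar>a - x j\<bar> < e" if "\<bar>a - b\<bar> < e'" for a using e'(2)[OF that] by (auto simp: abs_less_iff)
  then have "nb {j} (x(j := b)) e' \<subseteq> nb {j} x e" unfolding nb_line by auto
  moreover have "\<forall>z\<in>nb {j} (x(j := b)) e'. f z \<le> c" unfolding nb_line using e'(2) by auto
  ultimately show "\<exists>y e' c. 0 < e' \<and> nb {j} y e' \<subseteq> nb {j} x e \<and> (\<forall>z\<in>nb {j} y e'. f z \<le> c)"
    using e'(1) by blast
qed

lemma ds_image_nb:
  assumes "finite I" "dt f" shows "ds {a. \<exists>y. eqoff I x y \<and> ((\<forall>i\<in>I. \<bar>y i - x i\<bar> < e) \<and> a = f y)}"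
proof -
  note [dfn_intro] = dterm_subst[OF assms(2)]
  show ?thesis unfolding mem_Collect_eq
    by (rule dfn_intro dfn_ex_eqoff assms(1) dfn_ball_finite)+
qed

lemma near_inf:
  assumes "finite I" "dt f" "0 < e" "0 < d" "\<And>z. z \<in> nb I x e \<Longrightarrow> c \<le> f z"
  obtains z where "z \<in> nb I x e" "\<And>w. w \<in> nb I x e \<Longrightarrow> f z < f w + d"
proof -
  let ?S = "{a. \<exists>y. eqoff I x y \<and> ((\<forall>i\<in>I. \<bar>y i - x i\<bar> < e) \<and> a = f y)}"
  have eq: "?S = f ` nb I x e" unfolding nb_def by auto
  have lb: "c \<le> a" if "a \<in> f ` nb I x e" for a using that assms(5) by blast
  have ne: "f ` nb I x e \<noteq> {}" using nb_center[OF assms(3)] by blast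
  obtain m where m: "\<And>a. a \<in> f ` nb I x e \<Longrightarrow> m \<le> a" "\<And>d. (\<And>a. a \<in> f ` nb I x e \<Longrightarrow> d \<le> a) \<Longrightarrow> d \<le> m"
    using inf_exists[OF ds_image_nb[OF assms(1,2), of x e, unfolded eq] ne lb] by blast
  have "\<exists>z\<in>nb I x e. f z < m + d"
  proof (rule ccontr)
    assume "\<not> ?thesis"
    then have "m + d \<le> a" if "a \<in> f ` nb I x e" for a using that by (auto simp: not_less)
    then have "m + d \<le> m" by (rule m(2))
    then show False using assms(4) by simp
  qed
  then obtain z where z: "z \<in> nb I x e" "f z < m + d" by blast
  moreover have "f z < f w + d" if "w \<in> nb I x e" for w
    using z(2) m(1)[OF imageI[OF that]] by linarith
  ultimately show thesis using that by blast
qed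

text \<open>The points where \<open>f\<close> is close to its local infimum are dense, hence contain a ball. In this
  ball choose a point where \<open>f\<close> is close to its supremum.\<close>

lemma small_oscillation_if:
  assumes fin: "finite I" and un: "small_union I" and bd: "locally_bounded I"
  shows "small_oscillation I"
  unfolding small_oscillation_def
proof (intro allI impI)
  fix f x and e d :: 'a assume f: "dt f" and "0 < e" "0 < d"
  have mf: "dt (\<lambda>s. - f s)" by (intro dfn_intro f)
  obtain x1 e1 c1 where 1: "0 < e1" "nb I x1 e1 \<subseteq> nb I x e" "\<And>z. z \<in> nb I x1 e1 \<Longrightarrow> f z \<le> c1"
    by (rule locally_boundedD[OF bd f \<open>0 < e\<close>, where x = x]) (rule that)
  obtain x2 e2 c2 where 2: "0 < e2" "nb I x2 e2 \<subseteq> nb I x1 e1" "\<And>z. z \<in> nb I x2 e2 \<Longrightarrow> - f z \<le> c2"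
    by (rule locally_boundedD[OF bd mf 1(1), where x = x1]) (rule that)
  define d3 where "d3 = d / 3"
  have "0 < d3" "d3 + d3 + d3 = d" using \<open>0 < d\<close> by (auto simp: d3_def)
  define A where "A = {z. \<exists>r>0. \<forall>w. eqoff I z w \<longrightarrow> (\<forall>i\<in>I. \<bar>w i - z i\<bar> < r) \<longrightarrow> f z < f w + d3}"
  have mem_A: "z \<in> A \<longleftrightarrow> (\<exists>r>0. \<forall>w\<in>nb I z r. f z < f w + d3)" for z
    unfolding A_def nb_def by auto
  note [dfn_intro] = dterm_subst[OF f]
  have dA: "dset M A" unfolding A_def mem_Collect_eq
    by (rule dfn_intro dfn_all_eqoff fin dfn_ball_finite)+
  note dbox = dset_box[OF fin, of x2 e2]
  \<comment> \<open>Were a ball free of \<open>A\<close>, a point of it where \<open>f\<close>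
    nearly attains its infimum would still belong to \<open>A\<close>.\<close>
  have dense: "\<not> nb I y e' \<subseteq> box I x2 e2 - A" if "eqoff I x2 y" "0 < e'" for y e'
  proof
    assume sub: "nb I y e' \<subseteq> box I x2 e2 - A"
    have "nb I y e' \<subseteq> nb I x2 e2" using nb_subset_if_box[OF that(1)] sub by blast
    then have "- c2 \<le> f z" if "z \<in> nb I y e'" for z using 2(3)[of z] that by force
    then obtain z where z: "z \<in> nb I y e'" "\<And>w. w \<in> nb I y e' \<Longrightarrow> f z < f w + d3"
      using near_inf[OF fin f \<open>0 < e'\<close> \<open>0 < d3\<close>] by blast
    obtain r where "r > 0" "nb I z r \<subseteq> nb I y e'" using nb_inner[OF fin z(1)] by blast
    then have "z \<in> A" unfolding mem_A using z(2) by blast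
    then show False using sub z(1) by blast
  qed
  have "has_interior I ((box I x2 e2 - A) \<union> (box I x2 e2 \<inter> A)) x2"
    by (rule has_interior_mono[OF has_interior_nb_center[OF 2(1)]]) (use nb_subset_box in blast)
  then have "has_interior I (box I x2 e2 - A) x2 \<or> has_interior I (box I x2 e2 \<inter> A) x2"
    using un[unfolded small_union_def] dset_Diff[OF dbox dA] dset_Int[OF dbox dA] by blast
  then obtain y e' where y': "eqoff I x2 y" "0 < e'" "nb I y e' \<subseteq> box I x2 e2 \<inter> A"
    using dense unfolding has_interior_nb by blast
  then have y: "0 < e'" "nb I y e' \<subseteq> nb I x2 e2 \<inter> A"
    using nb_subset_if_box[OF y'(1), of e' e2] by auto
  have "- c1 \<le> - f z" if "z \<in> nb I y e'" for z using 1(3)[of z] y(2) 2(2) that by force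
  then obtain z where z: "z \<in> nb I y e'" "\<And>w. w \<in> nb I y e' \<Longrightarrow> - f z < - f w + d3"
    using near_inf[OF fin mf y(1) \<open>0 < d3\<close>] by blast
  obtain r where r: "0 < r" "\<And>w. w \<in> nb I z r \<Longrightarrow> f z < f w + d3"
    using z(1) y(2) mem_A by blast
  obtain r' where r': "0 < r'" "nb I z r' \<subseteq> nb I y e'" using nb_inner[OF fin z(1)] by blast
  define q where "q = min r r'"
  have q: "0 < q" "nb I z q \<subseteq> nb I z r" "nb I z q \<subseteq> nb I z r'"
    using r(1) r'(1) by (auto simp: q_def intro!: nb_mono)
  \<comment> \<open>\<open>z\<close> nearly maximises \<open>f\<close> on the larger ball and nearly
    minimises it on a smaller one, so near \<open>z\<close> all values are within \<open>d3\<close>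
    of \<open>f z\<close>.\<close>
  have close: "f z < f w + d3 \<and> f w < f z + d3" if "w \<in> nb I z q" for w
    using r(2)[of w] z(2)[of w] q(2,3) r'(2) that by force
  have "\<bar>f w - f w'\<bar> < d" if "w \<in> nb I z q" "w' \<in> nb I z q" for w w'
    using close[OF that(1)] close[OF that(2)] \<open>0 < d3\<close> \<open>d3 + d3 + d3 = d\<close> by (auto simp: abs_less_iff)
  moreover have "nb I z q \<subseteq> nb I x e" using q(3) r'(2) y(2) 2(2) 1(2) by blast
  ultimately show "\<exists>y e'. 0 < e' \<and> nb I y e' \<subseteq> nb I x e \<and>
      (\<forall>z\<in>nb I y e'. \<forall>w\<in>nb I y e'. \<bar>f z - f w\<bar> < d)"
    using q(1) by blast
qed

text \<open>In each fibre choose definably the centre \<open>t1\<close> and the radius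
  \<open>t2\<close> of an interval contained in \<open>A\<close>. On a smaller ball
  \<open>1 / t2\<close> is bounded, so the radius is at least some \<open>r0\<close>, and on a still
  smaller one the centre varies by less than \<open>r0 / 2\<close>; the intervals then share a
  common part of radius \<open>r0 / 2\<close>.\<close>

lemma has_interior_fubini:
  assumes fin: "finite I" and bd: "locally_bounded I" and osc: "small_oscillation I"
    and j: "j \<notin> I" and A: "dset M A" and int: "has_interior I {y. has_interior {j} A y} x"
  shows "has_interior (insert j I) A x"
proof -
  obtain y0 e0 where 0: "eqoff I x y0" "0 < e0" "\<And>y. y \<in> nb I y0 e0 \<Longrightarrow> has_interior {j} A y"
    using int unfolding has_interior_nb[of I] by blast
  define S1 where "S1 y = {c. \<exists>r>0. \<forall>a. \<bar>a - c\<bar> < r \<longrightarrow> y(j := a) \<in> A}" for y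
  have "dfam M S1" unfolding dfam_def S1_def mem_Collect_eq
    by (intro dfn_intro dset_mem[OF A])
  from choice_line[OF this] obtain t1 where t1: "dt t1" "\<forall>s. S1 s \<noteq> {} \<longrightarrow> t1 s \<in> S1 s"
    by (elim exE conjE)
  define S2 where "S2 y = {r. 0 < r \<and> (\<forall>a. \<bar>a - t1 y\<bar> < r \<longrightarrow> y(j := a) \<in> A)}" for y
  note [dfn_intro] = dterm_rename[OF t1(1)]
  have "dfam M S2" unfolding dfam_def S2_def mem_Collect_eq
    by (intro dfn_intro dset_mem[OF A])
  from choice_line[OF this] obtain t2 where t2: "dt t2" "\<forall>s. S2 s \<noteq> {} \<longrightarrow> t2 s \<in> S2 s"
    by (elim exE conjE)
  have t2_mem: "t2 y \<in> S2 y" if "y \<in> nb I y0 e0" for y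
  proof -
    have "\<exists>c. c \<in> interior {a. y(j := a) \<in> A}" using 0(3)[OF that] unfolding has_interior_line by blast
    then have "S1 y \<noteq> {}" unfolding interior_iff_abs S1_def by blast
    then have "t1 y \<in> S1 y" using t1(2) by blast
    then have "S2 y \<noteq> {}" unfolding S1_def S2_def by blast
    then show ?thesis using t2(2) by blast
  qed
  have df: "dt (\<lambda>y. 1 / t2 y)" by (intro dfn_intro t2)
  obtain y1 e1 c where 1: "0 < e1" "nb I y1 e1 \<subseteq> nb I y0 e0" "\<And>z. z \<in> nb I y1 e1 \<Longrightarrow> 1 / t2 z \<le> c"
    by (rule locally_boundedD[OF bd df 0(2), where x = y0]) (rule that)
  have pos: "0 < t2 y" if "y \<in> nb I y1 e1" for y using t2_mem[of y] 1(2) that by (auto simp: S2_def)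
  have "0 < c" using 1(3)[OF nb_center[OF 1(1)]] pos[OF nb_center[OF 1(1)]]
    by (meson less_le_trans zero_less_divide_1_iff)
  define r0 where "r0 = 1 / c"
  have "0 < r0" using \<open>0 < c\<close> by (simp add: r0_def)
  have t2_ge: "r0 \<le> t2 y" if "y \<in> nb I y1 e1" for y
    using 1(3)[OF that] pos[OF that] \<open>0 < c\<close> unfolding r0_def by (simp add: field_simps)
  have "0 < r0 / 2" using \<open>0 < r0\<close> by simp
  obtain y2 e2 where 2: "0 < e2" "nb I y2 e2 \<subseteq> nb I y1 e1"
      "\<And>z w. z \<in> nb I y2 e2 \<Longrightarrow> w \<in> nb I y2 e2 \<Longrightarrow> \<bar>t1 z - t1 w\<bar> < r0 / 2"
    by (rule small_oscillationD[OF osc t1(1) 1(1) \<open>0 < r0 / 2\<close>, where x = y1]) (rule that)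
  define p where "p = y2(j := t1 y2)"
  define q where "q = min e2 (r0 / 2)"
  have "y2 \<in> nb I y0 e0" using nb_center[OF 2(1)] 2(2) 1(2) by blast
  then have "eqoff I x y2" using 0(1) nb_eqoff eqoff_trans by blast
  then have "eqoff (insert j I) x p" by (auto simp: p_def eqoff_def)
  moreover have "0 < q" using 2(1) \<open>0 < r0\<close> by (simp add: q_def)
  moreover have "nb (insert j I) p q \<subseteq> A"
  proof
    fix z assume z: "z \<in> nb (insert j I) p q"
    define z' where "z' = z(j := y2 j)"
    have zi: "\<bar>z i - p i\<bar> < q" if "i \<in> insert j I" for i using z that by (auto simp: nb_def)
    have "y2 i = z' i" if "i \<notin> I" for i
      using z that by (cases "i = j") (auto simp: nb_def eqoff_def z'_def p_def)
    moreover have "\<bar>z' i - y2 i\<bar> < e2" if "i \<in> I" for i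
    proof -
      have "i \<noteq> j" using that j by blast
      then show ?thesis using zi[of i] that by (simp add: z'_def p_def q_def)
    qed
    ultimately have z': "z' \<in> nb I y2 e2" by (simp add: nb_def eqoff_def)
    have "\<bar>z j - t1 y2\<bar> < r0 / 2" using zi[of j] by (simp add: p_def q_def)
    moreover have "\<bar>t1 y2 - t1 z'\<bar> < r0 / 2" using 2(3)[OF nb_center[OF 2(1)] z'] .
    ultimately have "\<bar>z j - t1 z'\<bar> < r0 / 2 + r0 / 2" by linarith
    then have "\<bar>z j - t1 z'\<bar> < t2 z'" using t2_ge[of z'] 2(2) z' by auto
    moreover have "t2 z' \<in> S2 z'" using t2_mem z' 2(2) 1(2) by blast
    ultimately have "z'(j := z j) \<in> A" by (simp add: S2_def)
    then show "z \<in> A" by (simp add: z'_def)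
  qed
  ultimately show ?thesis unfolding has_interior_nb by blast
qed

text \<open>Split the union on each line in direction \<open>j\<close>, then split the base over
  \<open>I\<close>; the Fubini lemma carries interior in base and fibres back to the total
  set.\<close>

lemma small_union_insert:
  assumes fin: "finite I" and un: "small_union I" and bd: "locally_bounded I"
    and osc: "small_oscillation I" and j: "j \<notin> I"
  shows "small_union (insert j I)"
  unfolding small_union_def
proof (intro allI impI)
  fix A B x assume A: "dset M A" and B: "dset M B" and int: "has_interior (insert j I) (A \<union> B) x"
  have "has_interior I {y. has_interior {j} (A \<union> B) y} x" by (rule has_interior_insert_imp[OF j int])
  then have "has_interior I ({y. has_interior {j} A y} \<union> {y. has_interior {j} B y}) x"
    by (rule has_interior_mono) (use small_union_line[of j] A B in \<open>auto simp: small_union_def\<close>)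
  moreover have "dset M {y. has_interior {j} A y}" "dset M {y. has_interior {j} B y}"
    by (intro dset_has_interior A B finite.intros)+
  ultimately have "has_interior I {y. has_interior {j} A y} x \<or> has_interior I {y. has_interior {j} B y} x"
    using un unfolding small_union_def by blast
  then show "has_interior (insert j I) A x \<or> has_interior (insert j I) B x"
    using has_interior_fubini[OF fin bd osc j A] has_interior_fubini[OF fin bd osc j B] by blast
qed

text \<open>On each line in direction \<open>j\<close> the function is bounded on some interval. A
  definable choice \<open>t\<close> of such a bound is itself bounded by some \<open>c\<close> on a
  ball of the base, so the sublevel set of \<open>c\<close> has fibres with interior over this ball,
  and the Fubini lemma applies.\<close>

lemma locally_bounded_insert:
  assumes fin: "finite I" and bd: "locally_bounded I" and osc: "small_oscillation I" and j: "j \<notin> I"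
  shows "locally_bounded (insert j I)"
  unfolding locally_bounded_def
proof (intro allI impI)
  fix f x and e :: 'a assume f: "dt f" and e: "0 < e"
  note [dfn_intro] = dterm_subst[OF f]
  \<comment> \<open>The interval has to stay within \<open>e\<close> of \<open>x j\<close>;
    otherwise the final box could leave the given ball.\<close>
  define S where "S z = {c. \<exists>b. \<exists>r>0. \<forall>a. \<bar>a - b\<bar> < r \<longrightarrow> \<bar>a - x j\<bar> < e \<and> f (z(j := a)) \<le> c}" for z
  have "dfam M S" unfolding dfam_def S_def mem_Collect_eq
    by (intro dfn_intro)
  from choice_line[OF this] obtain t where t: "dt t" "\<forall>s. S s \<noteq> {} \<longrightarrow> t s \<in> S s"
    by (elim exE conjE)
  have "S z \<noteq> {}" for z
  proof -
    obtain y e' c where y: "0 < e'" "nb {j} y e' \<subseteq> nb {j} (z(j := x j)) e" "\<And>w. w \<in> nb {j} y e' \<Longrightarrow> f w \<le> c"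
      by (rule locally_boundedD[OF locally_bounded_line f e, where x = "z(j := x j)"]) (rule that)
    have "\<bar>a - x j\<bar> < e \<and> f (z(j := a)) \<le> c" if "\<bar>a - y j\<bar> < e'" for a
    proof -
      have "y(j := a) \<in> nb {j} y e'" using that unfolding nb_line by blast
      moreover from this have "y(j := a) \<in> nb {j} (z(j := x j)) e" using y(2) by blast
      then obtain a' where a': "y(j := a) = z(j := a')" "\<bar>a' - x j\<bar> < e" unfolding nb_line by auto
      moreover have "a' = a" using fun_cong[OF a'(1), of j] by simp
      ultimately show ?thesis using y(3) by auto
    qed
    then show ?thesis using y(1) unfolding S_def by blast
  qed
  then have tS: "t z \<in> S z" for z using t(2) by blast
  obtain y e' c where y: "0 < e'" "nb I y e' \<subseteq> nb I x e" "\<And>z. z \<in> nb I y e' \<Longrightarrow> t z \<le> c"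
    by (rule locally_boundedD[OF bd t(1) e, where x = x]) (rule that)
  define B where "B = {w. w \<in> box (insert j I) x e \<and> f w \<le> c}"
  have dB: "dset M B" unfolding B_def mem_Collect_eq
    by (intro dfn_conj dset_box finite.intros fin dfn_le f dterm_const)
  have "has_interior {j} B z" if z: "z \<in> nb I y e'" for z
  proof -
    obtain b r where r: "r > 0" "\<And>a. \<bar>a - b\<bar> < r \<Longrightarrow> \<bar>a - x j\<bar> < e \<and> f (z(j := a)) \<le> t z"
      using tS[of z] unfolding S_def by blast
    have zI: "\<bar>z i - x i\<bar> < e" if "i \<in> I" for i using z y(2) that by (auto simp: nb_def)
    have "z(j := a) \<in> B" if "\<bar>a - b\<bar> < r" for a
      using r(2)[OF that] zI y(3)[OF z] unfolding B_def box_def by auto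
    then have "b \<in> interior {a. z(j := a) \<in> B}" unfolding interior_iff_abs using r(1) by blast
    then show ?thesis unfolding has_interior_line by blast
  qed
  then have "has_interior I {z. has_interior {j} B z} y"
    using has_interior_mono[OF has_interior_nb_center[OF y(1), of I y]] by blast
  then have "has_interior (insert j I) B y" by (rule has_interior_fubini[OF fin bd osc j dB])
  then obtain p q where pq: "eqoff (insert j I) y p" "0 < q" "nb (insert j I) p q \<subseteq> B"
    unfolding has_interior_nb by blast
  have "eqoff I x y" using nb_center[OF y(1)] y(2) nb_eqoff by blast
  then have "eqoff (insert j I) x p" using pq(1) by (auto simp: eqoff_def)
  then have "nb (insert j I) p q \<subseteq> nb (insert j I) x e"
    by (rule nb_subset_if_box) (use pq(3) in \<open>auto simp: B_def\<close>)
  moreover have "\<forall>z\<in>nb (insert j I) p q. f z \<le> c" using pq(3) by (auto simp: B_def)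
  ultimately show "\<exists>y e' c. 0 < e' \<and> nb (insert j I) y e' \<subseteq> nb (insert j I) x e \<and>
      (\<forall>z\<in>nb (insert j I) y e'. f z \<le> c)"
    using pq(2) by blast
qed

text \<open>The three properties depend on each other: the Fubini lemma for one more coordinate uses
  boundedness and oscillation over \<open>I\<close>; it yields unions and boundedness over
  \<open>insert j I\<close>, and these give small oscillation there.\<close>

lemma generic_regularity:
  assumes "finite I" shows "small_union I \<and> locally_bounded I \<and> small_oscillation I"
  using assms
proof (induction I rule: finite_induct)
  case empty
  have eq: "eqoff {} x y \<longleftrightarrow> y = x" for x y by (auto simp: eqoff_def fun_eq_iff)
  have nb: "nb {} x e = {x}" for x e by (auto simp: nb_def eq)
  have "small_union {}" unfolding small_union_def has_interior_nb nb eq using zero_less_one by auto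
  moreover have "locally_bounded {}" unfolding locally_bounded_def nb by auto
  ultimately show ?case using small_oscillation_if by blast
next
  case (insert j I)
  then show ?case
    using small_union_insert locally_bounded_insert small_oscillation_if finite.insertI by metis
qed

lemma has_interior_UnD:
  assumes "finite I" "dset M A" "dset M B" "has_interior I (A \<union> B) x"
  shows "has_interior I A x \<or> has_interior I B x"
  using generic_regularity[OF assms(1)] assms(2-4) unfolding small_union_def by blast

lemma has_interior_Union:
  assumes "finite I" "finite J" "\<And>j. j \<in> J \<Longrightarrow> dset M (B j)" "has_interior I (\<Union>j\<in>J. B j) x"
  shows "\<exists>j\<in>J. has_interior I (B j) x"
  using assms(2-)
proof (induction J rule: finite_induct)
  case empty
  then show ?case using has_interior_nonempty by fastforce
next
  case (insert j J)
  have "dset M (\<Union>j\<in>J. B j)" unfolding UN_iff using insert by (intro dfn_bex_finite) auto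
  then have "has_interior I (B j) x \<or> has_interior I (\<Union>j\<in>J. B j) x"
    using insert.prems by (intro has_interior_UnD assms(1)) auto
  then show ?case using insert by auto
qed

text \<open>If \<open>h\<close> were discontinuous at every point, a positive lower bound
  \<open>k x\<close> for its oscillation at \<open>x\<close> could be chosen definably. Bounding
  \<open>1 / k\<close> on an interval gives one positive bound for all points there, which
  contradicts small oscillation.\<close>

lemma generic_continuity_line:
  assumes h: "dt (\<lambda>s. h (s 0))" and uv: "u < v"
  shows "\<exists>x\<in>{u<..<v}. \<forall>d>0. \<exists>e>0. \<forall>y. \<bar>y - x\<bar> < e \<longrightarrow> \<bar>h y - h x\<bar> < d"
proof (rule ccontr)
  assume no: "\<not> ?thesis"
  have h': "dt t \<Longrightarrow> dt (\<lambda>s. h (t s))" for t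
    using dterm_subst[where g = "\<lambda>s _. t s", OF h] by simp
  define S where "S s = {d. 0 < d \<and> (\<forall>e>0. \<exists>y. \<bar>y - s 0\<bar> < e \<and> d \<le> \<bar>h y - h (s 0)\<bar>)}" for s :: "nat \<Rightarrow> 'a"
  have "dfam M S" unfolding dfam_def S_def mem_Collect_eq by (intro dfn_intro h')
  from choice_line[OF this] obtain t where t: "dt t" "\<forall>s. S s \<noteq> {} \<longrightarrow> t s \<in> S s"
    by (elim exE conjE)
  define k where "k x = t (\<lambda>_. x)" for x
  have k: "k x \<in> S (\<lambda>_. x)" if "x \<in> {u<..<v}" for x
  proof -
    obtain d where "0 < d" "\<forall>e>0. \<exists>y. \<bar>y - x\<bar> < e \<and> \<not> \<bar>h y - h x\<bar> < d" using no \<open>x \<in> {u<..<v}\<close> by blast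
    then have "d \<in> S (\<lambda>_. x)" by (simp add: S_def not_less)
    then have "S (\<lambda>_. x) \<noteq> {}" by blast
    then show ?thesis unfolding k_def using t(2) by blast
  qed
  have "dt (\<lambda>s. 1 / k (s 0))" unfolding k_def by (intro dfn_intro dterm_subst[OF t(1)])
  from baire_line[OF this uv] obtain c where "interior {x \<in> {u<..<v}. 1 / k x \<le> c} \<noteq> {}" ..
  then obtain x where "x \<in> interior {x \<in> {u<..<v}. 1 / k x \<le> c}" by blast
  then obtain e where e: "0 < e" "\<And>y. \<bar>y - x\<bar> < e \<Longrightarrow> y \<in> {u<..<v} \<and> 1 / k y \<le> c"
    unfolding interior_iff_abs by blast
  have "x \<in> {u<..<v}" "1 / k x \<le> c" using e(2)[of x] e(1) by auto
  then have "0 < c" using k[of x] by (auto simp: S_def intro: less_le_trans[of 0 "1 / k x"])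
  have k_ge: "1 / c \<le> k y" if "\<bar>y - x\<bar> < e" for y
    using e(2)[OF that] k[of y] \<open>0 < c\<close> by (auto simp: S_def field_simps)
  have "0 < 1 / c" using \<open>0 < c\<close> by simp
  obtain y e' where y: "0 < e'" "nb {0} y e' \<subseteq> nb {0} (\<lambda>_. x) e"
      "\<And>z w. z \<in> nb {0} y e' \<Longrightarrow> w \<in> nb {0} y e' \<Longrightarrow> \<bar>h (z 0) - h (w 0)\<bar> < 1 / c"
    by (rule small_oscillationD[OF _ h e(1) \<open>0 < 1 / c\<close>, of "{0}" "\<lambda>_. x"])
      (use generic_regularity[of "{0}"] in blast, rule that)
  have y0: "y \<in> nb {0} y e'" using nb_center[OF y(1)] .
  then have "y \<in> nb {0} (\<lambda>_. x) e" using y(2) by blast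
  then have "\<bar>y 0 - x\<bar> < e" by (simp add: nb_def)
  then have "k (y 0) \<in> S (\<lambda>_. y 0)" "1 / c \<le> k (y 0)" using k e(2) k_ge by blast+
  then obtain w where w: "\<bar>w - y 0\<bar> < e'" "1 / c \<le> \<bar>h w - h (y 0)\<bar>"
    using y(1) unfolding S_def by force
  have "y(0 := w) \<in> nb {0} y e'" using w(1) unfolding nb_line by blast
  from y(3)[OF this y0] w(2) show False by simp
qed

end

section \<open>The pseudo-filter\<close>

lemma continuous_on_abs:
  fixes g :: "'a::{linordered_field, linorder_topology} \<Rightarrow> 'a"
  assumes "\<And>x d. x \<in> D \<Longrightarrow> 0 < d \<Longrightarrow> \<exists>e>0. \<forall>y\<in>D. \<bar>y - x\<bar> < e \<longrightarrow> \<bar>g y - g x\<bar> < d"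
  shows "continuous_on D g"
  unfolding continuous_on_topological
proof (intro ballI allI impI)
  fix x B assume x: "x \<in> D" and B: "open B" "g x \<in> B"
  obtain d where d: "0 < d" "\<forall>y. \<bar>y - g x\<bar> < d \<longrightarrow> y \<in> B" using B open_iff_abs[of B] by blast
  obtain e where e: "0 < e" "\<forall>y\<in>D. \<bar>y - x\<bar> < e \<longrightarrow> \<bar>g y - g x\<bar> < d" using assms[OF x d(1)] by blast
  show "\<exists>A. open A \<and> x \<in> A \<and> (\<forall>y\<in>D. y \<in> A \<longrightarrow> g y \<in> B)"
    by (intro exI[of _ "{y. \<bar>y - x\<bar> < e}"] conjI open_abs_ball) (use d e in auto)
qed

lemma continuous_map_Ftop:
  fixes f :: "'a::{linordered_field, linorder_topology} \<Rightarrow> nat \<Rightarrow> 'a"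
  assumes "f ` D \<subseteq> Fspace n"
    and "\<And>i x d. i < n \<Longrightarrow> x \<in> D \<Longrightarrow> 0 < d \<Longrightarrow> \<exists>e>0. \<forall>y\<in>D. \<bar>y - x\<bar> < e \<longrightarrow> \<bar>f y i - f x i\<bar> < d"
  shows "continuous_map (subtopology euclidean D) (Ftop n) f"
proof -
  have "continuous_on D (\<lambda>x. f x i)" if "i < n" for i
    by (rule continuous_on_abs) (use assms(2)[OF that] in blast)
  then show ?thesis using assms(1) unfolding Ftop_def continuous_map_componentwise
    by (auto simp: Fspace_def PiE_def)
qed

lemma open_open_interval:
  fixes I :: "'a::linorder_topology set"
  assumes "open_interval I" shows "open I"
proof -
  obtain a b where I: "I = {x. a < Fin x \<and> Fin x < b}" using assms unfolding open_interval_def by blast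
  have "open {x. a < Fin x}" by (cases a) (auto simp flip: greaterThan_def)
  moreover have "open {x. Fin x < b}" by (cases b) (auto simp flip: lessThan_def)
  ultimately show ?thesis unfolding I by (rule open_Collect_conj)
qed

lemma open_interval_greaterThanLessThan: "open_interval {a<..<b}"
  unfolding open_interval_def by (intro exI[of _ "Fin a"] exI[of _ "Fin b"]) auto

text \<open>One \<open>e\<close> serves for the box and for the interval around 0; a box with
  infinite ends still contains a cube around each of its points.\<close>

lemma Lim_set_iff:
  fixes f :: "'a::{linordered_field, linorder_topology} \<Rightarrow> nat \<Rightarrow> 'a"
  assumes "f ` D \<subseteq> Fspace n"
  shows "p \<in> Lim_set n D f \<longleftrightarrow>
    p \<in> Fspace n \<and> (\<forall>e>0. \<exists>t\<in>D. \<bar>t\<bar> < e \<and> (\<forall>i<n. \<bar>f t i - p i\<bar> < e))"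
proof (intro iffI conjI allI impI)
  assume "p \<in> Lim_set n D f"
  then show p: "p \<in> Fspace n" by (simp add: Lim_set_def)
  fix e :: 'a assume e: "0 < e"
  define B where "B = (\<Pi>\<^sub>E i\<in>{..<n}. {p i - e<..<p i + e})"
  have "open_box n B" unfolding open_box_def B_def
    by (intro exI[of _ "\<lambda>i. {p i - e<..<p i + e}"]) (simp add: open_interval_greaterThanLessThan)
  moreover have "p \<in> B" using p e by (auto simp: B_def Fspace_def PiE_def)
  ultimately have "(f -` B \<inter> D) \<inter> {-e<..<e} \<noteq> {}"
    using \<open>p \<in> Lim_set n D f\<close> e open_interval_greaterThanLessThan[of "-e" e]
    unfolding Lim_set_def by simp
  then obtain t where t: "t \<in> D" "t \<in> {-e<..<e}" "f t \<in> B" by blast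
  have "\<bar>f t i - p i\<bar> < e" if "i < n" for i
    using t(3) that by (auto simp: B_def PiE_def Pi_def abs_less_iff algebra_simps)
  moreover have "\<bar>t\<bar> < e" using t(2) by (auto simp: abs_less_iff)
  ultimately show "\<exists>t\<in>D. \<bar>t\<bar> < e \<and> (\<forall>i<n. \<bar>f t i - p i\<bar> < e)" using t(1) by blast
next
  assume *: "p \<in> Fspace n \<and> (\<forall>e>0. \<exists>t\<in>D. \<bar>t\<bar> < e \<and> (\<forall>i<n. \<bar>f t i - p i\<bar> < e))"
  have "(f -` B \<inter> D) \<inter> I \<noteq> {}"
    if B: "open_box n B" "p \<in> B" and I: "open_interval I" "0 \<in> I" for B I
  proof -
    obtain J where J: "\<forall>i<n. open_interval (J i)" "B = (\<Pi>\<^sub>E i\<in>{..<n}. J i)"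
      using B(1) unfolding open_box_def by blast
    have "\<exists>d>0. \<forall>y. \<bar>y - p i\<bar> < d \<longrightarrow> y \<in> J i" if "i < n" for i
    proof -
      have "open (J i)" "p i \<in> J i"
        using J that B(2) by (auto intro: open_open_interval simp: PiE_def Pi_def)
      then show ?thesis using open_iff_abs[of "J i"] by blast
    qed
    then have "\<forall>i\<in>{..<n}. \<exists>d. 0 < d \<and> (\<forall>y. \<bar>y - p i\<bar> < d \<longrightarrow> y \<in> J i)" by auto
    from bchoice[OF this] obtain d where
      d: "\<forall>i\<in>{..<n}. 0 < d i \<and> (\<forall>y. \<bar>y - p i\<bar> < d i \<longrightarrow> y \<in> J i)" ..
    obtain e where e: "0 < e" "\<forall>i\<in>{..<n}. e \<le> d i"
      using finite_positive_lower_bound[of "{..<n}" d] d by auto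
    obtain e' where e': "0 < e'" "\<forall>y. \<bar>y - 0\<bar> < e' \<longrightarrow> y \<in> I"
      using open_iff_abs[of I] open_open_interval[OF I(1)] I(2) by blast
    obtain t where t: "t \<in> D" "\<bar>t\<bar> < min e e'" "\<forall>i<n. \<bar>f t i - p i\<bar> < min e e'"
      using * e(1) e'(1) by (meson min_less_iff_conj)
    have "f t i \<in> J i" if "i < n" for i
    proof -
      have "\<bar>f t i - p i\<bar> < d i" using t(3) e(2) that by force
      then show ?thesis using d that by blast
    qed
    then have "f t \<in> B" using assms t(1) unfolding J(2) by (auto simp: Fspace_def PiE_def Pi_def)
    moreover have "t \<in> I" using e'(2) t(2) by auto
    ultimately show ?thesis using t(1) by blast
  qed
  then show "p \<in> Lim_set n D f" using * unfolding Lim_set_def by blast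
qed

lemma Lim_set_singleton:
  fixes f :: "'a::{linordered_field, linorder_topology} \<Rightarrow> nat \<Rightarrow> 'a"
  assumes f: "f ` D \<subseteq> Fspace n" and p: "p \<in> Lim_set n D f" and D: "D \<subseteq> {0<..}"
    and conv: "\<And>d. 0 < d \<Longrightarrow> \<exists>e>0. \<forall>t\<in>D. t < e \<longrightarrow> (\<forall>i<n. \<bar>f t i - p i\<bar> < d)"
  shows "Lim_set n D f = {p}"
proof -
  have "q = p" if q: "q \<in> Lim_set n D f" for q
  proof (rule ext)
    fix i
    have pq: "p \<in> Fspace n" "q \<in> Fspace n" using p q by (auto simp: Lim_set_def)
    show "q i = p i"
    proof (cases "i < n")
      case True
      show ?thesis
      proof (rule ccontr)
        assume "q i \<noteq> p i"
        then have d: "0 < \<bar>q i - p i\<bar> / 2" by simp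
        from conv[OF d] obtain e where e: "0 < e"
            "\<forall>t\<in>D. t < e \<longrightarrow> (\<forall>j<n. \<bar>f t j - p j\<bar> < \<bar>q i - p i\<bar> / 2)"
          by (elim exE conjE)
        have m: "0 < min e (\<bar>q i - p i\<bar> / 2)" using e(1) d by simp
        have "\<forall>e>0. \<exists>t\<in>D. \<bar>t\<bar> < e \<and> (\<forall>i<n. \<bar>f t i - q i\<bar> < e)"
          using q[unfolded Lim_set_iff[OF f]] by (rule conjunct2)
        from this[rule_format, OF m] obtain t where t: "t \<in> D" "\<bar>t\<bar> < min e (\<bar>q i - p i\<bar> / 2)"
            "\<forall>j<n. \<bar>f t j - q j\<bar> < min e (\<bar>q i - p i\<bar> / 2)"
          by (elim bexE conjE)
        have "\<bar>f t i - q i\<bar> < \<bar>q i - p i\<bar> / 2" using t(3) True by force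
        moreover have "\<bar>f t i - p i\<bar> < \<bar>q i - p i\<bar> / 2"
          using e(2) t(1,2) True by (auto simp: abs_less_iff)
        ultimately have "\<bar>q i - p i\<bar> < \<bar>q i - p i\<bar> / 2 + \<bar>q i - p i\<bar> / 2" by linarith
        then show False by (simp only: field_sum_of_halves order.irrefl)
      qed
    next
      case False
      then show ?thesis using pq by (auto simp: Fspace_def PiE_def extensional_def)
    qed
  qed
  then show ?thesis using p by blast
qed

section \<open>The dichotomy at zero and the two kinds of filters\<close>

context d_minimal_field
begin

text \<open>Definable connectedness of intervals: the supremum of the part of \<open>A\<close>
  between the two points is approached by \<open>A\<close> and by its complement. When the point of
  \<open>A\<close> is the larger one, the complement takes its place.\<close>

lemma boundary_between:
  assumes "ds A" "a \<in> A" "b \<notin> A"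
  shows "\<exists>x. min a b \<le> x \<and> x \<le> max a b \<and> x \<in> closure A \<and> x \<in> closure (- A)"
proof -
  have *: "\<exists>x. a \<le> x \<and> x \<le> b \<and> x \<in> closure A \<and> x \<in> closure (- A)"
    if A: "ds A" "a \<in> A" "b \<notin> A" and "a < b" for A a b
  proof -
    let ?S = "{x \<in> A. a \<le> x \<and> x \<le> b}"
    have "ds ?S" by (intro dfn_intro dsD[OF A(1)])
    moreover have "?S \<noteq> {}" using A(2) \<open>a < b\<close> by auto
    ultimately obtain c where c: "\<And>x. x \<in> ?S \<Longrightarrow> x \<le> c" "\<And>d. (\<And>x. x \<in> ?S \<Longrightarrow> x \<le> d) \<Longrightarrow> c \<le> d"
      by (rule sup_exists[where b = b]) auto
    have "a \<le> c" using c(1)[of a] A(2) \<open>a < b\<close> by simp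
    have "c \<le> b" by (rule c(2)) simp
    have "c \<in> closure A" unfolding closure_iff_abs
    proof (intro allI impI)
      fix e :: 'a assume "e > 0"
      have "\<not> (\<forall>x\<in>?S. x \<le> c - e)" using c(2)[of "c - e"] \<open>e > 0\<close> by force
      then obtain x where x: "x \<in> ?S" "c - e < x" by (auto simp: not_le)
      then show "\<exists>y\<in>A. \<bar>y - c\<bar> < e" using c(1)[of x] \<open>e > 0\<close> by (intro bexI[of _ x]) (auto simp: abs_less_iff)
    qed
    moreover have "c \<in> closure (- A)" unfolding closure_iff_abs
    proof (intro allI impI)
      fix e :: 'a assume "e > 0"
      show "\<exists>y\<in>- A. \<bar>y - c\<bar> < e"
      proof (cases "c = b")
        case True
        then show ?thesis using A(3) \<open>e > 0\<close> by (intro bexI[of _ b]) auto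
      next
        case False
        then obtain y where y: "c < y" "y < min b (c + e)"
          using dense[of c "min b (c + e)"] \<open>c \<le> b\<close> \<open>e > 0\<close> by auto
        have "y \<notin> A"
        proof
          assume "y \<in> A"
          then have "y \<le> c" using y \<open>a \<le> c\<close> by (intro c(1)) auto
          then show False using y(1) by simp
        qed
        then show ?thesis using y by (intro bexI[of _ y]) auto
      qed
    qed
    ultimately show ?thesis using \<open>a \<le> c\<close> \<open>c \<le> b\<close> by blast
  qed
  have "a \<noteq> b" using assms by blast
  then consider "a < b" | "b < a" by force
  then show ?thesis
  proof cases
    case 1
    then show ?thesis using *[OF assms 1] by (simp add: min_def max_def)
  next
    case 2
    have "ds (- A)" unfolding Compl_iff by (intro dfn_not assms(1))
    from *[OF this, of b a] show ?thesis using assms 2 by (auto simp: min_def max_def)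
  qed
qed

text \<open>The definable counterpart of a sequence decreasing to 0: its only limit point is 0, so
  every nonempty definable part bounded away from 0 has a greatest element.\<close>

definition null_seq :: "'a set \<Rightarrow> bool" where
  "null_seq D \<longleftrightarrow> ds D \<and> D \<subseteq> {0<..} \<and> bdd_above D \<and> 0 \<in> closure D \<and> closure D = D \<union> {0} \<and> discrete D"

lemma null_seq_subset:
  assumes "null_seq D" "D' \<subseteq> D" "ds D'" "0 \<in> closure D'" shows "null_seq D'"
proof -
  have "x \<in> D'" if "x \<in> closure D'" "x \<noteq> 0" for x
  proof -
    have "x \<in> D" using that closure_mono[OF assms(2)] assms(1) unfolding null_seq_def by blast
    then have "\<not> x islimpt D" using assms(1) unfolding null_seq_def discrete_iff by blast
    then have "\<not> x islimpt D'" using islimpt_subset assms(2) by blast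
    then show ?thesis using that by (simp add: closure_def)
  qed
  then have "closure D' = D' \<union> {0}" using closure_subset[of D'] assms(4) by blast
  moreover have "discrete D'" using assms(1,2) islimpt_subset unfolding null_seq_def discrete_iff by blast
  moreover have "bdd_above D" using assms(1) by (simp add: null_seq_def)
  then have "bdd_above D'" using assms(2) by (rule bdd_above_mono)
  ultimately show ?thesis using assms unfolding null_seq_def by blast
qed

text \<open>If neither \<open>A\<close> nor its complement contains some \<open>(0, e)\<close>, the boundary points of \<open>A\<close>
  accumulate at \<open>0\<close>; a suitable derived set of the boundary then has \<open>0\<close> as its only
  accumulation point nearby.\<close>

lemma null_seq_or_germs:
  "(\<exists>D. null_seq D) \<or> (\<forall>A. ds A \<longrightarrow> (\<exists>e>0. {0<..<e} \<subseteq> A \<or> {0<..<e} \<inter> A = {}))"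
proof (rule disjCI)
  assume "\<not> (\<forall>A. ds A \<longrightarrow> (\<exists>e>0. {0<..<e} \<subseteq> A \<or> {0<..<e} \<inter> A = {}))"
  then obtain A where A: "ds A" "\<And>e. 0 < e \<Longrightarrow> \<not> {0<..<e} \<subseteq> A \<and> {0<..<e} \<inter> A \<noteq> {}" by blast
  have dA': "ds (- A)" unfolding Compl_iff by (intro dfn_not A(1))
  define B where "B = {x. 0 < x \<and> x \<in> closure A \<and> x \<in> closure (- A)}"
  have dB: "ds B" unfolding B_def
    by (intro dfn_intro dfamD[OF dfam_closure[OF dfam_const[OF A(1)]], of _ "\<lambda>s. s"]
        dfamD[OF dfam_closure[OF dfam_const[OF dA']], of _ "\<lambda>s. s"])
  \<comment> \<open>\<open>interior B\<close> splits along \<open>A\<close>; whichever part has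
    interior would contain an open set of boundary points lying inside \<open>A\<close> or inside
    its complement.\<close>
  have intB: "interior B = {}"
  proof (rule ccontr)
    assume ne: "interior B \<noteq> {}"
    have "ds (interior B)" unfolding interior_iff_abs by (intro dfn_intro dsD[OF dB])
    then have "ds (interior B \<inter> A)" by (intro dfn_mem_Int A(1))
    moreover have "(interior B \<inter> A) \<union> (interior B - A) = interior B" by blast
    then have "interior ((interior B \<inter> A) \<union> (interior B - A)) \<noteq> {}" using ne by simp
    ultimately have "interior (interior B \<inter> A) \<noteq> {} \<or> interior (interior B - A) \<noteq> {}"
      by (rule interior_Un_nonempty)
    then show False
    proof
      assume "interior (interior B \<inter> A) \<noteq> {}"
      then obtain x where x: "x \<in> interior (interior B \<inter> A)" by blast
      then have "x \<in> interior A" using interior_mono[of "interior B \<inter> A" A] by blast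
      moreover have "x \<in> B" using x interior_subset by blast
      ultimately show False unfolding B_def by (simp add: closure_complement)
    next
      assume "interior (interior B - A) \<noteq> {}"
      then obtain x where x: "x \<in> interior (interior B - A)" by blast
      then have "x \<in> interior (- A)" using interior_mono[of "interior B - A" "- A"] by blast
      moreover have "x \<in> B" using x interior_subset by blast
      ultimately show False unfolding B_def by (simp add: interior_complement)
    qed
  qed
  have lim: "0 islimpt B" unfolding islimpt_iff_abs
  proof (intro allI impI)
    fix e :: 'a assume "e > 0"
    then obtain a b where ab: "a \<in> {0<..<e}" "a \<in> A" "b \<in> {0<..<e}" "b \<notin> A" using A(2) by blast
    from boundary_between[OF A(1) ab(2,4)] obtain x where
      x: "min a b \<le> x" "x \<le> max a b" "x \<in> closure A" "x \<in> closure (- A)" by blast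
    then have "0 < x" "x < e" using ab(1,3) by (auto simp: min_def max_def split: if_splits)
    then show "\<exists>y\<in>B. y \<noteq> 0 \<and> \<bar>y - 0\<bar> < e" using x by (intro bexI[of _ x]) (auto simp: B_def)
  qed
  define C where "C k = (der ^^ k) (closure B)" for k
  obtain N where "\<forall>s::nat \<Rightarrow> 'a. interior B = {} \<longrightarrow> (der ^^ N) (closure B) = {}"
    using der_funpow_uniform[OF dfam_const[OF dB]] ..
  then have "0 \<notin> C N" using intB by (simp add: C_def)
  \<comment> \<open>\<open>m\<close> is at least 2, and for \<open>k = m - 2\<close> the set
    \<open>C k\<close> accumulates at 0, while 0 is isolated among the limit points of
    \<open>C k\<close>.\<close>
  define m where "m = (LEAST k. 0 \<notin> C k)"
  have m: "0 \<notin> C m" "\<And>k. k < m \<Longrightarrow> 0 \<in> C k"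
    unfolding m_def using LeastI[of "\<lambda>k. 0 \<notin> C k", OF \<open>0 \<notin> C N\<close>] not_less_Least by blast+
  have "0 \<in> der (closure B)" using lim islimpt_subset closure_subset unfolding mem_der by blast
  then have "0 \<in> C 0" "0 \<in> C 1"
    using closed_der_subset[of "closure B"] unfolding C_def by auto
  then have "m \<noteq> 0" "m \<noteq> 1" using m(1) by metis+
  then obtain k where k: "m = Suc (Suc k)" by (metis One_nat_def not0_implies_Suc)
  have T0: "0 \<in> der (C k)" "0 \<notin> der (der (C k))" using m(1) m(2)[of "Suc k"] k by (auto simp: C_def)
  have clT: "closed (C k)" unfolding C_def by (intro closed_der_funpow) auto
  have "closure B \<subseteq> {0..}" by (intro closure_minimal) (auto simp: B_def)
  moreover have "C k \<subseteq> C 0" unfolding C_def by (intro der_funpow_decreasing) auto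
  ultimately have pos: "C k \<subseteq> {0..}" by (simp add: C_def)
  obtain d where d: "0 < d" "\<And>y. y \<in> der (C k) \<Longrightarrow> \<bar>y\<bar> < d \<Longrightarrow> y = 0"
    using T0(2) unfolding mem_der[of _ "der (C k)"] islimpt_iff_abs by auto
  \<comment> \<open>The end point \<open>d / 2\<close> is included to keep
    \<open>D \<union> {0}\<close> closed; it is less than \<open>d\<close>, so that 0 is the only
    limit point in reach.\<close>
  define D where "D = C k \<inter> {0<..d / 2}"
  have "ds (C k)" unfolding C_def
    by (rule dfam_ds[OF dfam_der_funpow[OF dfam_closure[OF dfam_const[OF dB]]]])
  then have "ds D" unfolding D_def by (intro dfn_intro)
  moreover have cl0: "0 \<in> closure D" unfolding closure_iff_abs
  proof (intro allI impI)
    fix e :: 'a assume "e > 0"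
    then have "0 < min e (d / 2)" using d(1) by simp
    then obtain y where y: "y \<in> C k" "y \<noteq> 0" "\<bar>y - 0\<bar> < min e (d / 2)"
      using T0(1) unfolding mem_der islimpt_iff_abs by blast
    have "0 \<le> y" using y(1) pos by auto
    then show "\<exists>y\<in>D. \<bar>y - 0\<bar> < e" using y by (intro bexI[of _ y]) (auto simp: D_def)
  qed
  moreover have "closure D = D \<union> {0}"
  proof
    have "closure D \<subseteq> C k \<inter> {0..d / 2}"
      by (intro closure_minimal) (auto simp: D_def clT)
    then show "closure D \<subseteq> D \<union> {0}" by (auto simp: D_def)
    show "D \<union> {0} \<subseteq> closure D" using cl0 closure_subset by auto
  qed
  moreover have "discrete D" unfolding discrete_iff
  proof
    fix x assume x: "x \<in> D"
    show "\<not> x islimpt D"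
    proof
      assume "x islimpt D"
      then have "x \<in> der (C k)" unfolding mem_der D_def using islimpt_subset by blast
      moreover have "0 < x" "x \<le> d / 2" using x by (auto simp: D_def)
      moreover from this have "\<bar>x\<bar> < d" using d(1) by (simp add: less_le_trans)
      ultimately show False using d(2) by blast
    qed
  qed
  moreover have "bdd_above D" unfolding D_def by (auto intro: bdd_aboveI[of _ "d / 2"])
  moreover have "D \<subseteq> {0<..}" by (auto simp: D_def)
  ultimately show "\<exists>D. null_seq D" unfolding null_seq_def by blast
qed

text \<open>Terms are total, hence the value 0 outside \<open>D\<close>. The graph of one component
  arises from the graph of \<open>f\<close> by quantifying over the coordinates \<open>1\<close> to
  \<open>n\<close> and pinning the coordinate \<open>Suc i\<close>.\<close>

lemma dterm_component:
  assumes "definable_map1 M n D f" "i < n"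
  shows "dt (\<lambda>s. if s 0 \<in> D then f (s 0) i else 0)"
proof -
  let ?G = "(\<lambda>t. cat 1 (pt t) (f t)) ` D"
  have D: "ds D" and f: "\<And>t. t \<in> D \<Longrightarrow> f t \<in> Fspace n" and G: "df (\<lambda>s. restrict s {..<1 + n} \<in> ?G)"
    using assms(1) unfolding definable_map1_def definable1_iff definable_iff_dfn by auto
  have G_iff: "restrict s {..<1 + n} \<in> ?G \<longleftrightarrow> s 0 \<in> D \<and> (\<forall>i<n. s (Suc i) = f (s 0) i)" for s
  proof
    assume "restrict s {..<1 + n} \<in> ?G"
    then obtain t where t: "t \<in> D" "restrict s {..<1 + n} = cat 1 (pt t) (f t)" by blast
    have "s 0 = t" using fun_cong[OF t(2), of 0] by (simp add: cat_def pt_def)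
    moreover have "s (Suc i) = f t i" if "i < n" for i
      using fun_cong[OF t(2), of "Suc i"] that by (simp add: cat_def)
    ultimately show "s 0 \<in> D \<and> (\<forall>i<n. s (Suc i) = f (s 0) i)" using t(1) by blast
  next
    assume *: "s 0 \<in> D \<and> (\<forall>i<n. s (Suc i) = f (s 0) i)"
    have "restrict s {..<1 + n} k = cat 1 (pt (s 0)) (f (s 0)) k" for k
      using * f[of "s 0"] by (cases k) (auto simp: cat_def pt_def Fspace_def PiE_def extensional_def)
    then show "restrict s {..<1 + n} \<in> ?G" using * by blast
  qed
  have ex: "(\<exists>y. eqoff {1..n} s y \<and> restrict y {..<1 + n} \<in> ?G \<and> y (Suc i) = a) \<longleftrightarrow>
      s 0 \<in> D \<and> f (s 0) i = a" for s a
  proof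
    assume "\<exists>y. eqoff {1..n} s y \<and> restrict y {..<1 + n} \<in> ?G \<and> y (Suc i) = a"
    then obtain y where "eqoff {1..n} s y" "restrict y {..<1 + n} \<in> ?G" "y (Suc i) = a" by blast
    moreover from this have "s 0 = y 0" by (simp add: eqoff_def)
    ultimately show "s 0 \<in> D \<and> f (s 0) i = a" unfolding G_iff using assms(2) by auto
  next
    assume *: "s 0 \<in> D \<and> f (s 0) i = a"
    let ?y = "\<lambda>k. if k \<in> {1..n} then f (s 0) (k - 1) else s k"
    have "eqoff {1..n} s ?y" "restrict ?y {..<1 + n} \<in> ?G" "?y (Suc i) = a"
      unfolding G_iff using * assms(2) by (auto simp: eqoff_def)
    then show "\<exists>y. eqoff {1..n} s y \<and> restrict y {..<1 + n} \<in> ?G \<and> y (Suc i) = a" by blast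
  qed
  have "df (\<lambda>s. \<exists>y. eqoff {1..n} (\<lambda>i. s (Suc i)) y \<and> (restrict y {..<1 + n} \<in> ?G \<and> y (Suc i) = s 0))"
    by (intro dfn_ex_eqoff finite_atLeastAtMost dfn_intro dfn_subst[OF G])
  then have "df (\<lambda>s. s (Suc 0) \<in> D \<and> f (s (Suc 0)) i = s 0)" unfolding ex .
  then have "df (\<lambda>s. (s (Suc 0) \<in> D \<and> f (s (Suc 0)) i = s 0) \<or> (s (Suc 0) \<notin> D \<and> s 0 = 0))"
    by (rule dfn_disj) (intro dfn_conj dfn_not dsD[OF D] dfn_eq dfn_intro)
  then show ?thesis unfolding dterm_def by (rule back_subst[of "dfn M"]) auto
qed

text \<open>On a discrete set every map is continuous. To make \<open>f\<close> converge to a given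
  \<open>p\<close> in its limit set, keep for each \<open>e\<close> only the largest
  \<open>t < e\<close> in \<open>D\<close> at which \<open>f\<close> is within \<open>e\<close> of
  \<open>p\<close>.\<close>

lemma good_pseudo_filter_null_seqs:
  assumes "null_seq D0"
  shows "good_pseudo_filter M {D. null_seq D}"
  unfolding good_pseudo_filter_def
proof (intro conjI ballI allI impI)
  show "{D. null_seq D} \<noteq> {}" using assms by blast
next
  fix D assume "D \<in> {D. null_seq D}"
  then have D: "null_seq D" by simp
  show "definable1 M D" "D \<subseteq> {0<..}" "0 \<in> closure D" "bdd_above D" "closure D = D \<union> {0}"
    using D by (auto simp: null_seq_def definable1_iff)
  show "bdd_below D" using \<open>D \<subseteq> {0<..}\<close> by (intro bdd_belowI[of _ 0]) auto
next
  fix D D1 D2 assume "D \<in> {D. null_seq D}" and *: "definable1 M D1 \<and> definable1 M D2 \<and> D = D1 \<union> D2"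
  then have D: "null_seq D" by simp
  then have "0 \<in> closure D1 \<or> 0 \<in> closure D2" using * by (auto simp: null_seq_def)
  then show "(\<exists>D'\<in>{D. null_seq D}. D' \<subseteq> D1) \<or> (\<exists>D'\<in>{D. null_seq D}. D' \<subseteq> D2)"
    using null_seq_subset[OF D, of D1] null_seq_subset[OF D, of D2] * unfolding definable1_iff by blast
next
  fix D n f assume "D \<in> {D. null_seq D}" and f: "definable_map1 M n D f"
  then have D: "null_seq D" by simp
  then have dD: "ds D" and pos: "D \<subseteq> {0<..}" and disc: "discrete D" and clD: "closure D = D \<union> {0}"
    by (auto simp: null_seq_def)
  have fD: "f ` D \<subseteq> Fspace n" using f by (auto simp: definable_map1_def)
  have cont: "continuous_map (subtopology euclidean D') (Ftop n) f" if "D' \<subseteq> D" for D'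
  proof (rule continuous_map_Ftop)
    show "f ` D' \<subseteq> Fspace n" using fD that by blast
    fix i x and d :: 'a assume x: "x \<in> D'" and d: "0 < d"
    then have "\<not> x islimpt D" using disc that unfolding discrete_iff by blast
    then obtain e where "0 < e" "\<forall>y\<in>D. y \<noteq> x \<longrightarrow> \<not> \<bar>y - x\<bar> < e" unfolding islimpt_iff_abs by blast
    then show "\<exists>e>0. \<forall>y\<in>D'. \<bar>y - x\<bar> < e \<longrightarrow> \<bar>f y i - f x i\<bar> < d"
      using that d by (intro exI[of _ e]) force
  qed
  show "\<exists>D'\<in>{D. null_seq D}. D' \<subseteq> D \<and> continuous_map (subtopology euclidean D') (Ftop n) f \<and>
      (Lim_set n D f \<noteq> {} \<longrightarrow> is_singleton (Lim_set n D' f))"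
  proof (cases "Lim_set n D f = {}")
    case True
    then show ?thesis using D cont[of D] by blast
  next
    case False
    then obtain p where p: "p \<in> Lim_set n D f" by blast
    define near where "near e t \<longleftrightarrow> t \<in> D \<and> t < e \<and>
        (\<forall>i\<in>{..<n}. \<bar>(if t \<in> D then f t i else 0) - p i\<bar> < e)" for e t
    define last where "last e t \<longleftrightarrow> near e t \<and> (\<forall>u. near e u \<longrightarrow> u \<le> t)" for e t
    define D' where "D' = {t. \<exists>e>0. last e t}"
    have comp: "dt (\<lambda>s. if u s \<in> D then f (u s) i else 0)" if "i \<in> {..<n}" "dt u" for u i
    proof -
      have "i < n" using that(1) by simp
      from dterm_subst[where g = "\<lambda>s _. u s", OF dterm_component[OF f this] that(2)] show ?thesis .
    qed
    have dnear: "df (\<lambda>s. near (u s) (v s))" if "dt u" "dt v" for u v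
      unfolding near_def
      by (intro dfn_conj dfn_ball_finite finite_lessThan dfn_less dterm_abs dterm_minus comp dterm_const
          dsD[OF dD] that)
    have dD': "ds D'" unfolding D'_def last_def by (intro dfn_intro dnear)
    have sub: "D' \<subseteq> D" by (auto simp: D'_def last_def near_def)
    \<comment> \<open>The part of \<open>D\<close> from \<open>t0\<close> on stays away from 0, the
      only possible limit point, so the near points there have a maximum.\<close>
    have last_ex: "\<exists>t. last e t" if e: "0 < e" for e
    proof -
      obtain t0 where t0: "t0 \<in> D" "\<bar>t0\<bar> < e" "\<forall>i<n. \<bar>f t0 i - p i\<bar> < e"
        using p e unfolding Lim_set_iff[OF fD] by blast
      then have "near e t0" unfolding near_def by (auto simp: abs_less_iff)
      let ?S = "{t. near e t \<and> t0 \<le> t}"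
      have dS: "ds ?S" by (intro dfn_intro dnear)
      have "der ?S = {}"
      proof -
        have "?S \<subseteq> D" by (auto simp: near_def)
        then have "der ?S \<subseteq> der D" by (rule der_mono)
        moreover have "der D \<subseteq> {0}" using disc clD unfolding der_def discrete_iff closure_def by blast
        moreover have "der ?S \<subseteq> der {t0..}" by (rule der_mono) auto
        moreover have "der {t0..} \<subseteq> {t0..}" by (rule closed_der_subset) auto
        moreover have "0 < t0" using t0(1) pos by auto
        ultimately show ?thesis by fastforce
      qed
      moreover have neS: "?S \<noteq> {}" using \<open>near e t0\<close> by blast
      moreover have "\<And>t. t \<in> ?S \<Longrightarrow> t \<le> e" by (auto simp: near_def)
      ultimately obtain m where m: "m \<in> ?S" "\<And>t. t \<in> ?S \<Longrightarrow> t \<le> m"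
        using max_exists[OF dS closed_if_der_empty neS, of e] by blast
      have "u \<le> m" if "near e u" for u using m that by (cases "t0 \<le> u") auto
      then show ?thesis using m(1) unfolding last_def by blast
    qed
    have nearD: "t \<in> D \<and> t < e \<and> (\<forall>i<n. \<bar>f t i - p i\<bar> < e)" if "near e t" for e t
      using that by (auto simp: near_def)
    have hit: "\<exists>t\<in>D'. \<bar>t\<bar> < e \<and> (\<forall>i<n. \<bar>f t i - p i\<bar> < e)" if e: "0 < e" for e
    proof -
      obtain t where t: "last e t" using last_ex[OF e] by blast
      then have "t \<in> D'" using e by (auto simp: D'_def)
      moreover have "near e t" using t by (simp add: last_def)
      moreover have "0 < t" using nearD[OF calculation(2)] pos by auto
      ultimately show ?thesis using nearD[of e t] by (intro bexI[of _ t]) auto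
    qed
    have "0 \<in> closure D'" unfolding closure_iff_abs using hit by force
    then have "null_seq D'" by (rule null_seq_subset[OF D sub dD'])
    moreover have fD': "f ` D' \<subseteq> Fspace n" using fD sub by blast
    moreover have "Lim_set n D' f = {p}"
    proof (rule Lim_set_singleton[OF fD'])
      show "p \<in> Lim_set n D' f" unfolding Lim_set_iff[OF fD'] using hit p by (auto simp: Lim_set_def)
      show "D' \<subseteq> {0<..}" using sub pos by blast
      fix d :: 'a assume d: "0 < d"
      obtain m where m: "last d m" using last_ex[OF d] by blast
      have "0 < m" using m nearD[of d m] pos by (auto simp: last_def)
      moreover have "\<forall>i<n. \<bar>f t i - p i\<bar> < d" if t: "t \<in> D'" "t < m" for t
      proof -
        obtain e where e: "0 < e" "last e t" using t(1) unfolding D'_def by blast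
        \<comment> \<open>Were \<open>e\<close> at least \<open>d\<close>, the point
          \<open>m\<close> would also be near for \<open>e\<close>, and the largest such point
          \<open>t\<close> could not lie below \<open>m\<close>.\<close>
        have "\<not> d \<le> e"
        proof
          assume "d \<le> e"
          then have "near e m" using m unfolding last_def near_def by force
          then show False using e(2) t(2) by (auto simp: last_def)
        qed
        then show ?thesis using e(2) nearD[of e t] by (force simp: last_def)
      qed
      ultimately show "\<exists>e>0. \<forall>t\<in>D'. t < e \<longrightarrow> (\<forall>i<n. \<bar>f t i - p i\<bar> < d)" by blast
    qed
    ultimately show ?thesis using cont[OF sub] sub by (intro bexI[of _ D']) auto
  qed
qed

lemma closure_greaterThanAtMost:
  assumes "0 < (e::'a)" shows "closure {0<..e} = {0<..e} \<union> {0}"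
proof
  have "closure {0<..e} \<subseteq> {0..e}" by (intro closure_minimal) auto
  then show "closure {0<..e} \<subseteq> {0<..e} \<union> {0}" by auto
  have "0 \<in> closure {0<..e}" unfolding closure_iff_abs
  proof (intro allI impI)
    fix d :: 'a assume "0 < d"
    then obtain y where "0 < y" "y < min d e" using dense[of 0 "min d e"] assms by auto
    then show "\<exists>y\<in>{0<..e}. \<bar>y - 0\<bar> < d" by (intro bexI[of _ y]) auto
  qed
  then show "{0<..e} \<union> {0} \<subseteq> closure {0<..e}" using closure_subset by auto
qed

text \<open>Every definable condition on \<open>t\<close> is constant near 0 from the right, so one
  that holds arbitrarily close to 0 holds throughout some \<open>(0, e)\<close>. Continuity of a
  component at \<open>t\<close> is such a condition by generic continuity, and closeness of
  \<open>f t\<close> to a given \<open>p\<close> in the limit set is another.\<close>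

lemma good_pseudo_filter_germs:
  assumes germ: "\<And>A. ds A \<Longrightarrow> \<exists>e>0. {0<..<e} \<subseteq> A \<or> {0<..<e} \<inter> A = {}"
  shows "good_pseudo_filter M {{0<..e} |e. 0 < e}"
  unfolding good_pseudo_filter_def
proof (intro conjI ballI allI impI)
  show "{{0<..e} |e. 0 < (e::'a)} \<noteq> {}" using zero_less_one by blast
next
  fix D assume "D \<in> {{0<..e} |e. 0 < (e::'a)}"
  then obtain e where e: "0 < e" "D = {0<..e}" by blast
  show "D \<subseteq> {0<..}" using e by auto
  show "definable1 M D" unfolding definable1_iff e by (intro dfn_intro)
  show "closure D = D \<union> {0}" using closure_greaterThanAtMost e by simp
  then show "0 \<in> closure D" by simp
  show "bdd_below D" "bdd_above D" unfolding e by simp_all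
next
  fix D D1 D2 assume "D \<in> {{0<..e} |e. 0 < (e::'a)}"
    and *: "definable1 M D1 \<and> definable1 M D2 \<and> D = D1 \<union> D2"
  then obtain e where e: "0 < e" "D = {0<..e}" by blast
  obtain r where r: "0 < r" "{0<..<r} \<subseteq> D1 \<or> {0<..<r} \<inter> D1 = {}"
    using germ[of D1] * unfolding definable1_iff by blast
  obtain q where q: "0 < q" "q < min r e" using dense[of 0 "min r e"] r e by auto
  have sub: "{0<..q} \<subseteq> {0<..<r}" "{0<..q} \<subseteq> D" using q e by auto
  have mem: "{0<..q} \<in> {{0<..e} |e. 0 < e}" using q(1) by blast
  show "(\<exists>D'\<in>{{0<..e} |e. 0 < e}. D' \<subseteq> D1) \<or> (\<exists>D'\<in>{{0<..e} |e. 0 < e}. D' \<subseteq> D2)"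
    using r(2)
  proof
    assume "{0<..<r} \<subseteq> D1"
    then have "{0<..q} \<subseteq> D1" using sub by blast
    then show ?thesis using mem by blast
  next
    assume "{0<..<r} \<inter> D1 = {}"
    then have "{0<..q} \<subseteq> D2" using sub * by blast
    then show ?thesis using mem by blast
  qed
next
  fix D n f assume "D \<in> {{0<..e} |e. 0 < (e::'a)}" and f: "definable_map1 M n D f"
  then obtain e where e: "0 < e" "D = {0<..e}" by blast
  have dD: "ds D" unfolding e by (intro dfn_intro)
  have fD: "f ` D \<subseteq> Fspace n" using f by (auto simp: definable_map1_def)
  define g where "g i t = (if t \<in> D then f t i else 0)" for i t
  have dg: "dt (\<lambda>s. g i (s 0))" if "i < n" for i unfolding g_def by (rule dterm_component[OF f that])
  have dg': "dt (\<lambda>s. g i (u s))" if "i < n" "dt u" for i u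
    using dterm_subst[where g = "\<lambda>s _. u s", OF dg[OF that(1)] that(2)] .
  have "\<exists>r>0. \<forall>x\<in>{0<..<r}. \<forall>d>0. \<exists>q>0. \<forall>y. \<bar>y - x\<bar> < q \<longrightarrow> \<bar>g i y - g i x\<bar> < d" if i: "i < n" for i
  proof -
    let ?C = "{x. \<forall>d>0. \<exists>q>0. \<forall>y. \<bar>y - x\<bar> < q \<longrightarrow> \<bar>g i y - g i x\<bar> < d}"
    have "ds ?C" by (intro dfn_intro dg'[OF i])
    from germ[OF this] obtain r where r: "0 < r" "{0<..<r} \<subseteq> ?C \<or> {0<..<r} \<inter> ?C = {}"
      by (elim exE conjE)
    from generic_continuity_line[OF dg[OF i] r(1)] have "{0<..<r} \<inter> ?C \<noteq> {}" by blast
    then show ?thesis using r by (intro exI[of _ r]) blast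
  qed
  then have "\<forall>i\<in>{..<n}. \<exists>r. 0 < r \<and>
      (\<forall>x\<in>{0<..<r}. \<forall>d>0. \<exists>q>0. \<forall>y. \<bar>y - x\<bar> < q \<longrightarrow> \<bar>g i y - g i x\<bar> < d)" by simp
  from bchoice[OF this] obtain r where r: "\<forall>i\<in>{..<n}. 0 < r i \<and>
      (\<forall>x\<in>{0<..<r i}. \<forall>d>0. \<exists>q>0. \<forall>y. \<bar>y - x\<bar> < q \<longrightarrow> \<bar>g i y - g i x\<bar> < d)" ..
  obtain r0 where r0: "0 < r0" "\<forall>i\<in>{..<n}. r0 \<le> r i"
    using finite_positive_lower_bound[of "{..<n}" r] r by auto
  obtain q where q: "0 < q" "q < min r0 e" using dense[of 0 "min r0 e"] r0(1) e(1) by auto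
  define D' where "D' = {0<..q}"
  have sub: "D' \<subseteq> D" using q e by (auto simp: D'_def)
  have fD': "f ` D' \<subseteq> Fspace n" using fD sub by blast
  have "continuous_map (subtopology euclidean D') (Ftop n) f"
  proof (rule continuous_map_Ftop[OF fD'])
    fix i x and d :: 'a assume i: "i < n" and x: "x \<in> D'" and d: "0 < d"
    have "r0 \<le> r i" using r0(2) i by blast
    then have "x \<in> {0<..<r i}" using x q by (auto simp: D'_def)
    then obtain b where b: "0 < b" "\<forall>y. \<bar>y - x\<bar> < b \<longrightarrow> \<bar>g i y - g i x\<bar> < d"
      using r i d by blast
    have "g i y = f y i" if "y \<in> D'" for y using sub that by (auto simp: g_def)
    then have "\<forall>y\<in>D'. \<bar>y - x\<bar> < b \<longrightarrow> \<bar>f y i - f x i\<bar> < d" using b(2) x by force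
    then show "\<exists>b>0. \<forall>y\<in>D'. \<bar>y - x\<bar> < b \<longrightarrow> \<bar>f y i - f x i\<bar> < d" using b(1) by blast
  qed
  moreover have "is_singleton (Lim_set n D' f)" if ne: "Lim_set n D f \<noteq> {}"
  proof -
    obtain p where p: "p \<in> Lim_set n D f" using ne by blast
    have conv: "\<exists>b>0. \<forall>t\<in>D'. t < b \<longrightarrow> (\<forall>i<n. \<bar>f t i - p i\<bar> < d)" if d: "0 < d" for d
    proof -
      let ?A = "{t. t \<in> D \<and> (\<forall>i\<in>{..<n}. \<bar>g i t - p i\<bar> < d)}"
      have "ds ?A" unfolding mem_Collect_eq
        by (intro dfn_conj dfn_ball_finite finite_lessThan dfn_less dterm_abs dterm_minus dg' dterm_const
            dterm_var dD) auto
      from germ[OF this] obtain b where b: "0 < b" "{0<..<b} \<subseteq> ?A \<or> {0<..<b} \<inter> ?A = {}"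
        by (elim exE conjE)
      have "0 < min b d" using b(1) d by simp
      then obtain t where t: "t \<in> D" "\<bar>t\<bar> < min b d" "\<forall>i<n. \<bar>f t i - p i\<bar> < min b d"
        using p unfolding Lim_set_iff[OF fD] by blast
      then have "t \<in> {0<..<b} \<inter> ?A" by (auto simp: g_def e)
      then have *: "{0<..<b} \<subseteq> ?A" using b(2) by blast
      have "\<forall>t\<in>D'. t < b \<longrightarrow> (\<forall>i<n. \<bar>f t i - p i\<bar> < d)"
      proof (intro ballI impI allI)
        fix t i assume "t \<in> D'" "t < b" "i < n"
        then have "t \<in> ?A" using * by (auto simp: D'_def)
        then have "t \<in> D" "\<bar>g i t - p i\<bar> < d" using \<open>i < n\<close> by auto
        then show "\<bar>f t i - p i\<bar> < d" by (simp add: g_def)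
      qed
      then show ?thesis using b(1) by blast
    qed
    have "p \<in> Lim_set n D' f" unfolding Lim_set_iff[OF fD']
    proof (intro conjI allI impI)
      show "p \<in> Fspace n" using p by (simp add: Lim_set_def)
      fix d :: 'a assume d: "0 < d"
      then obtain b where b: "0 < b" "\<forall>t\<in>D'. t < b \<longrightarrow> (\<forall>i<n. \<bar>f t i - p i\<bar> < d)" using conv by blast
      obtain t where "0 < t" "t < min (min b d) q" using dense[of 0 "min (min b d) q"] b(1) d q(1) by auto
      then show "\<exists>t\<in>D'. \<bar>t\<bar> < d \<and> (\<forall>i<n. \<bar>f t i - p i\<bar> < d)"
        using b(2) by (intro bexI[of _ t]) (auto simp: D'_def)
    qed
    then have "Lim_set n D' f = {p}"
      by (rule Lim_set_singleton[OF fD']) (use conv in \<open>auto simp: D'_def\<close>)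
    then show ?thesis by simp
  qed
  ultimately show "\<exists>D'\<in>{{0<..e} |e. 0 < e}. D' \<subseteq> D \<and>
      continuous_map (subtopology euclidean D') (Ftop n) f \<and>
      (Lim_set n D f \<noteq> {} \<longrightarrow> is_singleton (Lim_set n D' f))"
    using sub q(1) by (intro bexI[of _ D']) (auto simp: D'_def)
qed

lemma pseudo_filter: "admits_good_pseudo_filter M"
  unfolding admits_good_pseudo_filter_def
  using null_seq_or_germs good_pseudo_filter_null_seqs good_pseudo_filter_germs by blast

section \<open>Fibrewise derived sets\<close>

definition fibre_der :: "nat set \<Rightarrow> (nat \<Rightarrow> 'a) set \<Rightarrow> (nat \<Rightarrow> 'a) set" where
  "fibre_der J A = {x. \<forall>e>0. \<exists>y. eqoff J x y \<and> (y \<in> A \<and> (\<forall>i\<in>J. \<bar>y i - x i\<bar> < e) \<and> (\<exists>i\<in>J. y i \<noteq> x i))}"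

text \<open>The projection that forgets the coordinates in \<open>J\<close>, kept as a
  \<open>J\<close>-saturated set of environments.\<close>

definition cyl :: "nat set \<Rightarrow> (nat \<Rightarrow> 'a) set \<Rightarrow> (nat \<Rightarrow> 'a) set" where
  "cyl J A = {x. \<exists>y. eqoff J x y \<and> y \<in> A}"

lemma dset_cyl: "finite J \<Longrightarrow> dset M A \<Longrightarrow> dset M (cyl J A)"
  unfolding cyl_def by (rule dset_ex_eqoff)

lemma dset_fibre_der:
  assumes "finite J" "dset M A" shows "dset M (fibre_der J A)"
  unfolding fibre_der_def mem_Collect_eq
  by (rule dfn_intro dfn_ex_eqoff dfn_ball_finite dfn_bex_finite dset_mem[OF assms(2)] assms(1))+

lemma dset_fibre_der_funpow: "finite J \<Longrightarrow> dset M A \<Longrightarrow> dset M ((fibre_der J ^^ k) A)"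
  by (induction k) (auto intro: dset_fibre_der)

text \<open>The inclusion is assumed on the fibre through \<open>x\<close> alone: in the application
  it holds over a single base point.\<close>

lemma fibre_der_fibre_mono:
  assumes "\<And>y. eqoff J x y \<Longrightarrow> y \<in> A \<Longrightarrow> y \<in> B" "eqoff J x y" "y \<in> fibre_der J A"
  shows "y \<in> fibre_der J B"
  unfolding fibre_der_def mem_Collect_eq
proof (intro allI impI)
  fix e :: 'a assume "0 < e"
  then obtain z where z: "eqoff J y z" "z \<in> A" "\<forall>i\<in>J. \<bar>z i - y i\<bar> < e" "\<exists>i\<in>J. z i \<noteq> y i"
    using assms(3) unfolding fibre_der_def by blast
  have "z \<in> B" using assms(1)[OF eqoff_trans[OF assms(2) z(1)] z(2)] .
  then show "\<exists>z. eqoff J y z \<and> (z \<in> B \<and> (\<forall>i\<in>J. \<bar>z i - y i\<bar> < e) \<and> (\<exists>i\<in>J. z i \<noteq> y i))"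
    using z by blast
qed

lemma fibre_der_funpow_fibre_mono:
  assumes "\<And>y. eqoff J x y \<Longrightarrow> y \<in> A \<Longrightarrow> y \<in> B" "eqoff J x y" "y \<in> (fibre_der J ^^ k) A"
  shows "y \<in> (fibre_der J ^^ k) B"
  using assms(2,3)
proof (induction k arbitrary: y)
  case (Suc k)
  then show ?case using fibre_der_fibre_mono[of J x "(fibre_der J ^^ k) A" "(fibre_der J ^^ k) B" y] by simp
qed (use assms(1) in simp)

lemma fibre_der_Un: "fibre_der J (A \<union> B) = fibre_der J A \<union> fibre_der J B"
proof
  show "fibre_der J A \<union> fibre_der J B \<subseteq> fibre_der J (A \<union> B)"
    unfolding fibre_der_def by blast
  show "fibre_der J (A \<union> B) \<subseteq> fibre_der J A \<union> fibre_der J B"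
  proof
    fix x assume x: "x \<in> fibre_der J (A \<union> B)"
    show "x \<in> fibre_der J A \<union> fibre_der J B"
    proof (rule ccontr)
      assume "x \<notin> fibre_der J A \<union> fibre_der J B"
      then obtain e e' where e: "0 < e" "0 < e'"
        and A: "\<And>y. eqoff J x y \<Longrightarrow> y \<in> A \<Longrightarrow> \<forall>i\<in>J. \<bar>y i - x i\<bar> < e \<Longrightarrow> \<forall>i\<in>J. y i = x i"
        and B: "\<And>y. eqoff J x y \<Longrightarrow> y \<in> B \<Longrightarrow> \<forall>i\<in>J. \<bar>y i - x i\<bar> < e' \<Longrightarrow> \<forall>i\<in>J. y i = x i"
        unfolding fibre_der_def by blast
      have "0 < min e e'" using e by simp
      then obtain y where y: "eqoff J x y" "y \<in> A \<union> B" "\<forall>i\<in>J. \<bar>y i - x i\<bar> < min e e'" "\<exists>i\<in>J. y i \<noteq> x i"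
        using x unfolding fibre_der_def by blast
      then show False using A[OF y(1)] B[OF y(1)] by auto
    qed
  qed
qed

lemma fibre_der_funpow_Un: "(fibre_der J ^^ k) (A \<union> B) = (fibre_der J ^^ k) A \<union> (fibre_der J ^^ k) B"
  by (induction k) (auto simp: fibre_der_Un)

lemma cyl_Un: "cyl J (A \<union> B) = cyl J A \<union> cyl J B"
  unfolding cyl_def by blast

text \<open>\<open>A\<close> may fail to be closed in its fibres, so \<open>fibre_der J A\<close>
  may leave \<open>A\<close>; but a fibre that contains a limit point of the set contains points of
  it, and therefore the projections decrease.\<close>

lemma cyl_fibre_der_funpow_antimono:
  assumes "j \<le> k" shows "cyl J ((fibre_der J ^^ k) A) \<subseteq> cyl J ((fibre_der J ^^ j) A)"
  using assms
proof (induction k)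
  case (Suc k)
  have "cyl J ((fibre_der J ^^ Suc k) A) \<subseteq> cyl J ((fibre_der J ^^ k) A)"
  proof
    fix x assume "x \<in> cyl J ((fibre_der J ^^ Suc k) A)"
    then obtain y where y: "eqoff J x y" "y \<in> fibre_der J ((fibre_der J ^^ k) A)" unfolding cyl_def by auto
    then obtain z where "eqoff J y z" "z \<in> (fibre_der J ^^ k) A"
      unfolding fibre_der_def using zero_less_one by blast
    then show "x \<in> cyl J ((fibre_der J ^^ k) A)" unfolding cyl_def using y(1) eqoff_trans by blast
  qed
  then show ?case using Suc by (auto simp: le_Suc_eq)
qed simp

text \<open>The level of a point is the set of those \<open>m < N\<close> whose derived set still
  contains it. If \<open>b\<close> is lost at step \<open>Suc j\<close>, it is isolated in the
  \<open>j\<close>-th derived set, so nearby points other than \<open>b\<close> are missing from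
  that set already.\<close>

lemma der_level:
  fixes T :: "'a set"
  assumes "closed T" "(der ^^ N) T = {}" "b \<in> T"
  shows "\<exists>e>0. \<forall>a\<in>T. \<bar>a - b\<bar> < e \<longrightarrow> a \<noteq> b \<longrightarrow>
    {m. m < N \<and> a \<in> (der ^^ m) T} \<subset> {m. m < N \<and> b \<in> (der ^^ m) T}"
proof -
  have "b \<notin> (der ^^ N) T" using assms(2) by simp
  define k where "k = (LEAST k. b \<notin> (der ^^ k) T)"
  have k: "b \<notin> (der ^^ k) T" "\<And>j. j < k \<Longrightarrow> b \<in> (der ^^ j) T" "k \<le> N"
    unfolding k_def using LeastI[of "\<lambda>k. b \<notin> (der ^^ k) T", OF \<open>b \<notin> (der ^^ N) T\<close>] not_less_Least
      Least_le[of "\<lambda>k. b \<notin> (der ^^ k) T", OF \<open>b \<notin> (der ^^ N) T\<close>] by blast+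
  have "k \<noteq> 0" using k(1) assms(3) by (intro notI) simp
  then obtain j where j: "k = Suc j" by (cases k) auto
  have "\<not> b islimpt (der ^^ j) T" using k(1) by (simp add: j mem_der)
  then obtain e where e: "0 < e" "\<And>y. y \<in> (der ^^ j) T \<Longrightarrow> y \<noteq> b \<Longrightarrow> \<not> \<bar>y - b\<bar> < e"
    unfolding islimpt_iff_abs by blast
  have less: "{m. m < N \<and> a \<in> (der ^^ m) T} \<subset> {m. m < N \<and> b \<in> (der ^^ m) T}"
    if a: "\<bar>a - b\<bar> < e" "a \<noteq> b" for a
  proof -
    have "a \<notin> (der ^^ j) T" using e(2) a by blast
    then have "m < j" if "a \<in> (der ^^ m) T" for m
      using der_funpow_decreasing[OF assms(1), of j m] that by force
    then have "b \<in> (der ^^ m) T" if "a \<in> (der ^^ m) T" for m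
      using k(2)[of m] j that less_SucI by blast
    then have sub: "{m. m < N \<and> a \<in> (der ^^ m) T} \<subseteq> {m. m < N \<and> b \<in> (der ^^ m) T}" by blast
    have "j \<in> {m. m < N \<and> b \<in> (der ^^ m) T}" using k j by auto
    moreover have "j \<notin> {m. m < N \<and> a \<in> (der ^^ m) T}" using \<open>a \<notin> (der ^^ j) T\<close> by blast
    ultimately show ?thesis using sub by blast
  qed
  show ?thesis by (intro exI[of _ e] conjI ballI impI e(1) less)
qed

text \<open>If every one-coordinate projection of the fibre over \<open>x\<close> has empty interior, the levels of
  the coordinates of a point in the iterated derived sets of the closed projections add up to a
  bound for the number of fibrewise derived sets containing it.\<close>

lemma fibre_der_funpow_vanishes:
  assumes fin: "finite J" and x: "eqoff J x y" and y: "y \<in> (fibre_der J ^^ k) A"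
    and N: "\<And>j. j \<in> J \<Longrightarrow> (der ^^ N j) (closure {a. x(j := a) \<in> cyl (J - {j}) A}) = {}"
  shows "k \<le> (\<Sum>j\<in>J. N j)"
proof -
  define T where "T j = closure {a. x(j := a) \<in> cyl (J - {j}) A}" for j
  define L where "L j b = {m. m < N j \<and> b \<in> (der ^^ m) (T j)}" for j b
  have finL: "finite (L j b)" for j b unfolding L_def by simp
  have clT: "closed (T j)" for j by (simp add: T_def)
  have "(\<forall>j\<in>J. y j \<in> T j) \<and> k \<le> (\<Sum>j\<in>J. card (L j (y j)))"
    using x y
  proof (induction k arbitrary: y)
    case 0
    have "y j \<in> T j" if "j \<in> J" for j
    proof -
      have "eqoff (J - {j}) (x(j := y j)) y" using 0(1) by (auto simp: eqoff_def)
      moreover have "y \<in> A" using 0(2) by simp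
      ultimately have "x(j := y j) \<in> cyl (J - {j}) A" unfolding cyl_def by blast
      then show ?thesis unfolding T_def by (intro subsetD[OF closure_subset]) simp
    qed
    then show ?case by simp
  next
    case (Suc k)
    have yd: "y \<in> fibre_der J ((fibre_der J ^^ k) A)" using Suc.prems(2) by simp
    have yT: "y j \<in> T j" if j: "j \<in> J" for j
    proof -
      have "y j \<in> closure (T j)" unfolding closure_iff_abs
      proof (intro allI impI)
        fix e :: 'a assume "0 < e"
        then obtain z where z: "eqoff J y z" "z \<in> (fibre_der J ^^ k) A" "\<forall>i\<in>J. \<bar>z i - y i\<bar> < e"
          using yd unfolding fibre_der_def by blast
        then have "z j \<in> T j" using Suc.IH[of z] eqoff_trans[OF Suc.prems(1)] j by blast
        then show "\<exists>b\<in>T j. \<bar>b - y j\<bar> < e" using z(3) j by blast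
      qed
      then show ?thesis using clT by (simp add: closure_closed)
    qed
    have "\<exists>e>0. \<forall>a\<in>T j. \<bar>a - y j\<bar> < e \<longrightarrow> a \<noteq> y j \<longrightarrow> L j a \<subset> L j (y j)" if "j \<in> J" for j
      unfolding L_def by (rule der_level[OF clT _ yT[OF that]]) (use N[OF that] in \<open>simp add: T_def\<close>)
    then have "\<forall>j\<in>J. \<exists>e. 0 < e \<and> (\<forall>a\<in>T j. \<bar>a - y j\<bar> < e \<longrightarrow> a \<noteq> y j \<longrightarrow> L j a \<subset> L j (y j))" by blast
    from bchoice[OF this] obtain e where
      e: "\<forall>j\<in>J. 0 < e j \<and> (\<forall>a\<in>T j. \<bar>a - y j\<bar> < e j \<longrightarrow> a \<noteq> y j \<longrightarrow> L j a \<subset> L j (y j))" ..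
    obtain d where d: "0 < d" "\<forall>j\<in>J. d \<le> e j"
      using finite_positive_lower_bound[OF fin, of e] e by blast
    \<comment> \<open>\<open>z\<close> differs from \<open>y\<close> in some coordinate of
      \<open>J\<close>; wherever it does, it is close enough for its level to be strictly smaller,
      so the sum of the levels grows from \<open>z\<close> to \<open>y\<close>.\<close>
    obtain z where z: "eqoff J y z" "z \<in> (fibre_der J ^^ k) A" "\<forall>i\<in>J. \<bar>z i - y i\<bar> < d" "\<exists>i\<in>J. z i \<noteq> y i"
      using yd d(1) unfolding fibre_der_def by blast
    have IH: "\<forall>j\<in>J. z j \<in> T j" "k \<le> (\<Sum>j\<in>J. card (L j (z j)))"
      using Suc.IH[OF eqoff_trans[OF Suc.prems(1) z(1)] z(2)] by auto
    have lt: "L j (z j) \<subset> L j (y j)" if "j \<in> J" "z j \<noteq> y j" for j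
    proof -
      have "\<bar>z j - y j\<bar> < e j" using z(3) d(2) that(1) by force
      then show ?thesis using e IH(1) that by blast
    qed
    have "(\<Sum>j\<in>J. card (L j (z j))) < (\<Sum>j\<in>J. card (L j (y j)))"
    proof (rule sum_strict_mono_ex1[OF fin])
      show "\<forall>j\<in>J. card (L j (z j)) \<le> card (L j (y j))"
      proof
        fix j assume "j \<in> J"
        then show "card (L j (z j)) \<le> card (L j (y j))"
          using lt[of j] finL[of j "y j"] by (cases "z j = y j") (auto intro: card_mono)
      qed
      obtain i where i: "i \<in> J" "z i \<noteq> y i" using z(4) by blast
      then have "card (L i (z i)) < card (L i (y i))" using lt finL by (intro psubset_card_mono)
      then show "\<exists>j\<in>J. card (L j (z j)) < card (L j (y j))" using i(1) by blast
    qed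
    then show ?case using yT IH(2) by auto
  qed
  moreover have "card (L j b) \<le> N j" for j b
  proof -
    have "L j b \<subseteq> {..<N j}" by (auto simp: L_def)
    from card_mono[OF _ this] show ?thesis by simp
  qed
  then have "(\<Sum>j\<in>J. card (L j (y j))) \<le> (\<Sum>j\<in>J. N j)" by (intro sum_mono)
  ultimately show ?thesis by linarith
qed

text \<open>By the Fubini lemma, the base points over which some one-coordinate projection of the
  fibre has interior form a set without interior in the directions \<open>I\<close>. Over the
  remaining points the height is bounded by the sum of the uniform derivation lengths
  \<open>N j\<close>.\<close>

lemma finite_height:
  assumes fin: "finite I" "finite J" and disj: "I \<inter> J = {}" and A: "dset M A"
    and no: "\<And>j. j \<in> J \<Longrightarrow> \<not> has_interior (insert j I) (cyl (J - {j}) A) x"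
  shows "\<exists>k. \<not> has_interior I (cyl J ((fibre_der J ^^ k) A)) x"
proof -
  define S where "S j y = {a. y(j := a) \<in> cyl (J - {j}) A}" for j y
  have dP: "dset M (cyl (J - {j}) A)" for j using fin A by (intro dset_cyl) auto
  have "dfam M (S j)" for j unfolding dfam_def S_def mem_Collect_eq
    by (intro dset_mem[OF dP] dfn_intro)
  then have "\<exists>N. \<forall>y. interior (S j y) = {} \<longrightarrow> (der ^^ N) (closure (S j y)) = {}" for j
    by (rule der_funpow_uniform)
  then have "\<forall>j. \<exists>N. \<forall>y. interior (S j y) = {} \<longrightarrow> (der ^^ N) (closure (S j y)) = {}" ..
  from choice[OF this] obtain N where
    N: "\<forall>j y. interior (S j y) = {} \<longrightarrow> (der ^^ N j) (closure (S j y)) = {}" ..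
  let ?k = "Suc (\<Sum>j\<in>J. N j)"
  let ?B = "\<lambda>j. {y. has_interior {j} (cyl (J - {j}) A) y}"
  have reg: "small_union I" "locally_bounded I" "small_oscillation I"
    using generic_regularity[OF fin(1)] by auto
  have "\<not> has_interior I (\<Union>j\<in>J. ?B j) x"
  proof
    assume "has_interior I (\<Union>j\<in>J. ?B j) x"
    then have "\<exists>j\<in>J. has_interior I (?B j) x"
      by (rule has_interior_Union[where B = ?B, OF fin, rotated]) (intro dset_has_interior dP finite.intros)
    then obtain j where j: "j \<in> J" "has_interior I (?B j) x" ..
    have "j \<notin> I" using j(1) disj by blast
    from has_interior_fubini[OF fin(1) reg(2,3) this dP j(2)] show False using no[OF j(1)] by blast
  qed
  moreover have "y \<in> (\<Union>j\<in>J. ?B j)" if y: "y \<in> cyl J ((fibre_der J ^^ ?k) A)" for y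
  proof (rule ccontr)
    assume "y \<notin> (\<Union>j\<in>J. ?B j)"
    then have "interior (S j y) = {}" if "j \<in> J" for j
      using that unfolding S_def has_interior_line by blast
    then have vanish: "(der ^^ N j) (closure {a. y(j := a) \<in> cyl (J - {j}) A}) = {}" if "j \<in> J" for j
      using N that unfolding S_def by blast
    obtain z where z: "eqoff J y z" "z \<in> (fibre_der J ^^ ?k) A" using y unfolding cyl_def by blast
    from fibre_der_funpow_vanishes[OF fin(2) z vanish] show False by simp
  qed
  ultimately show ?thesis using has_interior_mono by blast
qed

lemma small_oscillation_finite:
  assumes "finite I" "finite J" "\<And>j. j \<in> J \<Longrightarrow> dt (f j)" "0 < e" "0 < d"
  shows "\<exists>y e'. 0 < e' \<and> nb I y e' \<subseteq> nb I x e \<and>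
    (\<forall>j\<in>J. \<forall>z\<in>nb I y e'. \<forall>w\<in>nb I y e'. \<bar>f j z - f j w\<bar> < d)"
  using assms(2,3)
proof (induction J rule: finite_induct)
  case empty
  show ?case using assms(4) by blast
next
  case (insert j J)
  from insert.IH insert.prems obtain y e' where y: "0 < e'" "nb I y e' \<subseteq> nb I x e"
      "\<forall>j\<in>J. \<forall>z\<in>nb I y e'. \<forall>w\<in>nb I y e'. \<bar>f j z - f j w\<bar> < d" by auto
  have osc: "small_oscillation I" and dj: "dt (f j)"
    using generic_regularity[OF assms(1)] insert.prems by auto
  obtain y2 e2 where y2: "0 < e2" "nb I y2 e2 \<subseteq> nb I y e'"
      "\<And>z w. z \<in> nb I y2 e2 \<Longrightarrow> w \<in> nb I y2 e2 \<Longrightarrow> \<bar>f j z - f j w\<bar> < d"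
    by (rule small_oscillationD[OF osc dj y(1) assms(5), where x = y]) (rule that)
  show ?case
    by (intro exI[of _ y2] exI[of _ e2]) (use y y2 in blast)
qed

text \<open>Over a small ball of the base choose a definable section \<open>g\<close> of \<open>Z\<close> of small oscillation whose
  values are isolated in the fibres of \<open>Y\<close> at a uniform distance. Near a point of its graph, \<open>Y\<close> is
  contained in the graph.\<close>

lemma interior_if_same_height:
  assumes fin: "finite I" "finite J" and disj: "I \<inter> J = {}"
    and Z: "dset M Z" and Y: "dset M Y" and sub: "Z \<subseteq> Y"
    and high: "has_interior I (cyl J ((fibre_der J ^^ k) Z)) x"
    and low: "\<not> has_interior I (cyl J ((fibre_der J ^^ Suc k) Y)) x"
  shows "\<exists>z e. eqoff (I \<union> J) x z \<and> z \<in> Z \<and> 0 < e \<and>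
    (\<forall>w. eqoff (I \<union> J) z w \<longrightarrow> (\<forall>i\<in>I \<union> J. \<bar>w i - z i\<bar> < e) \<longrightarrow> w \<in> Y \<longrightarrow> w \<in> Z)"
proof -
  let ?A = "cyl J ((fibre_der J ^^ k) Z)" and ?B = "cyl J ((fibre_der J ^^ Suc k) Y)"
  have dA: "dset M ?A" and dB: "dset M ?B"
    using fin Z Y by (auto intro!: dset_cyl dset_fibre_der_funpow simp del: funpow.simps)
  have "has_interior I ((?A - ?B) \<union> ?B) x" by (rule has_interior_mono[OF high]) blast
  then have "has_interior I (?A - ?B) x"
    using has_interior_UnD[OF fin(1) dset_Diff[OF dA dB] dB] low by blast
  then obtain x0 e0 where 0: "eqoff I x x0" "0 < e0" "nb I x0 e0 \<subseteq> ?A - ?B"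
    unfolding has_interior_nb by blast
  \<comment> \<open>These points of \<open>Z\<close> are isolated in their fibre of
    \<open>Y\<close>. If a fibre over the ball had none, \<open>Z\<close> would lie there in
    \<open>fibre_der J Y\<close>, and \<open>k\<close> derivations of \<open>Z\<close> would amount
    to \<open>Suc k\<close> derivations of \<open>Y\<close>, which the ball avoids.\<close>
  define G where "G = Z - fibre_der J Y"
  have dG: "dset M G" unfolding G_def by (intro dset_Diff Z dset_fibre_der fin Y)
  have exG: "\<exists>y. eqoff J v y \<and> y \<in> G" if v: "v \<in> nb I x0 e0" for v
  proof (rule ccontr)
    assume no: "\<not> ?thesis"
    have "v \<in> ?A" "v \<notin> ?B" using v 0(3) by blast+
    then obtain y where y: "eqoff J v y" "y \<in> (fibre_der J ^^ k) Z" unfolding cyl_def by blast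
    have "y \<in> (fibre_der J ^^ k) (fibre_der J Y)"
      by (rule fibre_der_funpow_fibre_mono[OF _ y]) (use no in \<open>auto simp: G_def\<close>)
    then have "y \<in> (fibre_der J ^^ Suc k) Y" by (simp add: funpow_swap1)
    then show False using \<open>v \<notin> ?B\<close> y(1) unfolding cyl_def by blast
  qed
  from env_choice[OF fin(2) dG] obtain g where g: "\<forall>i. dt (\<lambda>x. g x i)"
    "\<forall>x. (\<exists>y. eqoff J x y \<and> y \<in> G) \<longrightarrow> g x \<in> G \<and> eqoff J x (g x)"
    by (elim exE conjE)
  have gG: "g v \<in> G" "eqoff J v (g v)" if "v \<in> nb I x0 e0" for v
    using g(2) exG[OF that] by blast+
  \<comment> \<open>Radii around \<open>g v\<close> within which the fibre of \<open>Y\<close> has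
    no second point; shrinking the ball makes a chosen radius at least \<open>r0\<close>.\<close>
  define S where "S v = {r. 0 < r \<and> (\<forall>y. eqoff J (g v) y \<longrightarrow>
      ((\<forall>i\<in>J. \<bar>y i - g v i\<bar> < r) \<longrightarrow> y \<in> Y \<longrightarrow> (\<forall>i\<in>J. y i = g v i)))}" for v
  have "dfam M S" unfolding dfam_def S_def mem_Collect_eq
    by (rule dfn_intro dfn_all_eqoff fin dfn_ball_finite dset_mem[OF Y] dterm_rename[OF g(1)[rule_format]])+
  from choice_line[OF this] obtain t where t: "dt t" "\<forall>s. S s \<noteq> {} \<longrightarrow> t s \<in> S s"
    by (elim exE conjE)
  have tS: "t v \<in> S v" if v: "v \<in> nb I x0 e0" for v
  proof -
    have "g v \<notin> fibre_der J Y" using gG[OF v] by (simp add: G_def)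
    then obtain r where r: "0 < r" "\<not> (\<exists>y. eqoff J (g v) y \<and> (y \<in> Y \<and> (\<forall>i\<in>J. \<bar>y i - g v i\<bar> < r) \<and>
        (\<exists>i\<in>J. y i \<noteq> g v i)))"
      unfolding fibre_der_def by blast
    then have "r \<in> S v" unfolding S_def by blast
    then show ?thesis using t(2) by blast
  qed
  have bd: "locally_bounded I" using generic_regularity[OF fin(1)] by blast
  have dinv: "dt (\<lambda>y. 1 / t y)" by (intro dfn_intro t)
  obtain y1 e1 c where 1: "0 < e1" "nb I y1 e1 \<subseteq> nb I x0 e0" "\<And>z. z \<in> nb I y1 e1 \<Longrightarrow> 1 / t z \<le> c"
    by (rule locally_boundedD[OF bd dinv 0(2), where x = x0]) (rule that)
  have pos: "0 < t y" if "y \<in> nb I y1 e1" for y using tS[of y] 1(2) that by (auto simp: S_def)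
  have "0 < c" using 1(3)[OF nb_center[OF 1(1)]] pos[OF nb_center[OF 1(1)]]
    by (meson less_le_trans zero_less_divide_1_iff)
  define r0 where "r0 = 1 / c"
  have "0 < r0" using \<open>0 < c\<close> by (simp add: r0_def)
  have t_ge: "r0 \<le> t y" if "y \<in> nb I y1 e1" for y
    using 1(3)[OF that] pos[OF that] \<open>0 < c\<close> unfolding r0_def by (simp add: field_simps)
  have "0 < r0 / 2" using \<open>0 < r0\<close> by simp
  from small_oscillation_finite[where f = "\<lambda>j v. g v j", OF fin g(1)[rule_format] 1(1) this, of y1]
  obtain x2 e2 where 2: "0 < e2" "nb I x2 e2 \<subseteq> nb I y1 e1"
    "\<forall>j\<in>J. \<forall>z\<in>nb I x2 e2. \<forall>w\<in>nb I x2 e2. \<bar>g z j - g w j\<bar> < r0 / 2" by (elim exE conjE)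
  have x2: "x2 \<in> nb I x2 e2" using nb_center[OF 2(1)] .
  have x2': "x2 \<in> nb I x0 e0" using x2 2(2) 1(2) by blast
  define z where "z = g x2"
  have "z \<in> Z" using gG(1)[OF x2'] by (simp add: z_def G_def)
  have zJ: "eqoff J x2 z" using gG(2)[OF x2'] by (simp add: z_def)
  have "eqoff I x x2" using 0(1) nb_eqoff[OF x2'] eqoff_trans by blast
  then have "eqoff (I \<union> J) x z" using zJ by (simp add: eqoff_def)
  moreover have "0 < min e2 (r0 / 2)" using 2(1) \<open>0 < r0\<close> by simp
  moreover have "w \<in> Z"
    if w: "eqoff (I \<union> J) z w" "\<forall>i\<in>I \<union> J. \<bar>w i - z i\<bar> < min e2 (r0 / 2)" "w \<in> Y" for w
  proof -
    \<comment> \<open>The base point below \<open>w\<close>. Both \<open>w\<close> and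
      \<open>g v\<close> lie in the fibre of \<open>Y\<close> over it, closer than the radius
      \<open>t v\<close>, so they coincide.\<close>
    define v where "v = (\<lambda>i. if i \<in> I then w i else x2 i)"
    have zI: "x2 i = z i" if "i \<in> I" for i using zJ that disj unfolding eqoff_def by blast
    have v: "v \<in> nb I x2 e2" using w(2) zI by (auto simp: nb_def eqoff_def v_def)
    then have v': "v \<in> nb I y1 e1" "v \<in> nb I x0 e0" using 2(2) 1(2) by auto
    have "eqoff J v w" unfolding eqoff_def
    proof (intro allI impI)
      fix i assume "i \<notin> J"
      then show "v i = w i" using zJ w(1) by (cases "i \<in> I") (auto simp: v_def eqoff_def)
    qed
    then have gw: "eqoff J (g v) w" using gG(2)[OF v'(2)] eqoff_trans eqoff_sym by blast
    have "\<bar>w i - g v i\<bar> < t v" if i: "i \<in> J" for i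
    proof -
      have "\<bar>w i - z i\<bar> < r0 / 2" using w(2) i by simp
      moreover have "\<bar>z i - g v i\<bar> < r0 / 2" using 2(3) i x2 v by (simp add: z_def)
      ultimately have "\<bar>w i - g v i\<bar> < r0 / 2 + r0 / 2" by linarith
      then show ?thesis using t_ge[OF v'(1)] by simp
    qed
    then have "\<forall>i\<in>J. w i = g v i" using tS[OF v'(2)] gw w(3) unfolding S_def by blast
    then have "w = g v" using gw unfolding eqoff_def by (metis ext)
    then show ?thesis using gG(1)[OF v'(2)] by (simp add: G_def)
  qed
  ultimately show ?thesis using \<open>z \<in> Z\<close> by blast
qed

end

section \<open>The extended rank\<close>

definition lexle :: "nat \<times> nat \<Rightarrow> nat \<times> nat \<Rightarrow> bool" where
  "lexle p q \<longleftrightarrow> (p, q) \<in> less_than <*lex*> less_than \<or> p = q"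

lemma lexle_iff: "lexle (a, b) (c, d) \<longleftrightarrow> a < c \<or> a = c \<and> b \<le> d"
  unfolding lexle_def by auto

lemma lexle_refl: "lexle p p"
  and lexle_trans: "lexle p q \<Longrightarrow> lexle q r \<Longrightarrow> lexle p r"
  and lexle_antisym: "lexle p q \<Longrightarrow> lexle q p \<Longrightarrow> p = q"
  and lexle_linear: "lexle p q \<or> lexle q p"
  by (cases p; cases q; cases r; auto simp: lexle_iff)+

definition is_lexmax :: "(nat \<times> nat) set \<Rightarrow> nat \<times> nat \<Rightarrow> bool" where
  "is_lexmax S p \<longleftrightarrow> p \<in> S \<and> (\<forall>q\<in>S. lexle q p)"

definition lexmax :: "(nat \<times> nat) set \<Rightarrow> nat \<times> nat" where
  "lexmax S = (THE p. is_lexmax S p)"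

lemma lexmax_eq: "is_lexmax S p \<Longrightarrow> lexmax S = p"
  unfolding lexmax_def is_lexmax_def by (rule the_equality) (auto intro: lexle_antisym)

lemma is_lexmax_Un:
  assumes "is_lexmax S p" "is_lexmax T q"
  shows "is_lexmax (S \<union> T) (if lexle p q then q else p)"
proof (cases "lexle p q")
  case True
  then have "\<forall>r\<in>S. lexle r q" using assms(1) lexle_trans unfolding is_lexmax_def by blast
  then show ?thesis using True assms(2) unfolding is_lexmax_def by auto
next
  case False
  then have "lexle q p" using lexle_linear by blast
  then have "\<forall>r\<in>T. lexle r p" using assms(2) lexle_trans unfolding is_lexmax_def by blast
  then show ?thesis using False assms(1) unfolding is_lexmax_def by auto
qed

text \<open>Second components are bounded over the largest first component; over smaller ones they
  may be unbounded, since fibres with interior survive every derivation.\<close>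

lemma is_lexmax_exists:
  assumes "S \<noteq> {}" "\<And>p. p \<in> S \<Longrightarrow> fst p \<le> n"
    and bound: "\<And>d. (\<And>p. p \<in> S \<Longrightarrow> fst p \<le> d) \<Longrightarrow> \<exists>K. \<forall>k. (d, k) \<in> S \<longrightarrow> k \<le> K"
  shows "\<exists>p. is_lexmax S p"
proof -
  have "fst ` S \<subseteq> {..n}" using assms(2) by blast
  then have "finite (fst ` S)" by (rule finite_subset) simp
  define d where "d = Max (fst ` S)"
  have d: "d \<in> fst ` S" unfolding d_def using \<open>finite (fst ` S)\<close> assms(1) by (intro Max_in) auto
  have d_max: "fst p \<le> d" if "p \<in> S" for p
    unfolding d_def using \<open>finite (fst ` S)\<close> that by (intro Max_ge) auto
  from bound[OF d_max] obtain K where K: "\<forall>k. (d, k) \<in> S \<longrightarrow> k \<le> K" ..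
  have "{k. (d, k) \<in> S} \<subseteq> {..K}" using K by blast
  then have fin: "finite {k. (d, k) \<in> S}" by (rule finite_subset) simp
  have ne: "{k. (d, k) \<in> S} \<noteq> {}" using d by (auto simp: image_iff)
  define k where "k = Max {k. (d, k) \<in> S}"
  have "(d, k) \<in> S" "\<And>j. (d, j) \<in> S \<Longrightarrow> j \<le> k"
    unfolding k_def using Max_in[OF fin ne] Max_ge[OF fin] by auto
  then have "is_lexmax S (d, k)"
    unfolding is_lexmax_def using d_max by (force simp: lexle_iff le_less)
  then show ?thesis ..
qed

text \<open>The values of an extended rank function have to be sets of environments.\<close>

definition code :: "nat \<times> nat \<Rightarrow> (nat \<Rightarrow> 'a::linordered_field) set" where
  "code p = {\<lambda>_. of_nat (prod_encode p)}"

lemma code_eq_iff [simp]: "code p = (code q :: (nat \<Rightarrow> 'a::linordered_field) set) \<longleftrightarrow> p = q"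
  unfolding code_def by (auto dest: fun_cong)

definition code_le :: "(nat \<Rightarrow> 'a::linordered_field) set rel" where
  "code_le = {(code p, code q) |p q. lexle p q}"

lemma code_le_iff [simp]: "(code p, code q) \<in> (code_le :: (nat \<Rightarrow> 'a::linordered_field) set rel) \<longleftrightarrow> lexle p q"
  unfolding code_le_def by (auto simp del: split_paired_Ex)

lemma linear_order_code_le: "linear_order_on (range code) code_le"
  unfolding linear_order_on_def partial_order_on_def preorder_on_def
proof (intro conjI)
  show "refl_on (range code) code_le"
    unfolding refl_on_def by (auto simp: lexle_refl)
  show "code_le \<subseteq> range code \<times> range code" unfolding code_le_def by auto
  show "trans code_le"
    unfolding trans_def code_le_def by (auto intro: lexle_trans)
  show "antisym code_le"
    unfolding antisym_def code_le_def by (auto dest: lexle_antisym)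
  show "total_on (range code) code_le"
    unfolding total_on_def using lexle_linear by auto
qed

lemma no_descending_code:
  "\<not> (\<exists>s :: nat \<Rightarrow> (nat \<Rightarrow> 'a::linordered_field) set.
     \<forall>i. s i \<in> range code \<and> (s (Suc i), s i) \<in> code_le \<and> s (Suc i) \<noteq> s i)"
proof
  assume "\<exists>s :: nat \<Rightarrow> (nat \<Rightarrow> 'a) set.
     \<forall>i. s i \<in> range code \<and> (s (Suc i), s i) \<in> code_le \<and> s (Suc i) \<noteq> s i"
  then obtain s :: "nat \<Rightarrow> (nat \<Rightarrow> 'a) set" where
    s: "\<forall>i. s i \<in> range code \<and> (s (Suc i), s i) \<in> code_le \<and> s (Suc i) \<noteq> s i" ..
  then have "\<forall>i. \<exists>p. s i = code p" by blast
  from choice[OF this] obtain p where p: "\<forall>i. s i = code (p i)" ..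
  have "(p (Suc i), p i) \<in> less_than <*lex*> less_than" for i
    using s p unfolding lexle_def[symmetric] by (metis code_eq_iff code_le_iff lexle_def)
  moreover have "wf (less_than <*lex*> less_than)" by auto
  ultimately show False unfolding wf_iff_no_infinite_down_chain by blast
qed

lemma openin_Ftop_ball:
  fixes x :: "nat \<Rightarrow> 'a::{linordered_field, linorder_topology}"
  shows "openin (Ftop n) (\<Pi>\<^sub>E i\<in>{..<n}. {y. \<bar>y - x i\<bar> < e})"
  unfolding Ftop_def by (subst openin_PiE) (auto simp: open_abs_ball)

context d_minimal_field
begin

section \<open>The rank of a definable set\<close>

definition envs :: "nat \<Rightarrow> (nat \<Rightarrow> 'a) set \<Rightarrow> (nat \<Rightarrow> 'a) set" where
  "envs n X = {s. restrict s {..<n} \<in> X}"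

text \<open>Pairs of a dimension and a height witnessed over some set \<open>I\<close> of
  coordinates. The base point \<open>\<lambda>_. 0\<close> only fills the coordinates from
  \<open>n\<close> on, to which sets of the form \<open>envs n X\<close> are indifferent.\<close>

definition ranks :: "nat \<Rightarrow> (nat \<Rightarrow> 'a) set \<Rightarrow> (nat \<times> nat) set" where
  "ranks n A = {(card I, k) |I k. I \<subseteq> {..<n} \<and>
     has_interior I (cyl ({..<n} - I) ((fibre_der ({..<n} - I) ^^ k) A)) (\<lambda>_. 0)}"

lemma ranks_Un:
  assumes "dset M A" "dset M B" shows "ranks n (A \<union> B) = ranks n A \<union> ranks n B"
proof -
  have "has_interior I (cyl J ((fibre_der J ^^ k) (A \<union> B))) x \<longleftrightarrow>
      has_interior I (cyl J ((fibre_der J ^^ k) A)) x \<or> has_interior I (cyl J ((fibre_der J ^^ k) B)) x"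
    if I: "I \<subseteq> {..<n}" and J: "J = {..<n} - I" for I J k x
  proof -
    have fin: "finite I" "finite J" using I J finite_subset by auto
    have "dset M (cyl J ((fibre_der J ^^ k) A))" "dset M (cyl J ((fibre_der J ^^ k) B))"
      using assms fin by (auto intro!: dset_cyl dset_fibre_der_funpow)
    then show ?thesis unfolding fibre_der_funpow_Un cyl_Un
      using has_interior_UnD[OF fin(1)] has_interior_mono by (metis Un_iff)
  qed
  then show ?thesis unfolding ranks_def by blast
qed

text \<open>Dimensions are at most \<open>n\<close>. If \<open>d\<close> is the largest, no
  projection onto more than \<open>d\<close> coordinates has interior, so
  \<open>finite_height\<close> bounds the heights over each of the finitely many sets
  \<open>I\<close> of size \<open>d\<close>.\<close>

lemma is_lexmax_ranks:
  assumes A: "dset M A" and ne: "\<exists>y. eqoff {..<n} (\<lambda>_. 0) y \<and> y \<in> A"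
  shows "is_lexmax (ranks n A) (lexmax (ranks n A))"
proof -
  have "\<exists>p. is_lexmax (ranks n A) p"
  proof (rule is_lexmax_exists)
    \<comment> \<open>With no coordinates to move, having interior means membership, so every
      nonempty set realises the pair \<open>(0, 0)\<close>.\<close>
    have "has_interior {} B x \<longleftrightarrow> x \<in> B" for B x
    proof -
      have "eqoff {} x y \<longleftrightarrow> y = x" for x y by (auto simp: eqoff_def fun_eq_iff)
      moreover have "\<exists>e::'a. 0 < e" using zero_less_one by blast
      ultimately show ?thesis unfolding has_interior_def by auto
    qed
    then have "has_interior {} (cyl ({..<n} - {}) ((fibre_der ({..<n} - {}) ^^ 0) A)) (\<lambda>_. 0)"
      using ne by (simp add: cyl_def)
    then show "ranks n A \<noteq> {}" unfolding ranks_def by blast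
    show "fst p \<le> n" if p: "p \<in> ranks n A" for p
    proof -
      obtain I where "I \<subseteq> {..<n}" "fst p = card I" using p unfolding ranks_def by auto
      then show ?thesis using card_mono[of "{..<n}" I] by simp
    qed
    fix d assume d: "\<And>p. p \<in> ranks n A \<Longrightarrow> fst p \<le> d"
    have "\<exists>K. \<forall>k. has_interior I (cyl ({..<n} - I) ((fibre_der ({..<n} - I) ^^ k) A)) (\<lambda>_. 0) \<longrightarrow> k \<le> K"
      if I: "I \<subseteq> {..<n}" "card I = d" for I
    proof -
      let ?J = "{..<n} - I"
      have fin: "finite I" "finite ?J" using I finite_subset by auto
      have "\<not> has_interior (insert j I) (cyl (?J - {j}) A) (\<lambda>_. 0)" if j: "j \<in> ?J" for j
      proof
        assume "has_interior (insert j I) (cyl (?J - {j}) A) (\<lambda>_. 0)"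
        moreover have "?J - {j} = {..<n} - insert j I" by blast
        ultimately have "has_interior (insert j I) (cyl ({..<n} - insert j I)
            ((fibre_der ({..<n} - insert j I) ^^ 0) A)) (\<lambda>_. 0)" by simp
        moreover have "insert j I \<subseteq> {..<n}" using I j by blast
        ultimately have "(card (insert j I), 0) \<in> ranks n A" unfolding ranks_def by blast
        then have "card (insert j I) \<le> d" using d by force
        then show False using I j fin by simp
      qed
      from finite_height[OF fin _ A this]
      obtain K where K: "\<not> has_interior I (cyl ?J ((fibre_der ?J ^^ K) A)) (\<lambda>_. 0)" by blast
      have "k \<le> K" if k: "has_interior I (cyl ?J ((fibre_der ?J ^^ k) A)) (\<lambda>_. 0)" for k
      proof (rule ccontr)
        assume "\<not> k \<le> K"
        then have "cyl ?J ((fibre_der ?J ^^ k) A) \<subseteq> cyl ?J ((fibre_der ?J ^^ K) A)"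
          by (intro cyl_fibre_der_funpow_antimono) simp
        then show False using has_interior_mono[OF k] K by blast
      qed
      then show ?thesis by blast
    qed
    then have "\<forall>I\<in>{I. I \<subseteq> {..<n} \<and> card I = d}. \<exists>K. \<forall>k.
        has_interior I (cyl ({..<n} - I) ((fibre_der ({..<n} - I) ^^ k) A)) (\<lambda>_. 0) \<longrightarrow> k \<le> K" by simp
    from bchoice[OF this] obtain K where
      K: "\<forall>I\<in>{I. I \<subseteq> {..<n} \<and> card I = d}. \<forall>k.
        has_interior I (cyl ({..<n} - I) ((fibre_der ({..<n} - I) ^^ k) A)) (\<lambda>_. 0) \<longrightarrow> k \<le> K I" ..
    have fin: "finite {I. I \<subseteq> {..<n} \<and> card I = d}" by (rule finite_subset[of _ "Pow {..<n}"]) auto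
    have "k \<le> Max (K ` {I. I \<subseteq> {..<n} \<and> card I = d})" if dk: "(d, k) \<in> ranks n A" for k
    proof -
      obtain I where I: "I \<subseteq> {..<n}" "card I = d"
          "has_interior I (cyl ({..<n} - I) ((fibre_der ({..<n} - I) ^^ k) A)) (\<lambda>_. 0)"
        using dk unfolding ranks_def by auto
      then have "k \<le> K I" using K by blast
      also have "\<dots> \<le> Max (K ` {I. I \<subseteq> {..<n} \<and> card I = d})" using I fin by (intro Max_ge) auto
      finally show ?thesis .
    qed
    then show "\<exists>K. \<forall>k. (d, k) \<in> ranks n A \<longrightarrow> k \<le> K" by blast
  qed
  then show ?thesis using lexmax_eq by metis
qed

text \<open>Were the maxima equal, then over the set \<open>I\<close> that witnesses the maximum of
  \<open>Z\<close> the height of \<open>Y\<close> would not exceed that of \<open>Z\<close>, and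
  \<open>interior_if_same_height\<close> would find a point of \<open>Z\<close> near which
  \<open>Y\<close> is contained in \<open>Z\<close>.\<close>

lemma lexmax_ranks_less:
  assumes Z: "dset M Z" and Y: "dset M Y" and sub: "Z \<subseteq> Y"
    and ne: "\<exists>y. eqoff {..<n} (\<lambda>_. 0) y \<and> y \<in> Z"
    and no: "\<And>z e. z \<in> Z \<Longrightarrow> 0 < e \<Longrightarrow>
      \<exists>w. eqoff {..<n} z w \<and> (\<forall>i<n. \<bar>w i - z i\<bar> < e) \<and> w \<in> Y \<and> w \<notin> Z"
  shows "lexle (lexmax (ranks n Z)) (lexmax (ranks n Y)) \<and> lexmax (ranks n Z) \<noteq> lexmax (ranks n Y)"
proof -
  have ne': "\<exists>y. eqoff {..<n} (\<lambda>_. 0) y \<and> y \<in> Y" using ne sub by blast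
  obtain p where p: "is_lexmax (ranks n Z) p" using is_lexmax_ranks[OF Z ne] by blast
  obtain q where q: "is_lexmax (ranks n Y) q" using is_lexmax_ranks[OF Y ne'] by blast
  have "Z \<union> Y = Y" using sub by blast
  then have "ranks n Z \<subseteq> ranks n Y" using ranks_Un[OF Z Y, of n] by (metis Un_upper1)
  then have le: "lexle p q" using p q unfolding is_lexmax_def by blast
  have "p \<noteq> q"
  proof
    assume "p = q"
    obtain I k where Ik: "p = (card I, k)" "I \<subseteq> {..<n}"
        "has_interior I (cyl ({..<n} - I) ((fibre_der ({..<n} - I) ^^ k) Z)) (\<lambda>_. 0)"
      using p unfolding is_lexmax_def ranks_def by blast
    let ?J = "{..<n} - I"
    have fin: "finite I" "finite ?J" using Ik(2) finite_subset by auto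
    have low: "\<not> has_interior I (cyl ?J ((fibre_der ?J ^^ Suc k) Y)) (\<lambda>_. 0)"
    proof
      assume "has_interior I (cyl ?J ((fibre_der ?J ^^ Suc k) Y)) (\<lambda>_. 0)"
      then have "(card I, Suc k) \<in> ranks n Y" using Ik(2) unfolding ranks_def by blast
      then have "lexle (card I, Suc k) (card I, k)"
        using q \<open>p = q\<close> Ik(1) unfolding is_lexmax_def by blast
      then show False by (simp add: lexle_iff)
    qed
    have IJ: "I \<union> ?J = {..<n}" using Ik(2) by blast
    from interior_if_same_height[OF fin _ Z Y sub Ik(3) low, unfolded IJ]
    obtain z e where "z \<in> Z" "0 < e"
      "\<forall>w. eqoff {..<n} z w \<longrightarrow> (\<forall>i\<in>{..<n}. \<bar>w i - z i\<bar> < e) \<longrightarrow> w \<in> Y \<longrightarrow> w \<in> Z" by blast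
    then show False using no[of z e] by auto
  qed
  then show ?thesis using le lexmax_eq[OF p] lexmax_eq[OF q] by simp
qed

lemma definable_iff_envs: "definable M n X \<longleftrightarrow> X \<subseteq> Fspace n \<and> dset M (envs n X)"
  unfolding definable_iff_dfn envs_def mem_Collect_eq ..

lemma envs_Un: "envs n (X \<union> Y) = envs n X \<union> envs n Y"
  unfolding envs_def by blast

lemma envs_nonempty:
  assumes "X \<subseteq> Fspace n" "X \<noteq> {}" shows "\<exists>y. eqoff {..<n} (\<lambda>_. 0) y \<and> y \<in> envs n X"
proof -
  obtain x where x: "x \<in> X" using assms(2) by blast
  let ?y = "\<lambda>i. if i < n then x i else 0"
  have "restrict ?y {..<n} = x"
    using x assms(1) by (auto simp: Fspace_def fun_eq_iff PiE_def extensional_def)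
  then have "?y \<in> envs n X" using x by (simp add: envs_def)
  moreover have "eqoff {..<n} (\<lambda>_. 0) ?y" by (simp add: eqoff_def)
  ultimately show ?thesis by blast
qed

text \<open>The interior of \<open>X\<close> relative to \<open>Y\<close>, expressed by cubes rather
  than by \<open>openin\<close> so that its definability can be read off.\<close>

definition relint :: "nat \<Rightarrow> (nat \<Rightarrow> 'a) set \<Rightarrow> (nat \<Rightarrow> 'a) set \<Rightarrow> (nat \<Rightarrow> 'a) set" where
  "relint n Y X = {x\<in>X. \<exists>e>0. \<forall>y\<in>Y. (\<forall>i<n. \<bar>y i - x i\<bar> < e) \<longrightarrow> y \<in> X}"

lemma openin_relint:
  assumes "X \<subseteq> Y" "Y \<subseteq> Fspace n"
  shows "openin (subtopology (Ftop n) Y) (relint n Y X)"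
proof (subst openin_subopen, intro ballI)
  fix x assume x: "x \<in> relint n Y X"
  then obtain e where e: "0 < e" "\<forall>y\<in>Y. (\<forall>i<n. \<bar>y i - x i\<bar> < e) \<longrightarrow> y \<in> X" and "x \<in> X"
    unfolding relint_def by blast
  define V where "V = (\<Pi>\<^sub>E i\<in>{..<n}. {y. \<bar>y - x i\<bar> < e}) \<inter> Y"
  have "openin (subtopology (Ftop n) Y) V"
    unfolding V_def openin_subtopology using openin_Ftop_ball by blast
  moreover have "x \<in> V" using \<open>x \<in> X\<close> assms e(1) by (auto simp: V_def Fspace_def PiE_def)
  moreover have "V \<subseteq> relint n Y X"
  proof
    fix y assume y: "y \<in> V"
    then have near: "\<bar>y i - x i\<bar> < e" if "i < n" for i using that by (auto simp: V_def PiE_def Pi_def)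
    have "\<exists>d>0. \<forall>i\<in>{..<n}. d \<le> e - \<bar>y i - x i\<bar>"
      by (rule finite_positive_lower_bound) (use near in auto)
    then obtain d where d: "0 < d" "\<forall>i\<in>{..<n}. d \<le> e - \<bar>y i - x i\<bar>" by blast
    have "z \<in> X" if z: "z \<in> Y" "\<forall>i<n. \<bar>z i - y i\<bar> < d" for z
    proof -
      have "\<bar>z i - x i\<bar> < e" if "i < n" for i
      proof -
        have "\<bar>z i - y i\<bar> < d" "d \<le> e - \<bar>y i - x i\<bar>" using z(2) d(2) that by auto
        then show ?thesis by linarith
      qed
      then show ?thesis using e(2) z(1) by blast
    qed
    moreover have "y \<in> X" using e(2) near y by (auto simp: V_def)
    ultimately show "y \<in> relint n Y X" unfolding relint_def using d(1) by blast
  qed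
  ultimately show "\<exists>T. openin (subtopology (Ftop n) Y) T \<and> x \<in> T \<and> T \<subseteq> relint n Y X" by blast
qed

text \<open>Moves a quantifier over points of \<open>X\<close> to environments, in the shape that
  the rules for \<open>eqoff\<close> accept; \<open>s\<close> supplies the coordinates from
  \<open>n\<close> on.\<close>

lemma restrict_near:
  assumes "X \<subseteq> Fspace n"
  shows "(\<exists>y\<in>X. (\<forall>i<n. \<bar>y i - x i\<bar> < e) \<and> P y) \<longleftrightarrow>
    (\<exists>w. eqoff {..<n} s w \<and> (\<forall>i\<in>{..<n}. \<bar>w i - x i\<bar> < e) \<and> w \<in> envs n X \<and> P (restrict w {..<n}))"
proof
  assume "\<exists>y\<in>X. (\<forall>i<n. \<bar>y i - x i\<bar> < e) \<and> P y"
  then obtain y where y: "y \<in> X" "\<forall>i<n. \<bar>y i - x i\<bar> < e" "P y" by blast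
  let ?w = "\<lambda>i. if i < n then y i else s i"
  have "restrict ?w {..<n} = y"
    using y(1) assms by (auto simp: Fspace_def fun_eq_iff PiE_def extensional_def)
  then have "eqoff {..<n} s ?w \<and> (\<forall>i\<in>{..<n}. \<bar>?w i - x i\<bar> < e) \<and> ?w \<in> envs n X \<and> P (restrict ?w {..<n})"
    using y by (simp add: eqoff_def envs_def)
  then show "\<exists>w. eqoff {..<n} s w \<and> (\<forall>i\<in>{..<n}. \<bar>w i - x i\<bar> < e) \<and> w \<in> envs n X \<and> P (restrict w {..<n})"
    by blast
next
  assume "\<exists>w. eqoff {..<n} s w \<and> (\<forall>i\<in>{..<n}. \<bar>w i - x i\<bar> < e) \<and> w \<in> envs n X \<and> P (restrict w {..<n})"
  then obtain w where "\<forall>i\<in>{..<n}. \<bar>w i - x i\<bar> < e" "restrict w {..<n} \<in> X" "P (restrict w {..<n})"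
    unfolding envs_def by blast
  then show "\<exists>y\<in>X. (\<forall>i<n. \<bar>y i - x i\<bar> < e) \<and> P y"
    by (intro bexI[of _ "restrict w {..<n}"]) auto
qed

lemma definable_relint:
  assumes X: "definable M n X" and Y: "definable M n Y" and sub: "X \<subseteq> Y"
  shows "definable M n (relint n Y X)"
proof -
  have XF: "X \<subseteq> Fspace n" and YF: "Y \<subseteq> Fspace n" and dX: "dset M (envs n X)" and dY: "dset M (envs n Y)"
    using X Y unfolding definable_iff_envs by auto
  have eq: "restrict s {..<n} \<in> relint n Y X \<longleftrightarrow> s \<in> envs n X \<and> (\<exists>e>0. \<not> (\<exists>w. eqoff {..<n} s w \<and>
      ((\<forall>i\<in>{..<n}. \<bar>w i - s i\<bar> < e) \<and> w \<in> envs n Y \<and> w \<notin> envs n X)))" for s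
  proof -
    have "(\<exists>y\<in>Y. (\<forall>i<n. \<bar>y i - restrict s {..<n} i\<bar> < e) \<and> y \<notin> X) \<longleftrightarrow>
      (\<exists>w. eqoff {..<n} s w \<and> ((\<forall>i\<in>{..<n}. \<bar>w i - s i\<bar> < e) \<and> w \<in> envs n Y \<and> w \<notin> envs n X))" for e
      unfolding restrict_near[OF YF, where s = s] by (simp add: envs_def cong: conj_cong)
    moreover have "restrict s {..<n} \<in> relint n Y X \<longleftrightarrow> restrict s {..<n} \<in> X \<and>
        (\<exists>e>0. \<not> (\<exists>y\<in>Y. (\<forall>i<n. \<bar>y i - restrict s {..<n} i\<bar> < e) \<and> y \<notin> X))"
      unfolding relint_def by blast
    ultimately show ?thesis by (simp add: envs_def)
  qed
  have "df (\<lambda>s. restrict s {..<n} \<in> relint n Y X)"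
    unfolding eq
    by (rule dfn_intro dfn_ex_eqoff dfn_ball_finite finite_lessThan dset_mem[OF dX] dset_mem[OF dY])+
  then show ?thesis unfolding definable_iff_dfn using XF by (auto simp: relint_def)
qed

lemma definable_Diff:
  assumes "definable M n X" "definable M n Y" shows "definable M n (X - Y)"
proof -
  have "df (\<lambda>s. restrict s {..<n} \<in> X)" "df (\<lambda>s. restrict s {..<n} \<in> Y)" "X \<subseteq> Fspace n"
    using assms unfolding definable_iff_dfn by auto
  then show ?thesis unfolding definable_iff_dfn Diff_iff by (intro conjI dfn_conj dfn_not) auto
qed

lemma definable_singleton:
  assumes "x \<in> Fspace n" shows "definable M n {x}"
proof -
  have "restrict s {..<n} \<in> {x} \<longleftrightarrow> (\<forall>i\<in>{..<n}. s i = x i)" for s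
    using assms by (auto simp: Fspace_def fun_eq_iff PiE_def extensional_def)
  moreover have "df (\<lambda>s. \<forall>i\<in>{..<n}. s i = x i)" by (intro dfn_ball_finite dfn_intro) auto
  ultimately show ?thesis unfolding definable_iff_dfn using assms by simp
qed

definition erank :: "nat \<Rightarrow> (nat \<Rightarrow> 'a) set \<Rightarrow> (nat \<Rightarrow> 'a) set option" where
  "erank n X = (if X = {} then None else Some (code (lexmax (ranks n (envs n X)))))"

text \<open>Every point of the remainder has points of \<open>Y - X\<close> arbitrarily close to it,
  so the remainder contains no relatively open piece of \<open>Y\<close>.\<close>

lemma lexmax_ranks_relint:
  assumes X: "definable M n X" and Y: "definable M n Y" and sub: "X \<subseteq> Y"
    and ne: "X - relint n Y X \<noteq> {}"
  shows "lexle (lexmax (ranks n (envs n (X - relint n Y X)))) (lexmax (ranks n (envs n Y))) \<and>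
    lexmax (ranks n (envs n (X - relint n Y X))) \<noteq> lexmax (ranks n (envs n Y))"
proof -
  let ?Z = "X - relint n Y X"
  have "definable M n ?Z" using X Y sub by (intro definable_Diff definable_relint)
  then have ZF: "?Z \<subseteq> Fspace n" and dZ: "dset M (envs n ?Z)" unfolding definable_iff_envs by auto
  have YF: "Y \<subseteq> Fspace n" and dY: "dset M (envs n Y)" using Y unfolding definable_iff_envs by auto
  show ?thesis
  proof (rule lexmax_ranks_less[OF dZ dY _ envs_nonempty[OF ZF ne]])
    show "envs n ?Z \<subseteq> envs n Y" using sub unfolding envs_def by blast
    fix s and e :: 'a assume s: "s \<in> envs n ?Z" and e: "0 < e"
    have "\<exists>y\<in>Y. (\<forall>i<n. \<bar>y i - restrict s {..<n} i\<bar> < e) \<and> y \<notin> X"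
      using s e unfolding envs_def relint_def by blast
    then have "\<exists>y\<in>Y. (\<forall>i<n. \<bar>y i - s i\<bar> < e) \<and> y \<notin> X" by simp
    then obtain w where "eqoff {..<n} s w" "\<forall>i\<in>{..<n}. \<bar>w i - s i\<bar> < e" "w \<in> envs n Y"
        "restrict w {..<n} \<notin> X"
      unfolding restrict_near[OF YF, where s = s] by blast
    then show "\<exists>w. eqoff {..<n} s w \<and> (\<forall>i<n. \<bar>w i - s i\<bar> < e) \<and> w \<in> envs n Y \<and> w \<notin> envs n ?Z"
      unfolding envs_def by (intro exI[of _ w]) auto
  qed
qed

lemma good_extended_rank_erank: "good_extended_rank M n (range code) code_le (erank n)"
  unfolding good_extended_rank_def
proof (intro conjI allI impI)
  show "erank n \<in> {X. definable M n X} \<rightarrow> insert None (Some ` range code)"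
    by (auto simp: erank_def)
  show "linear_order_on (range code) (code_le :: (nat \<Rightarrow> 'a) set rel)" by (rule linear_order_code_le)
  have "lexle (0, 0) p" for p by (cases p) (auto simp: lexle_iff)
  then show "\<exists>e\<in>range code. \<forall>e'\<in>range code. (e, e') \<in> (code_le :: (nat \<Rightarrow> 'a) set rel)"
    by (intro bexI[of _ "code (0, 0)"]) auto
  show "(erank n X = None) = (X = {})" for X by (simp add: erank_def)
  show "\<not> (\<exists>s :: nat \<Rightarrow> (nat \<Rightarrow> 'a) set.
     \<forall>i. s i \<in> range code \<and> (s (Suc i), s i) \<in> code_le \<and> s (Suc i) \<noteq> s i)"
    by (rule no_descending_code)
next
  fix X Y assume "definable M n X \<and> definable M n Y"
  then have X: "X \<subseteq> Fspace n" "dset M (envs n X)" and Y: "Y \<subseteq> Fspace n" "dset M (envs n Y)"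
    unfolding definable_iff_envs by auto
  show "erank n (X \<union> Y) = rank_max code_le (erank n X) (erank n Y)"
  proof (cases "X = {} \<or> Y = {}")
    case True
    then show ?thesis by (auto simp: erank_def rank_max_def)
  next
    case False
    then have "is_lexmax (ranks n (envs n X)) (lexmax (ranks n (envs n X)))"
      "is_lexmax (ranks n (envs n Y)) (lexmax (ranks n (envs n Y)))"
      using X Y by (auto intro!: is_lexmax_ranks envs_nonempty)
    from is_lexmax_Un[OF this] have "lexmax (ranks n (envs n (X \<union> Y))) =
      (if lexle (lexmax (ranks n (envs n X))) (lexmax (ranks n (envs n Y)))
       then lexmax (ranks n (envs n Y)) else lexmax (ranks n (envs n X)))"
      unfolding envs_Un ranks_Un[OF X(2) Y(2)] by (rule lexmax_eq)
    then show ?thesis using False by (simp add: erank_def rank_max_def)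
  qed
next
  fix X Y assume *: "definable M n X \<and> definable M n Y \<and> X \<noteq> {} \<and> X \<subseteq> Y \<and> erank n X = erank n Y"
  then have X: "definable M n X" and Y: "definable M n Y" and sub: "X \<subseteq> Y" and "Y \<noteq> {}" by auto
  let ?U = "relint n Y X"
  have "definable M n ?U" by (rule definable_relint[OF X Y sub])
  moreover have "?U \<subseteq> X" unfolding relint_def by blast
  moreover have "openin (subtopology (Ftop n) Y) ?U"
    using openin_relint sub Y unfolding definable_iff_envs by blast
  moreover have "rank_less code_le (erank n (X - ?U)) (erank n Y)"
  proof (cases "X - ?U = {}")
    case True
    then show ?thesis using \<open>Y \<noteq> {}\<close> by (simp add: erank_def rank_less_def)
  next
    case False
    from lexmax_ranks_relint[OF X Y sub this] show ?thesis
      using False \<open>Y \<noteq> {}\<close> by (simp add: erank_def rank_less_def)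
  qed
  ultimately show "\<exists>U. definable M n U \<and> U \<subseteq> X \<and> openin (subtopology (Ftop n) Y) U \<and>
      rank_less code_le (erank n (X - U)) (erank n Y)" by blast
next
  fix X e assume *: "definable M n X \<and> X \<noteq> {} \<and> erank n X = Some e \<and> (\<forall>e'\<in>range code. (e, e') \<in> code_le)"
  then have X: "definable M n X" and XF: "X \<subseteq> Fspace n" unfolding definable_iff_envs by auto
  have "X \<noteq> {}" "erank n X = Some e" using * by blast+
  then have e: "e = code (lexmax (ranks n (envs n X)))" by (simp add: erank_def)
  have "(e, code p) \<in> code_le" for p using * by blast
  then have min: "lexle (lexmax (ranks n (envs n X))) p" for p unfolding e code_le_iff .
  have "openin (subtopology (Ftop n) X) {x}" if x: "x \<in> X" for x
  proof -
    have sing: "definable M n {x}" using x XF by (intro definable_singleton) blast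
    have sub: "{x} \<subseteq> X" using x by simp
    \<comment> \<open>If \<open>x\<close> were not isolated in \<open>X\<close>, the singleton would
      have a rank strictly below that of \<open>X\<close>, which is minimal.\<close>
    have "{x} - relint n X {x} = {}"
    proof (rule ccontr)
      assume "{x} - relint n X {x} \<noteq> {}"
      from lexmax_ranks_relint[OF sing X sub this] min show False using lexle_antisym by blast
    qed
    then have "relint n X {x} = {x}" by (auto simp: relint_def)
    then show ?thesis using openin_relint[OF sub XF] by simp
  qed
  moreover have "topspace (subtopology (Ftop n) X) = X"
    using XF by (auto simp: Ftop_def Fspace_def)
  ultimately have "discrete_topology X = subtopology (Ftop n) X"
    by (subst discrete_topology_unique) simp
  then show "subtopology (Ftop n) X = discrete_topology X" by simp
qed

lemma extended_rank: "has_good_extended_rank M"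
  unfolding has_good_extended_rank_def using good_extended_rank_erank by blast

end

section \<open>Definable choice\<close>

lemma restrict_add:
  "restrict s {..<m + n} = cat m (restrict s {..<m}) (\<lambda>i\<in>{..<n}. s (m + i))"
  by (auto simp: cat_def fun_eq_iff)

lemma cat_inject:
  assumes "x \<in> Fspace m" "x' \<in> Fspace m" "cat m x y = cat m x' y'" shows "x = x' \<and> y = y'"
proof
  show "y = y'"
  proof
    fix i show "y i = y' i" using fun_cong[OF assms(3), of "m + i"] by (simp add: cat_def)
  qed
  show "x = x'"
  proof
    fix i show "x i = x' i"
    proof (cases "i < m")
      case True
      then show ?thesis using fun_cong[OF assms(3), of i] by (simp add: cat_def)
    next
      case False
      then show ?thesis using assms(1,2) by (auto simp: Fspace_def PiE_def extensional_def)
    qed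
  qed
qed

lemma restrict_Fspace [simp]: "restrict s {..<n} \<in> Fspace n"
  by (simp add: Fspace_def)

lemma Fspace_restrict: "x \<in> Fspace n \<Longrightarrow> restrict x {..<n} = x"
  by (auto simp: Fspace_def PiE_def extensional_def fun_eq_iff)

context d_minimal_field
begin

lemma dterm_restrict:
  assumes "dt (\<lambda>s. g s i)" shows "dt (\<lambda>s. g (restrict s {..<m}) i)"
proof (rule dterm_subst[where t = "\<lambda>s. g s i", OF assms])
  show "dt (\<lambda>s. restrict s {..<m} j)" for j
    unfolding restrict_def by (intro dfn_intro)
qed

text \<open>The environment carries \<open>x\<close> in its first \<open>m\<close> places and a
  candidate from \<open>Y\<close> in the next \<open>m + n\<close>. The equations
  \<open>s (m + \<sigma> i) = s i\<close> express that the candidate projects to \<open>x\<close>,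
  for whichever coordinates are selected.\<close>

lemma definable_section:
  assumes \<sigma>: "\<sigma> \<in> {..<m} \<rightarrow> {..<m + n}" and X: "definable M m X" and Y: "definable M (m + n) Y"
    and XY: "coord_proj m \<sigma> ` Y = X"
  shows "\<exists>\<phi>. definable_map M m (m + n) X Y \<phi> \<and> (\<forall>x\<in>X. coord_proj m \<sigma> (\<phi> x) = x)"
proof -
  have XF: "X \<subseteq> Fspace m" and dX: "df (\<lambda>s. restrict s {..<m} \<in> X)"
    and YF: "Y \<subseteq> Fspace (m + n)" and dY: "df (\<lambda>s. restrict s {..<m + n} \<in> Y)"
    using X Y unfolding definable_iff_dfn by auto
  define I where "I = {m..<m + (m + n)}"
  define A where "A = {s. (\<lambda>i\<in>{..<m + n}. s (m + i)) \<in> Y \<and> (\<forall>i\<in>{..<m}. s (m + \<sigma> i) = s i)}"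
  have dA: "dset M A" unfolding A_def mem_Collect_eq
    by (intro dfn_conj dfn_ball_finite finite_lessThan dfn_eq dterm_var
        dfn_subst[OF dY, where g = "\<lambda>s i. s (m + i)"])
  have "finite I" by (simp add: I_def)
  from env_choice[OF this dA] obtain g where g: "\<forall>i. dt (\<lambda>x. g x i)"
    "\<forall>x. (\<exists>y. eqoff I x y \<and> y \<in> A) \<longrightarrow> g x \<in> A \<and> eqoff I x (g x)"
    by (elim exE conjE)
  define \<phi> where "\<phi> x = (\<lambda>i\<in>{..<m + n}. g x (m + i))" for x
  have sel: "\<phi> x \<in> Y \<and> coord_proj m \<sigma> (\<phi> x) = x" if x: "x \<in> X" for x
  proof -
    obtain y where y: "y \<in> Y" "coord_proj m \<sigma> y = x" using XY x by blast
    define s where "s i = (if i \<in> I then y (i - m) else x i)" for i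
    have "(\<lambda>i\<in>{..<m + n}. s (m + i)) = restrict y {..<m + n}"
      by (auto simp: s_def I_def fun_eq_iff)
    moreover have "y \<in> Fspace (m + n)" using y(1) YF by blast
    ultimately have "(\<lambda>i\<in>{..<m + n}. s (m + i)) \<in> Y" using y(1) by (simp add: Fspace_restrict)
    moreover have "s (m + \<sigma> i) = s i" if i: "i \<in> {..<m}" for i
    proof -
      have "\<sigma> i < m + n" using \<sigma> i by auto
      moreover have "x i = y (\<sigma> i)" using y(2) i by (auto simp: coord_proj_def)
      ultimately show ?thesis using i by (simp add: s_def I_def)
    qed
    ultimately have "s \<in> A" by (simp add: A_def)
    moreover have "eqoff I x s" by (simp add: eqoff_def s_def)
    ultimately have gA: "g x \<in> A" "eqoff I x (g x)" using g(2) by blast+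
    have "coord_proj m \<sigma> (\<phi> x) i = x i" for i
    proof (cases "i < m")
      case True
      then have "\<sigma> i < m + n" using \<sigma> by auto
      then have "coord_proj m \<sigma> (\<phi> x) i = g x (m + \<sigma> i)" using True by (simp add: coord_proj_def \<phi>_def)
      also have "\<dots> = g x i" using gA(1) True by (simp add: A_def)
      also have "\<dots> = x i" using gA(2) True by (simp add: eqoff_def I_def)
      finally show ?thesis .
    next
      case False
      then show ?thesis using x XF by (auto simp: coord_proj_def Fspace_def PiE_def extensional_def)
    qed
    then show ?thesis using gA(1) by (auto simp: A_def \<phi>_def)
  qed
  have graph: "restrict s {..<m + (m + n)} \<in> (\<lambda>x. cat m x (\<phi> x)) ` X \<longleftrightarrow>
      restrict s {..<m} \<in> X \<and> (\<forall>i\<in>{..<m + n}. s (m + i) = g (restrict s {..<m}) (m + i))" for s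
  proof
    assume "restrict s {..<m + (m + n)} \<in> (\<lambda>x. cat m x (\<phi> x)) ` X"
    then obtain x where x: "x \<in> X" "cat m (restrict s {..<m}) (\<lambda>i\<in>{..<m + n}. s (m + i)) = cat m x (\<phi> x)"
      unfolding restrict_add[of s m "m + n"] by blast
    then have "restrict s {..<m} = x" "(\<lambda>i\<in>{..<m + n}. s (m + i)) = \<phi> x"
      using cat_inject[OF restrict_Fspace _ x(2)] XF by auto
    moreover from this(2) have "s (m + i) = g x (m + i)" if "i < m + n" for i
      using that by (auto simp: \<phi>_def dest: fun_cong[of _ _ i])
    ultimately show "restrict s {..<m} \<in> X \<and>
        (\<forall>i\<in>{..<m + n}. s (m + i) = g (restrict s {..<m}) (m + i))" using x(1) by simp
  next
    assume *: "restrict s {..<m} \<in> X \<and> (\<forall>i\<in>{..<m + n}. s (m + i) = g (restrict s {..<m}) (m + i))"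
    then have "(\<lambda>i\<in>{..<m + n}. s (m + i)) = \<phi> (restrict s {..<m})" by (auto simp: \<phi>_def fun_eq_iff)
    then show "restrict s {..<m + (m + n)} \<in> (\<lambda>x. cat m x (\<phi> x)) ` X"
      unfolding restrict_add[of s m "m + n"] using * by auto
  qed
  have "df (\<lambda>s. restrict s {..<m + (m + n)} \<in> (\<lambda>x. cat m x (\<phi> x)) ` X)"
    unfolding graph
    by (intro dfn_conj dX dfn_ball_finite finite_lessThan dfn_eq dterm_var dterm_restrict g(1)[rule_format])
  moreover have "(\<lambda>x. cat m x (\<phi> x)) ` X \<subseteq> Fspace (m + (m + n))"
    by (auto simp: cat_def \<phi>_def Fspace_def PiE_def extensional_def)
  ultimately have "definable M (m + (m + n)) ((\<lambda>x. cat m x (\<phi> x)) ` X)"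
    unfolding definable_iff_dfn by (intro conjI)
  then have "definable_map M m (m + n) X Y \<phi>" unfolding definable_map_def using X Y sel by blast
  then show ?thesis using sel by blast
qed

text \<open>Related points have the same class, hence the same fibre, and the choice
  \<open>h\<close> sees only the fibre. So \<open>h\<close> is constant on classes, and its fixed
  points form the transversal.\<close>

lemma definable_transversal:
  assumes X: "definable M n X" and E: "equiv X E" and dE: "definable M (n + n) ((\<lambda>(x, y). cat n x y) ` E)"
  shows "\<exists>S. definable M n S \<and> S \<subseteq> X \<and> (\<forall>C\<in>X // E. \<exists>!s. s \<in> S \<inter> C)"
proof -
  have XF: "X \<subseteq> Fspace n" and dX: "df (\<lambda>s. restrict s {..<n} \<in> X)"
    using X unfolding definable_iff_dfn by auto
  have EX: "x \<in> X" "y \<in> X" if "(x, y) \<in> E" for x y using E that equiv_type by blast+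
  define A where "A = {s. (restrict s {..<n}, \<lambda>i\<in>{..<n}. s (n + i)) \<in> E}"
  have A_iff: "restrict s {..<n + n} \<in> (\<lambda>(x, y). cat n x y) ` E \<longleftrightarrow> s \<in> A" for s
  proof
    assume "restrict s {..<n + n} \<in> (\<lambda>(x, y). cat n x y) ` E"
    then obtain x y where xy: "(x, y) \<in> E" "cat n (restrict s {..<n}) (\<lambda>i\<in>{..<n}. s (n + i)) = cat n x y"
      unfolding restrict_add[of s n n] by auto
    then show "s \<in> A" using cat_inject[OF restrict_Fspace _ xy(2)] EX[OF xy(1)] XF
      unfolding A_def by auto
  next
    assume "s \<in> A"
    then show "restrict s {..<n + n} \<in> (\<lambda>(x, y). cat n x y) ` E"
      unfolding restrict_add[of s n n] A_def by force
  qed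
  have "dset M A" using dE unfolding definable_iff_dfn A_iff by blast
  define I where "I = {n..<n + n}"
  have "finite I" by (simp add: I_def)
  from env_choice[OF this \<open>dset M A\<close>] obtain g where g: "\<forall>i. dt (\<lambda>x. g x i)"
    "\<forall>x. (\<exists>y. eqoff I x y \<and> y \<in> A) \<longrightarrow> g x \<in> A \<and> eqoff I x (g x)"
    "\<forall>x x'. (\<forall>z. override_on x z I \<in> A \<longleftrightarrow> override_on x' z I \<in> A) \<longrightarrow> (\<forall>i\<in>I. g x i = g x' i)"
    by (elim exE conjE)
  define h where "h x = (\<lambda>i\<in>{..<n}. g x (n + i))" for x
  have hE: "(x, h x) \<in> E" if x: "x \<in> X" for x
  proof -
    have ext: "restrict x {..<n} = x" using x XF Fspace_restrict by blast
    define s where "s i = (if i \<in> I then x (i - n) else x i)" for i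
    have "restrict s {..<n} = restrict x {..<n}" "(\<lambda>i\<in>{..<n}. s (n + i)) = restrict x {..<n}"
      by (auto simp: s_def I_def fun_eq_iff)
    moreover have "(x, x) \<in> E" using E x by (meson equiv_def refl_onD)
    ultimately have "s \<in> A" unfolding A_def by (simp add: ext)
    moreover have "eqoff I x s" by (simp add: eqoff_def s_def)
    ultimately have gA: "g x \<in> A" "eqoff I x (g x)" using g(2) by blast+
    have "restrict (g x) {..<n} = restrict x {..<n}" using gA(2) by (auto simp: eqoff_def I_def fun_eq_iff)
    then show ?thesis using gA(1) unfolding A_def h_def by (simp add: ext)
  qed
  have h_cong: "h x = h x'" if xx: "(x, x') \<in> E" for x x'
  proof -
    have ov: "override_on w z I \<in> A \<longleftrightarrow> (restrict w {..<n}, \<lambda>i\<in>{..<n}. z (n + i)) \<in> E" for w z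
    proof -
      have "restrict (override_on w z I) {..<n} = restrict w {..<n}"
        "(\<lambda>i\<in>{..<n}. override_on w z I (n + i)) = (\<lambda>i\<in>{..<n}. z (n + i))"
        by (auto simp: override_on_def I_def fun_eq_iff)
      then show ?thesis by (simp add: A_def)
    qed
    have "restrict x {..<n} = x" "restrict x' {..<n} = x'"
      using EX[OF xx] XF Fspace_restrict by blast+
    moreover have "(x, y) \<in> E \<longleftrightarrow> (x', y) \<in> E" for y
      using xx E by (meson equivE symD transD)
    ultimately have "\<forall>z. override_on x z I \<in> A \<longleftrightarrow> override_on x' z I \<in> A" unfolding ov by simp
    then have "\<forall>i\<in>I. g x i = g x' i" using g(3) by blast
    then show ?thesis by (auto simp: h_def I_def fun_eq_iff)
  qed
  define S where "S = {x\<in>X. h x = x}"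
  have "restrict s {..<n} \<in> S \<longleftrightarrow>
      restrict s {..<n} \<in> X \<and> (\<forall>i\<in>{..<n}. g (restrict s {..<n}) (n + i) = s i)" for s
    by (auto simp: S_def h_def fun_eq_iff)
  moreover have "df (\<lambda>s. restrict s {..<n} \<in> X \<and> (\<forall>i\<in>{..<n}. g (restrict s {..<n}) (n + i) = s i))"
    by (intro dfn_conj dX dfn_ball_finite finite_lessThan dfn_eq dterm_var dterm_restrict g(1)[rule_format])
  ultimately have "definable M n S" unfolding definable_iff_dfn using XF by (auto simp: S_def)
  moreover have "\<exists>!s. s \<in> S \<inter> C" if C: "C \<in> X // E" for C
  proof -
    obtain x where x: "x \<in> X" "C = E `` {x}" using C by (rule quotientE)
    have "h x \<in> C" using hE[OF x(1)] x(2) by blast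
    moreover have "h x \<in> S" unfolding S_def using h_cong[OF hE[OF x(1)]] EX(2)[OF hE[OF x(1)]] by simp
    moreover have "s = h x" if "s \<in> S \<inter> C" for s
      using that h_cong[of x s] x(2) unfolding S_def by auto
    ultimately show ?thesis by blast
  qed
  ultimately show ?thesis by (intro exI[of _ S]) (auto simp: S_def)
qed

lemma choice_property: "definable_choice M"
  unfolding definable_choice_def
  by (intro conjI allI impI; elim conjE) (rule definable_section definable_transversal; assumption)+

end

theorem theorem7p22:
  fixes M :: "('a::{linordered_field, linorder_topology}, 'f, 'r) fo_structure"
  assumes "expands_ordered_field M"
    and "d_minimal M"
  shows "expands_ordered_field M \<and> definably_complete M \<and> definable_choice M \<and>
         admits_good_pseudo_filter M \<and> has_good_extended_rank M"
proof -
  interpret d_minimal_field M using assms by unfold_locales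
  show ?thesis
    using assms choice_property pseudo_filter extended_rank unfolding d_minimal_def by blast
qed

end
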